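(* Let $S$ be a finite nonempty set of positive integers with $\max(S)=i$. Then the sequence $(\beta_S(\Pi_n))_{n\ge i+2}$ of $S_n$-characters stabilizes beyond $n=4i$. Moreover, when $S=\{i\}$, it stabilizes sharply at $n=4i$.
   Context: $\Pi_n$ is the lattice of set partitions of $\{1,\dots,n\}$ ordered by refinement ($\pi\le\sigma$ if every block of $\sigma$ is a union of blocks of $\pi$), graded with $\mathrm{rank}(\pi)=n-(\text{number of blocks of }\pi)$, so ranks run from $0$ to $n-1$; $S_n$ acts on it. For $T\subseteq\{1,\dots,n-2\}$, let $\Pi_n^T=\{\pi:\mathrm{rank}(\pi)\in T\}$ and let $\alpha_T(\Pi_n)$ be the character of the permutation representation of $S_n$ on the set of maximal chains of $\Pi_n^T$ (for $T=\emptyset$ this is the trivial character). Define $\beta_S(\Pi_n)=\sum_{T\subseteq S}(-1)^{|S\setminus T|}\alpha_T(\Pi_n)$ (which equals the character of the top reduced homology of the order complex of $\Pi_n^S$). Stabilization: for a partition $\lambda$ and $m\ge0$, $\lambda+(m)=(\lambda_1+m,\lambda_2,\dots)$; for $\chi=\sum c_\lambda\chi^\lambda$ set $\chi^{(+m)}=\sum c_\lambda\chi^{\lambda+(m)}$. A sequence $(\chi_n)$ stabilizes beyond $n_0$ if $\chi_n=\chi_{n_0}^{(+(n-n_0))}$ for all $n\ge n_0$, and sharply at $n_0$ if $n_0$ is minimal with this property. *)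

theory Defs
  imports Main "HOL-Library.Disjoint_Sets" "HOL-Library.FuncSet" "HOL-Combinatorics.Permutations"
begin

definition setpart :: "nat \<Rightarrow> nat set set \<Rightarrow> bool" where
  "setpart n P \<longleftrightarrow> partition_on {1..n} P"

definition prank :: "nat \<Rightarrow> nat set set \<Rightarrow> nat" where
  "prank n P = n - card P"

definition refines :: "nat set set \<Rightarrow> nat set set \<Rightarrow> bool" where
  "refines P Q \<longleftrightarrow> (\<forall>C\<in>Q. \<exists>X\<subseteq>P. C = \<Union>X)"

definition rank_sel :: "nat \<Rightarrow> nat set \<Rightarrow> nat set set set" where
  "rank_sel n T = {P. setpart n P \<and> prank n P \<in> T}"

definition is_chain :: "nat \<Rightarrow> nat set \<Rightarrow> nat set set set \<Rightarrow> bool" where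
  "is_chain n T C \<longleftrightarrow> C \<subseteq> rank_sel n T \<and>
     (\<forall>x\<in>C. \<forall>y\<in>C. refines x y \<or> refines y x)"

definition max_chains :: "nat \<Rightarrow> nat set \<Rightarrow> nat set set set set" where
  "max_chains n T = {C. is_chain n T C \<and> \<not> (\<exists>D. is_chain n T D \<and> C \<subset> D)}"

definition act_part :: "(nat \<Rightarrow> nat) \<Rightarrow> nat set set \<Rightarrow> nat set set" where
  "act_part \<sigma> P = (\<lambda>B. \<sigma> ` B) ` P"

definition act_chain :: "(nat \<Rightarrow> nat) \<Rightarrow> nat set set set \<Rightarrow> nat set set set" where
  "act_chain \<sigma> C = act_part \<sigma> ` C"

text \<open>alpha_T(Pi_n): permutation character on maximal chains of Pi_n^T
  (evaluated at permutations \<sigma> of {1..n}).\<close>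
definition alphaT :: "nat \<Rightarrow> nat set \<Rightarrow> (nat \<Rightarrow> nat) \<Rightarrow> int" where
  "alphaT n T \<sigma> = int (card {C \<in> max_chains n T. act_chain \<sigma> C = C})"

definition betaS :: "nat \<Rightarrow> nat set \<Rightarrow> (nat \<Rightarrow> nat) \<Rightarrow> int" where
  "betaS n S \<sigma> = (\<Sum>T\<in>Pow S. (-1) ^ card (S - T) * alphaT n T \<sigma>)"

definition is_int_partition :: "nat \<Rightarrow> nat list \<Rightarrow> bool" where
  "is_int_partition n lam \<longleftrightarrow> sorted_wrt (\<ge>) lam \<and> (\<forall>x\<in>set lam. 0 < x) \<and> sum_list lam = n"

definition int_partitions :: "nat \<Rightarrow> nat list set" where
  "int_partitions n = {lam. is_int_partition n lam}"

text \<open>Young permutation character eta^alpha for a weak composition alpha (with entries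
  in int; zero if some entry is negative): number of ordered set partitions of {1..n}
  of type alpha fixed by \<sigma>.\<close>
definition young_char :: "nat \<Rightarrow> int list \<Rightarrow> (nat \<Rightarrow> nat) \<Rightarrow> int" where
  "young_char n a \<sigma> =
    (if (\<exists>x\<in>set a. x < 0) then 0 else
     int (card {f. f \<in> {1..n} \<rightarrow>\<^sub>E {..<length a} \<and>
                 (\<forall>j<length a. int (card {x\<in>{1..n}. f x = j}) = a ! j) \<and>
                 (\<forall>x\<in>{1..n}. f (\<sigma> x) = f x)}))"

text \<open>Irreducible character chi^lambda, via the Frobenius/Jacobi-Trudi determinantal
  formula chi^lambda = det(eta^(lambda_i - i + j)).\<close>
definition irr_char :: "nat \<Rightarrow> nat list \<Rightarrow> (nat \<Rightarrow> nat) \<Rightarrow> int" where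
  "irr_char n lam \<sigma> =
    (\<Sum>w\<in>{w. w permutes {..<length lam}}.
       sign w * young_char n (map (\<lambda>j. int (lam ! j) - int j + int (w j)) [0..<length lam]) \<sigma>)"

definition shift_part :: "nat list \<Rightarrow> nat \<Rightarrow> nat list" where
  "shift_part lam m = (case lam of [] \<Rightarrow> [m] | x # xs \<Rightarrow> (x + m) # xs)"

text \<open>chi_n = chi_{n0}^{(+(n-n0))} for all n \<ge> n0, where chi_{n0} = sum c_lambda chi^lambda
  (the decomposition into irreducibles is unique).\<close>
definition stabilizes_beyond :: "(nat \<Rightarrow> (nat \<Rightarrow> nat) \<Rightarrow> int) \<Rightarrow> nat \<Rightarrow> bool" where
  "stabilizes_beyond \<chi> n0 \<longleftrightarrow>
     (\<exists>c :: nat list \<Rightarrow> int.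
        (\<forall>\<sigma>. \<sigma> permutes {1..n0} \<longrightarrow>
            \<chi> n0 \<sigma> = (\<Sum>lam\<in>int_partitions n0. c lam * irr_char n0 lam \<sigma>)) \<and>
        (\<forall>n\<ge>n0. \<forall>\<sigma>. \<sigma> permutes {1..n} \<longrightarrow>
            \<chi> n \<sigma> = (\<Sum>lam\<in>int_partitions n0. c lam * irr_char n (shift_part lam (n - n0)) \<sigma>)))"

definition stabilizes_sharply_at :: "(nat \<Rightarrow> (nat \<Rightarrow> nat) \<Rightarrow> int) \<Rightarrow> nat \<Rightarrow> nat \<Rightarrow> bool" where
  "stabilizes_sharply_at \<chi> d n0 \<longleftrightarrow>
     d \<le> n0 \<and> stabilizes_beyond \<chi> n0 \<and> (\<forall>n'. d \<le> n' \<and> n' < n0 \<longrightarrow> \<not> stabilizes_beyond \<chi> n')"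

end

theory Submission
  imports Defs "HOL-Combinatorics.Orbits" "HOL-Computational_Algebra.Polynomial"
begin

text \<open>The non-singleton blocks of a chain of partitions of rank at most \<open>i\<close> cover at most \<open>2i\<close> points,
  so \<open>\<alpha>\<^sub>T\<close> is a sum, over \<open>k \<le> 2i\<close>, of characters induced from
  \<open>\<phi>\<^sub>k \<times> 1\<close> on \<open>S\<^sub>k \<times> S\<^sub>n\<^sub>-\<^sub>k\<close>, with permutation characters \<open>\<phi>\<^sub>k\<close> that do not depend on
  \<open>n\<close>. Every permutation character of \<open>S\<^sub>k\<close> is an integer combination of Young characters
  \<open>\<eta>\<^sup>\<gamma>\<close>: the multiplicities of the sign characters of Young subgroups are integers, are
  unitriangular on the \<open>\<eta>\<^sup>\<gamma>\<close> (0-1 matrices with given margins), and determine a class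
  function. Expanding the Jacobi-Trudi determinant of \<open>(n - |\<kappa>|, \<kappa>)\<close> along its first row
  rewrites the Young character of type \<open>(n - k, \<gamma>)\<close> in terms of the irreducible characters of shape
  \<open>(n - |\<kappa>|, \<kappa>)\<close> with \<open>|\<kappa>| \<le> k\<close>, with coefficients independent of \<open>n \<ge> 2k\<close>.
  For sharpness, pairing with the irreducible character of shape \<open>(2i, 2i)\<close> annihilates
  everything shifted from a smaller \<open>n\<close>, but not \<open>\<beta>\<close> at \<open>n = 4i\<close>, because of the
  perfect matchings of \<open>2i\<close> points.\<close>


subsection \<open>Colourings and Young permutation characters\<close>

text \<open>The irreducible characters enter only as Jacobi-Trudi determinants of Young characters,
  so nothing is decomposed into modules: every multiplicity is a sum over permutations, evaluated by
  double counting of fixed points. The coefficients \<open>c\<close> must be integers, so linear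
  algebra over the rationals would not do, and a pairing matrix that is unitriangular over the
  integers is used instead. Two factors of 2 give 4i: a block with b \<ge> 2 points has rank b - 1
  \<ge> b/2, so rank i reaches at most 2i points; and (n - |\<kappa>|, \<kappa>) is a partition for
  every |\<kappa>| \<le> K only from n = 2K on. The character \<beta> needs no separate treatment,
  being an integer combination of the \<alpha> of subsets of S. The pairing with the shape (2i, 2i)
  is read in two variables: a part a of a Young character corresponds to the factor h_a(1, t) = 1 +
  t + ... + t^a, and the multiplicity is a difference of two neighbouring coefficients. Of the
  shifted shapes, those with three or more rows then vanish, and those with at most two rows vanish
  by degree.\<close>

definition colorings :: "'a set \<Rightarrow> 'c set \<Rightarrow> ('c \<Rightarrow> nat) \<Rightarrow> ('a \<Rightarrow> 'c) set" where
  "colorings A J m = {f \<in> A \<rightarrow>\<^sub>E J. \<forall>j\<in>J. card {x\<in>A. f x = j} = m j}"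

abbreviation fixed_colorings :: "'a set \<Rightarrow> 'c set \<Rightarrow> ('c \<Rightarrow> nat) \<Rightarrow> ('a \<Rightarrow> 'a) \<Rightarrow> ('a \<Rightarrow> 'c) set" where
  "fixed_colorings A J m \<sigma> \<equiv> {f \<in> colorings A J m. \<forall>x\<in>A. f (\<sigma> x) = f x}"

text \<open>Young permutation character of type \<open>m\<close> at \<open>\<sigma>\<close>. Ground
  set and colour set are left arbitrary: later \<open>A\<close> is an invariant subset of {1..n},
  and \<open>J\<close> a product of two colour sets.\<close>

definition fixcol :: "'a set \<Rightarrow> 'c set \<Rightarrow> ('c \<Rightarrow> nat) \<Rightarrow> ('a \<Rightarrow> 'a) \<Rightarrow> nat" where
  "fixcol A J m \<sigma> = card (fixed_colorings A J m \<sigma>)"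

lemma finite_colorings [simp]: "finite A \<Longrightarrow> finite J \<Longrightarrow> finite (colorings A J m)"
  unfolding colorings_def by (rule finite_subset[of _ "A \<rightarrow>\<^sub>E J"]) (auto intro: finite_PiE)

text \<open>Fibres over the same colour have equal size, so one bijection per colour can be chosen,
  and these glue to a permutation of \<open>A\<close>.\<close>

lemma colorings_transitive:
  assumes "finite A" "f \<in> colorings A J m" "g \<in> colorings A J m"
  obtains \<tau> where "\<tau> permutes A" "\<And>x. x \<in> A \<Longrightarrow> f (\<tau> x) = g x"
proof -
  have "\<exists>h. bij_betw h {x\<in>A. g x = j} {x\<in>A. f x = j}" if "j \<in> J" for j
    using assms that by (intro finite_same_card_bij) (auto simp: colorings_def)
  then obtain h where h: "\<And>j. j \<in> J \<Longrightarrow> bij_betw (h j) {x\<in>A. g x = j} {x\<in>A. f x = j}"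
    by metis
  have gJ: "g x \<in> J" if "x \<in> A" for x
    using assms(3) that by (auto simp: colorings_def)
  define \<tau> where "\<tau> = (\<lambda>x. if x \<in> A then h (g x) x else x)"
  have t: "\<tau> x \<in> A \<and> f (\<tau> x) = g x" if "x \<in> A" for x
    using bij_betw_apply[OF h[OF gJ[OF that]], of x] that by (auto simp: \<tau>_def)
  have "inj_on \<tau> A"
  proof (rule inj_onI)
    fix x y assume xy: "x \<in> A" "y \<in> A" "\<tau> x = \<tau> y"
    then have "g x = g y" using t by metis
    then show "x = y"
      using xy bij_betw_imp_inj_on[OF h[OF gJ[OF xy(1)]]] by (auto simp: \<tau>_def inj_on_def)
  qed
  then have "\<tau> permutes A"
    using assms(1) t by (intro inj_imp_permutes) (auto simp: \<tau>_def)
  then show thesis using that t by blast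
qed

lemma colorings_comp:
  assumes "f \<in> colorings A J m" "\<tau> permutes A"
  shows "restrict (f \<circ> \<tau>) A \<in> colorings A J m"
proof -
  have "card {x \<in> A. restrict (f \<circ> \<tau>) A x = j} = card {x\<in>A. f x = j}" for j
  proof (rule bij_betw_same_card)
    show "bij_betw \<tau> {x \<in> A. restrict (f \<circ> \<tau>) A x = j} {x\<in>A. f x = j}"
    proof (rule bij_betw_imageI)
      show "inj_on \<tau> {x \<in> A. restrict (f \<circ> \<tau>) A x = j}"
        using assms(2) by (simp add: permutes_inj_on)
      show "\<tau> ` {x \<in> A. restrict (f \<circ> \<tau>) A x = j} = {x\<in>A. f x = j}"
      proof (intro equalityI subsetI)
        fix y assume "y \<in> {x\<in>A. f x = j}"
        then have "inv \<tau> y \<in> {x \<in> A. restrict (f \<circ> \<tau>) A x = j}" "y = \<tau> (inv \<tau> y)"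
          using permutes_inverses[OF assms(2)] permutes_in_image[OF permutes_inv[OF assms(2)]] by auto
        then show "y \<in> \<tau> ` {x \<in> A. restrict (f \<circ> \<tau>) A x = j}" by blast
      qed (use permutes_in_image[OF assms(2)] in auto)
    qed
  qed
  then show ?thesis using assms permutes_in_image[OF assms(2)]
    by (auto simp: colorings_def PiE_iff Pi_iff)
qed

text \<open>A bijection of \<open>A\<close> with a disjoint union of \<open>m j\<close> slots for
  each colour \<open>j\<close> is followed by the projection to the colour.\<close>

lemma colorings_nonempty:
  assumes "finite A" "finite J" "sum m J = card A"
  shows "colorings A J m \<noteq> {}"
proof -
  have "card (SIGMA j:J. {..<m j}) = card A"
    using assms by simp
  then obtain h where h: "bij_betw h A (SIGMA j:J. {..<m j})"
    using assms by (metis finite_SigmaI finite_lessThan finite_same_card_bij)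
  define f where "f = restrict (fst \<circ> h) A"
  have "card {x\<in>A. f x = j} = m j" if "j \<in> J" for j
  proof -
    have "h ` {x\<in>A. f x = j} = {j} \<times> {..<m j}"
    proof (intro equalityI subsetI)
      fix y assume "y \<in> {j} \<times> {..<m j}"
      then have "y \<in> (SIGMA j:J. {..<m j})" "fst y = j" using that by auto
      then obtain x where "x \<in> A" "h x = y" using bij_betw_imp_surj_on[OF h] by (metis imageE)
      with \<open>fst y = j\<close> show "y \<in> h ` {x\<in>A. f x = j}" by (auto simp: f_def)
    next
      fix y assume "y \<in> h ` {x\<in>A. f x = j}"
      then obtain x where x: "x \<in> A" "f x = j" "y = h x" by blast
      then show "y \<in> {j} \<times> {..<m j}" using bij_betw_apply[OF h, of x] by (auto simp: f_def)
    qed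
    moreover have "inj_on h {x\<in>A. f x = j}"
      using bij_betw_imp_inj_on[OF h] by (auto simp: inj_on_def)
    ultimately have "card {x\<in>A. f x = j} = card ({j} \<times> {..<m j})"
      by (metis card_image)
    then show ?thesis by (simp add: card_cartesian_product)
  qed
  moreover have "fst (h x) \<in> J" if "x \<in> A" for x
    using bij_betw_apply[OF h that] by auto
  then have "f \<in> A \<rightarrow>\<^sub>E J" by (auto simp: f_def)
  ultimately have "f \<in> colorings A J m" by (auto simp: colorings_def)
  then show ?thesis by blast
qed

section \<open>Fixed points, stabilisers and sign sums\<close>

lemma sum_card_swap:
  fixes w :: "'g \<Rightarrow> 'r::comm_semiring_1"
  assumes "finite G" "finite X"
  shows "(\<Sum>\<sigma>\<in>G. w \<sigma> * of_nat (card {x\<in>X. P \<sigma> x})) = (\<Sum>x\<in>X. \<Sum>\<sigma>\<in>{\<sigma>\<in>G. P \<sigma> x}. w \<sigma>)"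
proof -
  have "w \<sigma> * of_nat (card {x\<in>X. P \<sigma> x}) = (\<Sum>x\<in>X. if P \<sigma> x then w \<sigma> else 0)" for \<sigma>
    using assms by (simp add: sum.If_cases Int_def mult.commute)
  then have "(\<Sum>\<sigma>\<in>G. w \<sigma> * of_nat (card {x\<in>X. P \<sigma> x})) =
      (\<Sum>\<sigma>\<in>G. \<Sum>x\<in>X. if P \<sigma> x then w \<sigma> else 0)" by simp
  also have "\<dots> = (\<Sum>x\<in>X. \<Sum>\<sigma>\<in>G. if P \<sigma> x then w \<sigma> else 0)" by (rule sum.swap)
  also have "\<dots> = (\<Sum>x\<in>X. \<Sum>\<sigma>\<in>{\<sigma>\<in>G. P \<sigma> x}. w \<sigma>)"
    using assms by (simp add: sum.If_cases Int_def)
  finally show ?thesis .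
qed

text \<open>Burnside's count for a transitive action: the trivial character occurs exactly once in a
  Young character.\<close>

lemma sum_fixcol:
  assumes "finite A" "finite J" "sum m J = card A"
  shows "(\<Sum>\<sigma> | \<sigma> permutes A. fixcol A J m \<sigma>) = fact (card A)"
proof -
  let ?G = "{\<sigma>. \<sigma> permutes A}" and ?C = "colorings A J m"
  have finG: "finite ?G" using assms by (simp add: finite_permutations)
  obtain f0 where f0: "f0 \<in> ?C" using colorings_nonempty[OF assms] by blast
  have "(\<Sum>\<sigma>\<in>?G. fixcol A J m \<sigma>) = (\<Sum>f\<in>?C. \<Sum>\<sigma>\<in>{\<sigma>\<in>?G. \<forall>x\<in>A. f (\<sigma> x) = f x}. 1)"
    using sum_card_swap[of ?G ?C "\<lambda>_. 1::nat" "\<lambda>\<sigma> f. \<forall>x\<in>A. f (\<sigma> x) = f x"] assms finG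
    by (simp add: fixcol_def)
  \<comment> \<open>The stabiliser of \<open>f\<close> is exchanged for the equally large set of
    permutations carrying \<open>f0\<close> to \<open>f\<close>. These sets are disjoint for
    different \<open>f\<close> and cover the group.\<close>
  also have "\<dots> = (\<Sum>f\<in>?C. \<Sum>\<sigma>\<in>{\<sigma>\<in>?G. \<forall>x\<in>A. f0 (\<sigma> x) = f x}. 1)"
  proof (rule sum.cong)
    fix f assume f: "f \<in> ?C"
    obtain \<tau> where \<tau>: "\<tau> permutes A" "\<And>x. x \<in> A \<Longrightarrow> f0 (\<tau> x) = f x"
      using colorings_transitive[OF assms(1) f0 f] by blast
    have "bij_betw (\<lambda>\<sigma>. \<tau> \<circ> \<sigma>) {\<sigma>\<in>?G. \<forall>x\<in>A. f (\<sigma> x) = f x} {\<sigma>\<in>?G. \<forall>x\<in>A. f0 (\<sigma> x) = f x}"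
    proof (rule bij_betw_byWitness[where f' = "\<lambda>\<sigma>. inv \<tau> \<circ> \<sigma>"])
      show "(\<lambda>\<sigma>. inv \<tau> \<circ> \<sigma>) ` {\<sigma> \<in> ?G. \<forall>x\<in>A. f0 (\<sigma> x) = f x} \<subseteq> {\<sigma> \<in> ?G. \<forall>x\<in>A. f (\<sigma> x) = f x}"
      proof clarify
        fix \<sigma> assume s: "\<sigma> permutes A" "\<forall>x\<in>A. f0 (\<sigma> x) = f x"
        have "f ((inv \<tau> \<circ> \<sigma>) x) = f x" if "x \<in> A" for x
        proof -
          have "inv \<tau> (\<sigma> x) \<in> A"
            using that s permutes_in_image[OF s(1)] permutes_in_image[OF permutes_inv[OF \<tau>(1)]] by simp
          then have "f (inv \<tau> (\<sigma> x)) = f0 (\<tau> (inv \<tau> (\<sigma> x)))" using \<tau>(2) by simp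
          then show ?thesis using s that permutes_inverses[OF \<tau>(1)] by simp
        qed
        then show "inv \<tau> \<circ> \<sigma> \<in> ?G \<and> (\<forall>x\<in>A. f ((inv \<tau> \<circ> \<sigma>) x) = f x)"
          using s \<tau> by (simp add: permutes_compose permutes_inv)
      qed
      show "(\<lambda>\<sigma>. \<tau> \<circ> \<sigma>) ` {\<sigma> \<in> ?G. \<forall>x\<in>A. f (\<sigma> x) = f x} \<subseteq> {\<sigma> \<in> ?G. \<forall>x\<in>A. f0 (\<sigma> x) = f x}"
        using \<tau> by (auto simp: permutes_compose permutes_in_image)
    qed (use permutes_inverses[OF \<tau>(1)] in \<open>auto simp: fun_eq_iff\<close>)
    then show "(\<Sum>\<sigma>\<in>{\<sigma>\<in>?G. \<forall>x\<in>A. f (\<sigma> x) = f x}. 1) =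
       (\<Sum>\<sigma>\<in>{\<sigma>\<in>?G. \<forall>x\<in>A. f0 (\<sigma> x) = f x}. (1::nat))"
      by (simp add: bij_betw_same_card)
  qed simp
  also have "\<dots> = (\<Sum>\<sigma>\<in>?G. 1 * of_nat (card {f\<in>?C. \<forall>x\<in>A. f0 (\<sigma> x) = f x}))"
    using assms finG by (subst sum_card_swap) auto
  also have "\<dots> = (\<Sum>\<sigma>\<in>?G. 1)"
  proof (rule sum.cong)
    fix \<sigma> assume s: "\<sigma> \<in> ?G"
    have "{f\<in>?C. \<forall>x\<in>A. f0 (\<sigma> x) = f x} = {restrict (f0 \<circ> \<sigma>) A}"
    proof (intro equalityI subsetI)
      fix f assume "f \<in> {f\<in>?C. \<forall>x\<in>A. f0 (\<sigma> x) = f x}"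
      then show "f \<in> {restrict (f0 \<circ> \<sigma>) A}"
        by (auto simp: colorings_def intro!: extensionalityI[of _ A] simp: PiE_def)
    qed (use colorings_comp[OF f0, of \<sigma>] s in auto)
    then show "1 * of_nat (card {f\<in>?C. \<forall>x\<in>A. f0 (\<sigma> x) = f x}) = (1::nat)" by simp
  qed simp
  also have "\<dots> = fact (card A)" using assms by (simp add: card_permutations)
  finally show ?thesis .
qed

text \<open>Left multiplication by the transposition is a sign-reversing involution without fixed
  points. It serves both for stabilisers that contain a transposition and for determinants with two
  equal columns.\<close>

lemma sum_permutes_transpose_eq_0:
  fixes F :: "('a \<Rightarrow> 'a) \<Rightarrow> 'r::comm_ring_1"
  assumes ab: "a \<in> A" "b \<in> A" "a \<noteq> b" and "finite A"
    and inv: "\<And>w. P (Transposition.transpose a b \<circ> w) = P w"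
    "\<And>w. F (Transposition.transpose a b \<circ> w) = F w"
  shows "(\<Sum>w | w permutes A \<and> P w. of_int (sign w) * F w) = 0"
proof (rule sum_involution_eq_0[where h = "\<lambda>w. Transposition.transpose a b \<circ> w"])
  let ?t = "Transposition.transpose a b"
  fix w assume "w \<in> {w. w permutes A \<and> P w}"
  then have w: "w permutes A" "P w" by auto
  have "sign (?t \<circ> w) = - sign w"
    using ab(3) permutes_imp_permutation[OF \<open>finite A\<close> w(1)]
    by (simp add: sign_compose permutation_swap_id sign_swap_id)
  then show "of_int (sign (?t \<circ> w)) * F (?t \<circ> w) + of_int (sign w) * F w = 0" by (simp add: inv)
  show "?t \<circ> w \<in> {w. w permutes A \<and> P w}"
    using w ab inv by (simp add: permutes_compose permutes_swap_id)
  show "?t \<circ> (?t \<circ> w) = w" by (simp add: fun_eq_iff)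
  show "?t \<circ> w \<noteq> w"
  proof
    assume "?t \<circ> w = w"
    then have "?t (w (inv w a)) = w (inv w a)" by (metis comp_apply)
    then show False using ab permutes_inverses[OF w(1)] by simp
  qed
qed

text \<open>The stabiliser of \<open>q\<close> is a Young subgroup: trivial if all colours differ,
  and otherwise containing a transposition of two points of the same colour.\<close>

lemma sum_sign_stabilizer:
  assumes "finite A"
  shows "(\<Sum>\<sigma> | \<sigma> permutes A \<and> (\<forall>x\<in>A. q (\<sigma> x) = q x). sign \<sigma>) = (if inj_on q A then 1 else 0)"
proof (cases "inj_on q A")
  case True
  have "{\<sigma>. \<sigma> permutes A \<and> (\<forall>x\<in>A. q (\<sigma> x) = q x)} = {id}"
    using True by (auto simp: fun_eq_iff inj_on_def permutes_in_image) (metis permutes_in_image permutes_not_in)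
  then show ?thesis using True by simp
next
  case False
  then obtain a b where ab: "a \<in> A" "b \<in> A" "a \<noteq> b" "q a = q b" by (auto simp: inj_on_def)
  have "q (Transposition.transpose a b z) = q z" for z using ab by (auto simp: transpose_def)
  then have "(\<Sum>\<sigma> | \<sigma> permutes A \<and> (\<forall>x\<in>A. q (\<sigma> x) = q x). of_int (sign \<sigma>) * (1::int)) = 0"
    using ab(1-3) assms by (intro sum_permutes_transpose_eq_0) auto
  then show ?thesis using False by simp
qed

lemma sum_sign_fixed:
  assumes "finite A" "finite Q"
  shows "(\<Sum>\<sigma> | \<sigma> permutes A. sign \<sigma> * int (card {q\<in>Q. \<forall>x\<in>A. F q (\<sigma> x) = F q x}))
    = int (card {q\<in>Q. inj_on (F q) A})"
proof -
  have "(\<Sum>\<sigma> | \<sigma> permutes A. sign \<sigma> * int (card {q\<in>Q. \<forall>x\<in>A. F q (\<sigma> x) = F q x}))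
      = (\<Sum>q\<in>Q. if inj_on (F q) A then 1 else 0)"
    using assms by (subst sum_card_swap) (auto simp: finite_permutations sum_sign_stabilizer)
  then show ?thesis using assms by (simp add: sum.If_cases Int_def)
qed

section \<open>Integrality of the multiplicity of the sign character\<close>

definition perm_action :: "'a set \<Rightarrow> 'x set \<Rightarrow> (('a \<Rightarrow> 'a) \<Rightarrow> 'x \<Rightarrow> 'x) \<Rightarrow> bool" where
  "perm_action A X act \<longleftrightarrow> (\<forall>x\<in>X. act id x = x \<and> (\<forall>\<sigma>. \<sigma> permutes A \<longrightarrow> act \<sigma> x \<in> X \<and>
     (\<forall>\<tau>. \<tau> permutes A \<longrightarrow> act (\<tau> \<circ> \<sigma>) x = act \<tau> (act \<sigma> x))))"

lemma perm_actionD: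
  assumes "perm_action A X act"
  shows "\<sigma> permutes A \<Longrightarrow> x \<in> X \<Longrightarrow> act \<sigma> x \<in> X"
    and "x \<in> X \<Longrightarrow> act id x = x"
    and "\<sigma> permutes A \<Longrightarrow> \<tau> permutes A \<Longrightarrow> x \<in> X \<Longrightarrow> act (\<sigma> \<circ> \<tau>) x = act \<sigma> (act \<tau> x)"
  using assms by (auto simp: perm_action_def)

text \<open>The sum is |A|! times the multiplicity of the sign character, computed orbit by orbit.
  An orbit with an odd permutation in some stabiliser contributes 0; any other contributes orbit
  size times stabiliser order, that is |A|!. This is where the integrality of all later coefficients
  comes from.\<close>

lemma fact_dvd_sum_sign_fixed:
  fixes act :: "('a \<Rightarrow> 'a) \<Rightarrow> 'x \<Rightarrow> 'x"
  assumes "finite A" "finite X"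
    and action: "perm_action A X act"
  shows "fact (card A) dvd (\<Sum>\<sigma> | \<sigma> permutes A. sign \<sigma> * int (card {x\<in>X. act \<sigma> x = x}))"
proof -
  note closed = perm_actionD(1)[OF action] and id = perm_actionD(2)[OF action] and comp = perm_actionD(3)[OF action]
  let ?G = "{\<sigma>. \<sigma> permutes A}"
  have finG: "finite ?G" using assms by (simp add: finite_permutations)
  define s where "s x = (\<Sum>\<sigma> | \<sigma> \<in> ?G \<and> act \<sigma> x = x. sign \<sigma>)" for x
  define r where "r = {(x, y). x \<in> X \<and> y \<in> X \<and> (\<exists>\<sigma>. \<sigma> permutes A \<and> y = act \<sigma> x)}"
  have act_inv: "act (inv \<sigma>) (act \<sigma> x) = x" if "\<sigma> permutes A" "x \<in> X" for \<sigma> x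
    using that comp[of "inv \<sigma>" \<sigma> x] id permutes_inv[OF that(1)] permutes_inv_o[OF that(1)] by simp
  have "equiv X r"
  proof (rule equivI)
    show "refl_on X r"
      unfolding refl_on_def r_def using id permutes_id by (auto intro!: exI[of _ id])
    show "sym r"
      unfolding sym_def r_def using act_inv permutes_inv by fastforce
    show "trans r"
    proof (rule transI)
      fix x y z assume "(x, y) \<in> r" "(y, z) \<in> r"
      then obtain \<sigma> \<tau> where *: "x \<in> X" "z \<in> X" "\<sigma> permutes A" "\<tau> permutes A" "z = act \<tau> (act \<sigma> x)"
        by (auto simp: r_def)
      then have "z = act (\<tau> \<circ> \<sigma>) x" "\<tau> \<circ> \<sigma> permutes A" using comp by (auto simp: permutes_compose)
      then show "(x, z) \<in> r" using * by (auto simp: r_def)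
    qed
  qed (auto simp: r_def)
  then have part: "partition_on X (X // r)" by (rule partition_on_quotient)
  have perm: "permutation \<sigma>" if "\<sigma> permutes A" for \<sigma>
    using that assms by (simp add: permutes_imp_permutation)
  \<comment> \<open>Multiplication by \<open>\<rho>\<close> maps the stabiliser of \<open>x\<close>
    to itself and reverses all signs, so the signed sum equals its own negative.\<close>
  have odd: "s x = 0" if x: "x \<in> X" and \<rho>: "\<rho> permutes A" "act \<rho> x = x" "sign \<rho> = -1" for x \<rho>
  proof -
    have "s x = (\<Sum>\<sigma> | \<sigma> \<in> ?G \<and> act \<sigma> x = x. sign (\<rho> \<circ> \<sigma>))"
      unfolding s_def
    proof (rule sum.reindex_bij_witness[of _ "\<lambda>\<sigma>. \<rho> \<circ> \<sigma>" "\<lambda>\<sigma>. inv \<rho> \<circ> \<sigma>"])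
      fix \<sigma> assume "\<sigma> \<in> {\<sigma> \<in> ?G. act \<sigma> x = x}"
      then show "\<rho> \<circ> \<sigma> \<in> {\<sigma> \<in> ?G. act \<sigma> x = x}" "inv \<rho> \<circ> \<sigma> \<in> {\<sigma> \<in> ?G. act \<sigma> x = x}"
        using \<rho> x comp[of \<rho> \<sigma> x] comp[of "inv \<rho>" \<sigma> x] act_inv[OF \<rho>(1) x]
        by (auto simp: permutes_compose permutes_inv)
    qed (use permutes_inverses[OF \<rho>(1)] in \<open>auto simp: fun_eq_iff o_def\<close>)
    also have "\<dots> = (\<Sum>\<sigma> | \<sigma> \<in> ?G \<and> act \<sigma> x = x. - sign \<sigma>)"
      using \<rho> by (intro sum.cong) (auto simp: sign_compose perm)
    also have "\<dots> = - s x" by (simp add: s_def sum_negf)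
    finally show ?thesis by simp
  qed
  have block: "fact (card A) dvd (\<Sum>x\<in>B. s x)" if "B \<in> X // r" for B
  proof -
    from that obtain x0 where x0: "x0 \<in> X" "B = r `` {x0}" by (auto elim: quotientE)
    have inB: "\<exists>\<tau>. \<tau> permutes A \<and> x = act \<tau> x0" "x \<in> X" if "x \<in> B" for x
      using that x0 by (auto simp: r_def)
    have finB: "finite B" using assms(2) inB by (meson finite_subset subsetI)
    show ?thesis
    proof (cases "\<exists>x\<in>B. \<exists>\<rho>. \<rho> permutes A \<and> act \<rho> x = x \<and> sign \<rho> = -1")
      case True
      then obtain x \<rho> where \<rho>: "x \<in> B" "\<rho> permutes A" "act \<rho> x = x" "sign \<rho> = -1" by blast
      have "s y = 0" if "y \<in> B" for y
      proof -
        have "(x, y) \<in> r"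
          using \<rho>(1) that \<open>equiv X r\<close> \<open>B \<in> X // r\<close> by (meson quotient_eq_iff in_quotient_imp_in_rel insert_subset empty_subsetI)
        then obtain \<tau> where \<tau>: "\<tau> permutes A" "y = act \<tau> x" by (auto simp: r_def)
        have x: "x \<in> X" "y \<in> X" using inB \<rho>(1) that by auto
        \<comment> \<open>Conjugation carries the odd element of the stabiliser of \<open>x\<close>
          to one of the stabiliser of \<open>y\<close>.\<close>
        let ?\<rho> = "\<tau> \<circ> (\<rho> \<circ> inv \<tau>)"
        have iy: "act (inv \<tau>) y = x" using act_inv[OF \<tau>(1) x(1)] \<tau>(2) by simp
        have p: "\<rho> \<circ> inv \<tau> permutes A" using \<rho> \<tau> by (simp add: permutes_compose permutes_inv)
        have "act ?\<rho> y = y"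
          using comp[OF \<tau>(1) p x(2)] comp[OF \<rho>(2) permutes_inv[OF \<tau>(1)] x(2)] iy \<rho>(3) \<tau>(2) by simp
        moreover have "sign ?\<rho> = -1"
          using \<rho> \<tau> p sign_cases[of \<tau>] 
          by (auto simp: sign_compose perm permutes_inv sign_inverse permutation_compose permutation_inverse)
        ultimately show ?thesis
          using odd[OF x(2), of ?\<rho>] p \<tau> by (simp add: permutes_compose)
      qed
      then show ?thesis by simp
    next
      case False
      \<comment> \<open>With only even elements \<open>s x\<close> is the order of the stabiliser;
        replacing that by the coset of permutations sending \<open>x0\<close> to \<open>x\<close>
        makes each permutation count once over the whole orbit.\<close>
      have "s x = (\<Sum>\<sigma> | \<sigma> \<in> ?G \<and> act \<sigma> x0 = x. 1)" if "x \<in> B" for x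
      proof -
        obtain \<tau> where \<tau>: "\<tau> permutes A" "x = act \<tau> x0" using inB(1)[OF \<open>x \<in> B\<close>] by blast
        have x: "x \<in> X" using inB(2)[OF that] by simp
        have "s x = (\<Sum>\<sigma> | \<sigma> \<in> ?G \<and> act \<sigma> x = x. 1)"
          unfolding s_def using False that by (intro sum.cong) (auto simp: sign_def split: if_splits)
        also have "\<dots> = (\<Sum>\<sigma> | \<sigma> \<in> ?G \<and> act \<sigma> x0 = x. 1)"
        proof (rule sum.reindex_bij_witness[of _ "\<lambda>\<sigma>. \<sigma> \<circ> inv \<tau>" "\<lambda>\<sigma>. \<sigma> \<circ> \<tau>"])
          have iy: "act (inv \<tau>) x = x0" using act_inv[OF \<tau>(1) x0(1)] \<tau>(2) by simp
          fix \<sigma> assume "\<sigma> \<in> {\<sigma> \<in> ?G. act \<sigma> x0 = x}"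
          then show "\<sigma> \<circ> inv \<tau> \<in> {\<sigma> \<in> ?G. act \<sigma> x = x}"
            using \<tau>(1) x comp[of \<sigma> "inv \<tau>" x] iy by (auto simp: permutes_compose permutes_inv)
        next
          fix \<sigma> assume "\<sigma> \<in> {\<sigma> \<in> ?G. act \<sigma> x = x}"
          then show "\<sigma> \<circ> \<tau> \<in> {\<sigma> \<in> ?G. act \<sigma> x0 = x}"
            using \<tau> x0 comp[of \<sigma> \<tau> x0] by (auto simp: permutes_compose permutes_inv)
        qed (use permutes_inverses[OF \<tau>(1)] in \<open>auto simp: fun_eq_iff o_def\<close>)
        finally show ?thesis .
      qed
      then have "(\<Sum>x\<in>B. s x) = (\<Sum>x\<in>B. \<Sum>\<sigma> | \<sigma> \<in> ?G \<and> act \<sigma> x0 = x. 1)" by simp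
      also have "\<dots> = (\<Sum>\<sigma>\<in>?G. 1 * of_nat (card {x\<in>B. act \<sigma> x0 = x}))"
        using finG finB by (subst sum_card_swap) auto
      also have "\<dots> = (\<Sum>\<sigma>\<in>?G. 1)"
      proof (rule sum.cong)
        fix \<sigma> assume "\<sigma> \<in> ?G"
        then have "act \<sigma> x0 \<in> B" using x0 closed by (auto simp: r_def)
        then have "{x\<in>B. act \<sigma> x0 = x} = {act \<sigma> x0}" by auto
        then show "1 * of_nat (card {x\<in>B. act \<sigma> x0 = x}) = (1::int)" by simp
      qed simp
      also have "\<dots> = fact (card A)" using assms by (simp add: card_permutations)
      finally show ?thesis by simp
    qed
  qed
  have "(\<Sum>\<sigma> | \<sigma> permutes A. sign \<sigma> * int (card {x\<in>X. act \<sigma> x = x})) = (\<Sum>x\<in>X. s x)"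
    unfolding s_def using assms finG by (subst sum_card_swap) auto
  also have "\<dots> = (\<Sum>B\<in>X // r. \<Sum>x\<in>B. s x)"
    by (rule sum.partition[OF assms(2) part])
  finally show ?thesis using block by (simp add: dvd_sum)
qed

subsection \<open>Unitriangularity of signed multiplicities\<close>

lemma colorings_one_inj_on:
  assumes "f \<in> colorings A D (\<lambda>_. 1)"
  shows "inj_on f A"
proof (rule inj_onI)
  fix x y assume xy: "x \<in> A" "y \<in> A" "f x = f y"
  have "card {z\<in>A. f z = f x} = 1" using assms xy by (auto simp: colorings_def)
  then obtain w where "{z\<in>A. f z = f x} = {w}" by (auto simp: card_1_singleton_iff)
  then show "x = y" using xy by (metis (mono_tags, lifting) mem_Collect_eq singletonD)
qed

text \<open>Only the identity fixes an injective colouring, so the count over all permutations in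
  \<open>sum_fixcol\<close> reduces to a single term; this counts the bijections from
  \<open>A\<close> to \<open>D\<close>.\<close>

lemma card_colorings_one:
  assumes "finite A" "finite D" "card A = card D"
  shows "card (colorings A D (\<lambda>_. 1)) = fact (card A)"
proof -
  let ?C = "colorings A D (\<lambda>_. 1)"
  have "fixcol A D (\<lambda>_. 1) \<sigma> = (if \<sigma> = id then card ?C else 0)" if s: "\<sigma> permutes A" for \<sigma>
  proof (cases "\<sigma> = id")
    case False
    then obtain x where x: "\<sigma> x \<noteq> x" "x \<in> A" using s by (metis id_apply ext permutes_not_in)
    have "f (\<sigma> x) \<noteq> f x" if "f \<in> ?C" for f
      using colorings_one_inj_on[OF that] x s by (metis inj_onD permutes_in_image)
    then have "{f \<in> ?C. \<forall>x\<in>A. f (\<sigma> x) = f x} = {}" using x by blast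
    then have "fixcol A D (\<lambda>_. 1) \<sigma> = 0" unfolding fixcol_def by (simp only: card.empty)
    then show ?thesis using False by simp
  qed (simp add: fixcol_def)
  then have "(\<Sum>\<sigma> | \<sigma> permutes A. fixcol A D (\<lambda>_. 1) \<sigma>) = (\<Sum>\<sigma> | \<sigma> permutes A. if \<sigma> = id then card ?C else 0)"
    by simp
  also have "\<dots> = card ?C" using assms by (simp add: sum.delta finite_permutations)
  finally show ?thesis using sum_fixcol[of A D "\<lambda>_. 1"] assms by simp
qed

lemma inj_on_imp_colorings_one:
  assumes "finite A" "finite D" "card A = card D" "q \<in> A \<rightarrow>\<^sub>E D" "inj_on q A"
  shows "q \<in> colorings A D (\<lambda>_. 1)"
proof -
  have "card (q ` A) = card D" using assms by (simp add: card_image)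
  then have im: "q ` A = D" using assms by (intro card_subset_eq) auto
  have "card {x\<in>A. q x = j} = 1" if "j \<in> D" for j
  proof -
    obtain x where x: "x \<in> A" "q x = j" using im \<open>j \<in> D\<close> by blast
    then have "{x\<in>A. q x = j} = {x}" using assms(5) by (auto simp: inj_on_def)
    then show ?thesis by simp
  qed
  then show ?thesis using assms by (auto simp: colorings_def)
qed

text \<open>Integer partitions of \<open>k\<close> as antitone functions padded with zeros.\<close>

definition parts :: "nat \<Rightarrow> (nat \<Rightarrow> nat) set" where
  "parts k = {\<gamma>. antimono \<gamma> \<and> (\<forall>j\<ge>k. \<gamma> j = 0) \<and> (\<Sum>j<k. \<gamma> j) = k}"

definition conjugate :: "nat \<Rightarrow> (nat \<Rightarrow> nat) \<Rightarrow> nat \<Rightarrow> nat" where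
  "conjugate k \<gamma> i = card {j\<in>{..<k}. i < \<gamma> j}"

lemma parts_le: "\<gamma> \<in> parts k \<Longrightarrow> \<gamma> j \<le> k"
proof (cases "j < k")
  case True
  assume "\<gamma> \<in> parts k"
  moreover have "\<gamma> j \<le> (\<Sum>j<k. \<gamma> j)" using True by (intro member_le_sum) auto
  ultimately show ?thesis by (auto simp: parts_def)
qed (auto simp: parts_def)

lemma finite_parts: "finite (parts k)"
proof (rule finite_subset)
  let ?r = "\<lambda>(f::nat \<Rightarrow> nat) j. if j < k then f j else 0"
  show "parts k \<subseteq> ?r ` ({..<k} \<rightarrow>\<^sub>E {..k})"
  proof
    fix \<gamma> assume g: "\<gamma> \<in> parts k"
    then have "restrict \<gamma> {..<k} \<in> {..<k} \<rightarrow>\<^sub>E {..k}" using parts_le by auto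
    moreover have "\<gamma> = ?r (restrict \<gamma> {..<k})" using g by (auto simp: parts_def fun_eq_iff)
    ultimately show "\<gamma> \<in> ?r ` ({..<k} \<rightarrow>\<^sub>E {..k})" by blast
  qed
qed (auto intro: finite_PiE)

text \<open>As \<open>\<gamma>\<close> is decreasing, the rows of length more than \<open>i\<close>
  are an initial segment, so comparing \<open>j\<close> with their number is the same as testing row
  \<open>j\<close>.\<close>

lemma less_conjugate_iff:
  assumes "\<gamma> \<in> parts k" "j < k"
  shows "j < conjugate k \<gamma> i \<longleftrightarrow> i < \<gamma> j"
proof
  assume ij: "i < \<gamma> j"
  have "{..j} \<subseteq> {j\<in>{..<k}. i < \<gamma> j}"
    using assms ij by (auto simp: parts_def dest: antimonoD intro: less_le_trans)
  from card_mono[OF _ this] show "j < conjugate k \<gamma> i" by (simp add: conjugate_def)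
next
  assume c: "j < conjugate k \<gamma> i"
  show "i < \<gamma> j"
  proof (rule ccontr)
    assume n: "\<not> i < \<gamma> j"
    have "{j\<in>{..<k}. i < \<gamma> j} \<subseteq> {..<j}"
    proof
      fix x assume x: "x \<in> {j\<in>{..<k}. i < \<gamma> j}"
      show "x \<in> {..<j}"
      proof (rule ccontr)
        assume "x \<notin> {..<j}"
        then have "\<gamma> x \<le> \<gamma> j" using assms(1) antimonoD[of \<gamma> j x] by (simp add: parts_def)
        then show False using x n by simp
      qed
    qed
    from card_mono[OF _ this] c show False by (simp add: conjugate_def)
  qed
qed

lemma conjugate_conjugate:
  assumes "\<gamma> \<in> parts k"
  shows "conjugate k (conjugate k \<gamma>) = \<gamma>"
proof
  fix j
  show "conjugate k (conjugate k \<gamma>) j = \<gamma> j"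
  proof (cases "j < k")
    case True
    have "{i\<in>{..<k}. j < conjugate k \<gamma> i} = {..<\<gamma> j}"
      unfolding less_conjugate_iff[OF assms True] using parts_le[OF assms, of j] by auto
    then show ?thesis unfolding conjugate_def[of k "conjugate k \<gamma>"] by simp
  next
    case False
    have "conjugate k \<gamma> i \<le> k" for i
      unfolding conjugate_def by (rule order_trans[OF card_mono[of "{..<k}"]]) auto
    then have "\<not> j < conjugate k \<gamma> i" for i
      using False by (meson le_trans not_less)
    then have "{i\<in>{..<k}. j < conjugate k \<gamma> i} = {}" by blast
    then have "conjugate k (conjugate k \<gamma>) j = 0" by (simp only: conjugate_def[of k "conjugate k \<gamma>"] card.empty)
    then show ?thesis using False assms by (simp add: parts_def)
  qed
qed

text \<open>The cells in the first \<open>l\<close> columns of the diagram with rows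
  \<open>m i\<close> are counted by columns and by rows.\<close>

lemma sum_conjugate:
  "(\<Sum>j<l. conjugate k m j) = (\<Sum>i<k. min l (m i))"
proof -
  have "(\<Sum>j<l. conjugate k m j) = (\<Sum>j<l. \<Sum>i<k. if j < m i then 1 else 0)"
    by (simp add: conjugate_def sum.If_cases Int_def)
  also have "\<dots> = (\<Sum>i<k. \<Sum>j<l. if j < m i then 1 else 0)" by (rule sum.swap)
  also have "\<dots> = (\<Sum>i<k. min l (m i))"
  proof (rule sum.cong)
    fix i
    have "{..<l} \<inter> {j. j < m i} = {..<min l (m i)}" by auto
    then show "(\<Sum>j<l. if j < m i then 1 else 0) = min l (m i)" by (simp add: sum.If_cases)
  qed simp
  finally show ?thesis .
qed

lemma conjugate_parts:
  assumes "\<gamma> \<in> parts k"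
  shows "conjugate k \<gamma> \<in> parts k"
proof -
  have "antimono (conjugate k \<gamma>)"
    unfolding conjugate_def by (intro antimonoI card_mono) auto
  moreover have "conjugate k \<gamma> i = 0" if "i \<ge> k" for i
    using parts_le[OF assms] that unfolding conjugate_def by (auto simp: not_less intro: order_trans)
  moreover have "(\<Sum>j<k. conjugate k \<gamma> j) = k"
    using assms parts_le[OF assms] by (simp add: sum_conjugate min_absorb2) (simp add: parts_def)
  ultimately show ?thesis by (simp add: parts_def)
qed

text \<open>Adding up all partial sums gives a number that increases strictly along the dominance
  order; it linearises that order for \<open>unitriangular_solve\<close>.\<close>

definition part_rank :: "nat \<Rightarrow> (nat \<Rightarrow> nat) \<Rightarrow> nat" where
  "part_rank k \<gamma> = (\<Sum>l\<le>k. \<Sum>j<l. \<gamma> j)"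

text \<open>0-1 matrices with margins \<open>\<gamma>\<close> and \<open>m\<close> whose ones are
  labelled by the points of \<open>A\<close>: for a pair \<open>(f, p)\<close> the point
  \<open>x\<close> sits in column \<open>f x\<close> and row \<open>p x\<close>, and injectivity
  says that no cell is used twice.\<close>

definition inj_pairs :: "'a set \<Rightarrow> nat \<Rightarrow> (nat \<Rightarrow> nat) \<Rightarrow> (nat \<Rightarrow> nat) \<Rightarrow> (('a \<Rightarrow> nat) \<times> ('a \<Rightarrow> nat)) set" where
  "inj_pairs A k \<gamma> m = {q \<in> colorings A {..<k} \<gamma> \<times> colorings A {..<k} m. inj_on (\<lambda>x. (fst q x, snd q x)) A}"

text \<open>The left side is |A|! times the multiplicity of the sign character in a product of two
  Young characters. A pair of colourings is one colouring by pairs, and only the injective ones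
  survive in \<open>sum_sign_fixed\<close>.\<close>

lemma sum_sign_fixcol_fixcol:
  assumes "finite A"
  shows "(\<Sum>\<sigma> | \<sigma> permutes A. sign \<sigma> * int (fixcol A {..<k} \<gamma> \<sigma>) * int (fixcol A {..<k} m \<sigma>))
    = int (card (inj_pairs A k \<gamma> m))"
proof -
  let ?Q = "colorings A {..<k} \<gamma> \<times> colorings A {..<k} m" and ?F = "\<lambda>q x. (fst q x, snd q x)"
  have "fixcol A {..<k} \<gamma> \<sigma> * fixcol A {..<k} m \<sigma> = card {q\<in>?Q. \<forall>x\<in>A. ?F q (\<sigma> x) = ?F q x}" for \<sigma>
  proof -
    have "{q\<in>?Q. \<forall>x\<in>A. ?F q (\<sigma> x) = ?F q x} = 
       fixed_colorings A {..<k} \<gamma> \<sigma> \<times> fixed_colorings A {..<k} m \<sigma>"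
      by auto
    then show ?thesis by (simp add: fixcol_def card_cartesian_product)
  qed
  then have "int (fixcol A {..<k} \<gamma> \<sigma>) * int (fixcol A {..<k} m \<sigma>) = int (card {q\<in>?Q. \<forall>x\<in>A. ?F q (\<sigma> x) = ?F q x})" for \<sigma>
    by (metis of_nat_mult)
  then show ?thesis
    using sum_sign_fixed[of A ?Q ?F] assms by (simp add: mult.assoc inj_pairs_def)
qed

lemma card_eq_sum_fibres:
  assumes "finite X" "finite I" "\<And>x. x \<in> X \<Longrightarrow> g x \<in> I"
  shows "card X = (\<Sum>i\<in>I. card {x\<in>X. g x = i})"
  using sum.group[of X I g "\<lambda>_. 1::nat"] assms by (simp add: image_subset_iff)

lemma colorings_sum_less:
  fixes k l :: nat
  assumes "finite A" "f \<in> colorings A {..<k} \<gamma>" "l \<le> k"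
  shows "(\<Sum>j<l. \<gamma> j) = card {x\<in>A. f x < l}"
proof -
  have "card {x\<in>A. f x < l} = (\<Sum>j<l. card {x\<in>{x\<in>A. f x < l}. f x = j})"
    using assms(1) by (intro card_eq_sum_fibres) auto
  also have "\<dots> = (\<Sum>j<l. \<gamma> j)"
  proof (rule sum.cong)
    fix j assume "j \<in> {..<l}"
    then have "{x\<in>{x\<in>A. f x < l}. f x = j} = {x\<in>A. f x = j}" "j < k" using assms by auto
    then show "card {x\<in>{x\<in>A. f x < l}. f x = j} = \<gamma> j" using assms by (auto simp: colorings_def)
  qed simp
  finally show ?thesis by simp
qed

text \<open>In row \<open>i\<close> of the matrix the first \<open>l\<close> columns hold at most
  \<open>l\<close> ones, and the whole row holds \<open>m i\<close>.\<close>

lemma inj_pairs_card_le: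
  assumes "finite A" "(f, p) \<in> inj_pairs A k \<gamma> m" "i < k"
  shows "card {x\<in>A. f x < l \<and> p x = i} \<le> min l (m i)"
proof -
  have "inj_on f {x\<in>A. f x < l \<and> p x = i}"
    using assms by (auto simp: inj_pairs_def inj_on_def)
  moreover have "f ` {x\<in>A. f x < l \<and> p x = i} \<subseteq> {..<l}" by auto
  ultimately have "card {x\<in>A. f x < l \<and> p x = i} \<le> card {..<l}" by (metis card_inj_on_le finite_lessThan)
  moreover have "card {x\<in>A. f x < l \<and> p x = i} \<le> card {x\<in>A. p x = i}"
    using assms by (intro card_mono) auto
  moreover have "card {x\<in>A. p x = i} = m i" using assms by (auto simp: inj_pairs_def colorings_def)
  ultimately show ?thesis by simp
qed

lemma inj_pairs_sum_card:
  assumes "finite A" "(f, p) \<in> inj_pairs A k \<gamma> m"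
  shows "card {x\<in>A. f x < l} = (\<Sum>i<k. card {x\<in>A. f x < l \<and> p x = i})"
proof -
  have p: "p x < k" if "x \<in> A" for x
    using assms that by (auto simp: inj_pairs_def colorings_def)
  have "card {x\<in>A. f x < l} = (\<Sum>i<k. card {x\<in>{x\<in>A. f x < l}. p x = i})"
    using assms(1) p by (intro card_eq_sum_fibres) auto
  then show ?thesis by (simp add: conj_assoc)
qed

text \<open>The necessary half of the Gale-Ryser theorem: the row bounds \<open>min l (m i)\<close>,
  added over all rows, give the partial sums of the conjugate of \<open>m\<close>.\<close>

lemma inj_pairs_dominance:
  assumes "finite A" "inj_pairs A k \<gamma> m \<noteq> {}" "l \<le> k"
  shows "(\<Sum>j<l. \<gamma> j) \<le> (\<Sum>j<l. conjugate k m j)"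
proof -
  obtain f p where fp: "(f, p) \<in> inj_pairs A k \<gamma> m" using assms by auto
  then have "f \<in> colorings A {..<k} \<gamma>" by (auto simp: inj_pairs_def)
  then have "(\<Sum>j<l. \<gamma> j) = (\<Sum>i<k. card {x\<in>A. f x < l \<and> p x = i})"
    using colorings_sum_less[OF assms(1) _ assms(3)] inj_pairs_sum_card[OF assms(1) fp] by simp
  also have "\<dots> \<le> (\<Sum>i<k. min l (m i))"
    using inj_pairs_card_le[OF assms(1) fp] by (intro sum_mono) auto
  finally show ?thesis by (simp add: sum_conjugate)
qed

text \<open>Dominance bounds every partial sum; equality throughout would make the two partitions
  equal, so some inequality is strict.\<close>

lemma inj_pairs_part_rank:
  assumes "finite A" "inj_pairs A k \<gamma> m \<noteq> {}" "\<gamma> \<in> parts k" "m \<in> parts k" "\<gamma> \<noteq> conjugate k m"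
  shows "part_rank k \<gamma> < part_rank k (conjugate k m)"
proof -
  have le: "\<forall>l\<in>{..k}. (\<Sum>j<l. \<gamma> j) \<le> (\<Sum>j<l. conjugate k m j)"
    using inj_pairs_dominance[OF assms(1,2)] by auto
  have "\<exists>l\<in>{..k}. (\<Sum>j<l. \<gamma> j) < (\<Sum>j<l. conjugate k m j)"
  proof (rule ccontr)
    assume "\<not> ?thesis"
    then have eq: "(\<Sum>j<l. \<gamma> j) = (\<Sum>j<l. conjugate k m j)" if "l \<le> k" for l
      using le that by (meson atMost_iff le_neq_implies_less)
    have "\<gamma> j = conjugate k m j" for j
    proof (cases "j < k")
      case True
      then show ?thesis using eq[of j] eq[of "Suc j"] by simp
    next
      case False
      then show ?thesis using assms(3) conjugate_parts[OF assms(4)] by (simp add: parts_def)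
    qed
    then show False using assms(5) by auto
  qed
  then show ?thesis unfolding part_rank_def using le by (intro sum_strict_mono_ex1) auto
qed

text \<open>In the extremal case every row bound is attained, and this forces the ones to fill the
  Young diagram of \<open>m\<close>.\<close>

lemma inj_pairs_conjugate_in_diagram:
  assumes "finite A" "(f, p) \<in> inj_pairs A k (conjugate k m) m" "m \<in> parts k" "x \<in> A"
  shows "f x < m (p x)"
proof -
  \<comment> \<open>Choosing \<open>l\<close> as the length of the row of \<open>x\<close> makes the
    bound equal to the full row, so that row lies in its first \<open>l\<close> columns.\<close>
  let ?l = "m (p x)"
  have lk: "?l \<le> k" using parts_le[OF assms(3)] .
  have pk: "p x < k" using assms by (auto simp: inj_pairs_def colorings_def)
  have f: "f \<in> colorings A {..<k} (conjugate k m)" using assms(2) by (auto simp: inj_pairs_def)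
  have "(\<Sum>i<k. card {x\<in>A. f x < ?l \<and> p x = i}) = (\<Sum>i<k. min ?l (m i))"
    using colorings_sum_less[OF assms(1) f lk] inj_pairs_sum_card[OF assms(1,2), of ?l]
    by (simp add: sum_conjugate)
  then have "card {y\<in>A. f y < ?l \<and> p y = p x} = min ?l (m (p x))"
    using inj_pairs_card_le[OF assms(1,2)] pk
    by (intro sum_mono_inv[of "\<lambda>i. card {x\<in>A. f x < ?l \<and> p x = i}" "{..<k}" "\<lambda>i. min ?l (m i)" "p x"]) auto
  moreover have "card {y\<in>A. p y = p x} = m (p x)"
    using assms(2) pk by (auto simp: inj_pairs_def colorings_def)
  ultimately have "{y\<in>A. f y < ?l \<and> p y = p x} = {y\<in>A. p y = p x}"
    using assms(1) by (intro card_subset_eq) auto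
  then show ?thesis using assms(4) by blast
qed

text \<open>The Young diagram is the only 0-1 matrix with these margins, so a pair amounts to a
  bijection from \<open>A\<close> to its cells.\<close>

lemma card_inj_pairs_conjugate:
  assumes "finite A" "card A = k" "m \<in> parts k"
  shows "card (inj_pairs A k (conjugate k m) m) = fact k"
proof -
  define D where "D = (SIGMA i:{..<k}. {..<m i})"
  have cD: "card D = k" using assms by (simp add: D_def parts_def)
  have fD: "finite D" by (simp add: D_def)
  let ?C = "colorings A D (\<lambda>_. 1)"
  define enc where "enc = (\<lambda>(f, p). restrict (\<lambda>x. (p x, f x)) A :: 'a \<Rightarrow> nat \<times> nat)"
  define dec where "dec = (\<lambda>q :: 'a \<Rightarrow> nat \<times> nat. (restrict (snd \<circ> q) A, restrict (fst \<circ> q) A))"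
  have "bij_betw enc (inj_pairs A k (conjugate k m) m) ?C"
  proof (rule bij_betw_byWitness[where f' = dec])
    show "\<forall>q\<in>inj_pairs A k (conjugate k m) m. dec (enc q) = q"
      by (auto simp: inj_pairs_def colorings_def enc_def dec_def intro!: extensionalityI[of _ A] simp: PiE_def)
    show "\<forall>q\<in>?C. enc (dec q) = q"
      by (auto simp: colorings_def enc_def dec_def intro!: extensionalityI[of _ A] simp: PiE_def)
    show "enc ` inj_pairs A k (conjugate k m) m \<subseteq> ?C"
    proof clarify
      fix f p assume fp: "(f, p) \<in> inj_pairs A k (conjugate k m) m"
      have "enc (f, p) \<in> A \<rightarrow>\<^sub>E D"
        using inj_pairs_conjugate_in_diagram[OF assms(1) fp assms(3)] fp
        by (auto simp: enc_def D_def inj_pairs_def colorings_def)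
      moreover have "inj_on (enc (f, p)) A"
        using fp by (auto simp: enc_def inj_pairs_def inj_on_def)
      ultimately show "enc (f, p) \<in> ?C"
        using inj_on_imp_colorings_one[OF assms(1) fD] assms(2) cD by simp
    qed
    show "dec ` ?C \<subseteq> inj_pairs A k (conjugate k m) m"
    proof (rule image_subsetI)
      fix q assume q: "q \<in> ?C"
      have inj: "inj_on q A" using q by (rule colorings_one_inj_on)
      have qD: "q x \<in> D" if "x \<in> A" for x using q that by (auto simp: colorings_def)
      have im: "q ` A = D" 
      proof (rule card_subset_eq)
        show "q ` A \<subseteq> D" using qD by auto
      qed (use fD inj cD assms in \<open>auto simp: card_image\<close>)
      have card: "card {x\<in>A. P (q x)} = card {d\<in>D. P d}" for P
      proof (rule bij_betw_same_card)
        show "bij_betw q {x\<in>A. P (q x)} {d\<in>D. P d}"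
          using inj im by (auto simp: bij_betw_def inj_on_def)
      qed
      have "card {d\<in>D. fst d = i} = m i" if "i < k" for i
      proof -
        have "{d\<in>D. fst d = i} = {i} \<times> {..<m i}" using that by (auto simp: D_def)
        then show ?thesis by (simp add: card_cartesian_product)
      qed
      moreover have "card {d\<in>D. snd d = j} = conjugate k m j" for j
      proof -
        have "{d\<in>D. snd d = j} = {i\<in>{..<k}. j < m i} \<times> {j}" by (auto simp: D_def)
        then show ?thesis by (simp add: card_cartesian_product conjugate_def)
      qed
      moreover have "{x \<in> A. restrict (g \<circ> q) A x = j} = {x\<in>A. g (q x) = j}" for g :: "nat \<times> nat \<Rightarrow> nat" and j
        by auto
      moreover have "fst (q x) < k" "snd (q x) < k" if "x \<in> A" for x
        using qD[OF that] parts_le[OF assms(3), of "fst (q x)"] by (auto simp: D_def)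
      ultimately show "dec q \<in> inj_pairs A k (conjugate k m) m"
        using inj card[of "\<lambda>d. fst d = _"] card[of "\<lambda>d. snd d = _"]
        by (auto simp: dec_def inj_pairs_def colorings_def inj_on_def prod_eq_iff)
    qed
  qed
  then show ?thesis
    using card_colorings_one[OF assms(1) fD] assms(2) cD by (simp add: bij_betw_same_card)
qed

text \<open>Back substitution along \<open>r\<close>, possible over the integers because the
  diagonal is 1.\<close>

lemma unitriangular_solve:
  fixes N :: "'b \<Rightarrow> 'b \<Rightarrow> int"
  assumes "finite P" and diag: "\<And>\<beta>. \<beta> \<in> P \<Longrightarrow> N \<beta> \<beta> = 1"
    and tri: "\<And>\<gamma> \<beta>. \<gamma> \<in> P \<Longrightarrow> \<beta> \<in> P \<Longrightarrow> \<gamma> \<noteq> \<beta> \<Longrightarrow> N \<gamma> \<beta> \<noteq> 0 \<Longrightarrow> r \<gamma> < (r \<beta> :: nat)"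
  shows "\<exists>a. \<forall>\<beta>\<in>P. (\<Sum>\<gamma>\<in>P. a \<gamma> * N \<gamma> \<beta>) = v \<beta>"
proof -
  have "\<exists>a. \<forall>\<beta>\<in>P. r \<beta> < b \<longrightarrow> (\<Sum>\<gamma>\<in>P. a \<gamma> * N \<gamma> \<beta>) = v \<beta>" for b
  proof (induction b)
    case 0
    then show ?case by simp
  next
    case (Suc b)
    then obtain a where a: "\<And>\<beta>. \<beta> \<in> P \<Longrightarrow> r \<beta> < b \<Longrightarrow> (\<Sum>\<gamma>\<in>P. a \<gamma> * N \<gamma> \<beta>) = v \<beta>" by blast
    \<comment> \<open>Only coordinates of rank \<open>b\<close> change. An equation of rank at most
      \<open>b\<close> involves, besides its own diagonal term, only coordinates of rank below
      \<open>b\<close>, so the equations already solved stay valid.\<close>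
    define a' where "a' \<beta> = (if r \<beta> = b then v \<beta> - (\<Sum>\<gamma>\<in>P - {\<beta>}. a \<gamma> * N \<gamma> \<beta>) else a \<beta>)" for \<beta>
    have "(\<Sum>\<gamma>\<in>P. a' \<gamma> * N \<gamma> \<beta>) = v \<beta>" if b: "\<beta> \<in> P" "r \<beta> < Suc b" for \<beta>
    proof -
      have e: "(\<Sum>\<gamma>\<in>P - {\<beta>}. a' \<gamma> * N \<gamma> \<beta>) = (\<Sum>\<gamma>\<in>P - {\<beta>}. a \<gamma> * N \<gamma> \<beta>)"
      proof (rule sum.cong)
        fix \<gamma> assume g: "\<gamma> \<in> P - {\<beta>}"
        show "a' \<gamma> * N \<gamma> \<beta> = a \<gamma> * N \<gamma> \<beta>"
        proof (cases "N \<gamma> \<beta> = 0")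
          case False
          then have "r \<gamma> < b" using tri[of \<gamma> \<beta>] g b by auto
          then show ?thesis by (simp add: a'_def)
        qed simp
      qed simp
      have s: "(\<Sum>\<gamma>\<in>P. c \<gamma> * N \<gamma> \<beta>) = c \<beta> + (\<Sum>\<gamma>\<in>P - {\<beta>}. c \<gamma> * N \<gamma> \<beta>)" for c
        using assms(1) b diag by (simp add: sum.remove[of P \<beta>])
      show ?thesis
      proof (cases "r \<beta> = b")
        case True
        then show ?thesis using s[of a'] e by (simp add: a'_def)
      next
        case False
        then show ?thesis using s[of a'] s[of a] e a[OF b(1)] b by (simp add: a'_def)
      qed
    qed
    then show ?case by blast
  qed
  from this[of "Suc (Max (r ` P))"] show ?thesis
    using assms(1) by (auto simp: less_Suc_eq_le)
qed

subsection \<open>Class functions are determined by Young subgroups\<close>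

text \<open>\<open>funpow_dist1\<close> from \<open>x\<close> to itself is the cycle length, which
  is both the period of the powers at \<open>x\<close> and the size of the orbit.\<close>

lemma funpow_eq_iff_mod_card_orbit:
  assumes "permutation f"
  shows "(f ^^ a) x = (f ^^ b) x \<longleftrightarrow> a mod card (orbit f x) = b mod card (orbit f x)"
proof -
  let ?p = "funpow_dist1 f x x"
  have self: "x \<in> orbit f x" using assms by (rule permutation_self_in_orbit)
  have inj: "inj_on (\<lambda>n. (f ^^ n) x) {0..<?p}" using self by (rule inj_on_funpow_dist1)
  have "card (orbit f x) = ?p"
    using orbit_conv_funpow_dist1[OF self] card_image[OF inj] by simp
  moreover have "(f ^^ (n mod ?p)) x = (f ^^ n) x" for n
    using funpow_dist1_prop[OF self] by (rule funpow_mod_eq)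
  then have "(f ^^ a) x = (f ^^ b) x \<longleftrightarrow> (f ^^ (a mod ?p)) x = (f ^^ (b mod ?p)) x" by simp
  moreover have "\<dots> \<longleftrightarrow> a mod ?p = b mod ?p"
    using inj by (auto simp: inj_on_def)
  ultimately show ?thesis by simp
qed

text \<open>In each common orbit a base point is fixed, and \<open>\<pi>\<close> sends the d-th
  \<open>\<sigma>\<close>-iterate of the base point to its d-th \<open>\<tau>\<close>-iterate; equal
  cycle lengths make this consistent.\<close>

lemma conjugate_if_same_orbits:
  assumes "finite A" "\<sigma> permutes A" "\<tau> permutes A"
    and orb: "\<And>x. x \<in> A \<Longrightarrow> orbit \<sigma> x = orbit \<tau> x"
  obtains \<pi> where "\<pi> permutes A" "\<pi> \<circ> \<sigma> = \<tau> \<circ> \<pi>"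
proof -
  have ps: "permutation \<sigma>" and pt: "permutation \<tau>"
    using assms by (auto intro: permutes_imp_permutation)
  have self: "x \<in> orbit \<sigma> x" for x using ps by (rule permutation_self_in_orbit)
  \<comment> \<open>The choice is made from the orbit as a set, so all points of an orbit share the
    same base point.\<close>
  define rep where "rep x = (SOME y. y \<in> orbit \<sigma> x)" for x
  have rep: "rep x \<in> orbit \<sigma> x" for x
    unfolding rep_def using self[of x] by (intro someI_ex[of "\<lambda>y. y \<in> orbit \<sigma> x"]) blast
  have orep: "orbit \<sigma> (rep x) = orbit \<sigma> x" for x
    using rep orbit_cyclic_eq3[OF cyclic_on_orbit'[OF ps]] by blast
  have repA: "rep x \<in> A" if "x \<in> A" for x
    using rep[of x] permutes_orbit_subset[OF assms(2) that] by blast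
  define d where "d x = funpow_dist \<sigma> (rep x) x" for x
  have d: "(\<sigma> ^^ d x) (rep x) = x" for x
    unfolding d_def using self[of x] orep[of x] by (intro funpow_dist_prop) simp
  define \<pi> where "\<pi> x = (if x \<in> A then (\<tau> ^^ d x) (rep x) else x)" for x
  have same: "(\<sigma> ^^ a) r = (\<sigma> ^^ b) r \<longleftrightarrow> (\<tau> ^^ a) r = (\<tau> ^^ b) r" if "r \<in> A" for a b r
    using funpow_eq_iff_mod_card_orbit[OF ps, of a r b] funpow_eq_iff_mod_card_orbit[OF pt, of a r b] orb[OF that] by simp
  have \<pi>_orbit: "\<pi> x \<in> orbit \<sigma> x" if "x \<in> A" for x
  proof -
    have "(\<tau> ^^ d x) (rep x) \<in> orbit \<tau> (rep x)"
      by (simp add: funpow_in_orbit permutation_self_in_orbit[OF pt])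
    then show ?thesis using orb[OF repA[OF that]] orep that by (simp add: \<pi>_def)
  qed
  have "\<pi> permutes A"
  proof (rule inj_imp_permutes)
    show "inj_on \<pi> A"
    proof (rule inj_onI)
      fix x y assume xy: "x \<in> A" "y \<in> A" "\<pi> x = \<pi> y"
      have "orbit \<sigma> x = orbit \<sigma> y"
        using \<pi>_orbit[OF xy(1)] \<pi>_orbit[OF xy(2)] xy(3) orbit_cyclic_eq3[OF cyclic_on_orbit'[OF ps]] by metis
      then have "rep x = rep y" by (simp add: rep_def)
      then show "x = y" using xy same[OF repA[OF xy(1)], of "d x" "d y"] d by (metis \<pi>_def)
    qed
    show "\<pi> x \<in> A" if "x \<in> A" for x
      using \<pi>_orbit[OF that] permutes_orbit_subset[OF assms(2) that] by blast
  qed (use assms in \<open>auto simp: \<pi>_def\<close>)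
  moreover have "\<pi> (\<sigma> x) = \<tau> (\<pi> x)" for x
  proof (cases "x \<in> A")
    case True
    then have sA: "\<sigma> x \<in> A" using assms(2) by (simp add: permutes_in_image)
    have rs: "rep (\<sigma> x) = rep x" unfolding rep_def using permutation_orbit_step[OF ps] by simp
    have "(\<sigma> ^^ d (\<sigma> x)) (rep x) = (\<sigma> ^^ Suc (d x)) (rep x)"
      using d[of "\<sigma> x"] d[of x] rs by simp
    then have "(\<tau> ^^ d (\<sigma> x)) (rep x) = (\<tau> ^^ Suc (d x)) (rep x)"
      using same[OF repA[OF True]] by blast
    then show ?thesis using sA True rs by (simp add: \<pi>_def)
  next
    case False
    then show ?thesis using assms by (simp add: \<pi>_def permutes_not_in permutes_in_image)
  qed
  ultimately show thesis using that by (auto simp: fun_eq_iff)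
qed

text \<open>Sending each \<open>\<tau>\<close>-orbit to the \<open>\<sigma>\<close>-orbit that
  contains it is surjective; as there are at most as many \<open>\<tau>\<close>-orbits, it is
  injective, and no \<open>\<sigma>\<close>-orbit splits.\<close>

lemma orbits_subset_imp_eq:
  assumes "finite A" "\<sigma> permutes A" "\<tau> permutes A"
    and sub: "\<And>x. x \<in> A \<Longrightarrow> orbit \<tau> x \<subseteq> orbit \<sigma> x"
    and le: "card (orbit \<tau> ` A) \<le> card (orbit \<sigma> ` A)"
    and "x \<in> A"
  shows "orbit \<tau> x = orbit \<sigma> x"
proof -
  have ps: "permutation \<sigma>" and pt: "permutation \<tau>"
    using assms by (auto intro: permutes_imp_permutation)
  define h where "h B = (\<Union>x\<in>B. orbit \<sigma> x)" for B
  have h: "h (orbit \<tau> x) = orbit \<sigma> x" if "x \<in> A" for x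
  proof -
    have "orbit \<sigma> y = orbit \<sigma> x" if "y \<in> orbit \<tau> x" for y
      using that sub[OF \<open>x \<in> A\<close>] orbit_cyclic_eq3[OF cyclic_on_orbit'[OF ps]] by blast
    then show ?thesis unfolding h_def using orbit_nonempty[of \<tau> x] by blast
  qed
  then have "h ` orbit \<tau> ` A = orbit \<sigma> ` A" by (auto simp: image_iff)
  then have "card (h ` orbit \<tau> ` A) = card (orbit \<tau> ` A)"
    using le card_image_le[of "orbit \<tau> ` A" h] assms(1) by simp
  then have inj: "inj_on h (orbit \<tau> ` A)" using assms(1) by (intro eq_card_imp_inj_on) auto
  show ?thesis
  proof (rule equalityI[OF sub[OF \<open>x \<in> A\<close>]], rule subsetI)
    fix y assume y: "y \<in> orbit \<sigma> x"
    then have yA: "y \<in> A" using permutes_orbit_subset[OF assms(2) \<open>x \<in> A\<close>] by blast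
    have "orbit \<sigma> y = orbit \<sigma> x" using y orbit_cyclic_eq3[OF cyclic_on_orbit'[OF ps]] by blast
    then have "h (orbit \<tau> y) = h (orbit \<tau> x)" using h yA \<open>x \<in> A\<close> by simp
    then have "orbit \<tau> y = orbit \<tau> x" using inj yA \<open>x \<in> A\<close> by (auto dest: inj_onD)
    then show "y \<in> orbit \<tau> x" using permutation_self_in_orbit[OF pt, of y] by simp
  qed
qed

text \<open>Each point is coloured by the position of its cycle in a list ordered by decreasing
  length; hence \<open>m\<close> is the cycle type of \<open>\<sigma>\<close>.\<close>

lemma orbit_coloring:
  assumes "finite A" "card A = k" "\<sigma> permutes A"
  obtains m p where "m \<in> parts k" "p \<in> colorings A {..<k} m"
    "\<And>x y. x \<in> A \<Longrightarrow> y \<in> A \<Longrightarrow> p x = p y \<longleftrightarrow> orbit \<sigma> x = orbit \<sigma> y"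
proof -
  have ps: "permutation \<sigma>" using assms by (auto intro: permutes_imp_permutation)
  obtain l where l: "set l = orbit \<sigma> ` A" "distinct l"
    using finite_distinct_list[of "orbit \<sigma> ` A"] assms(1) by auto
  define xs where "xs = rev (sort_key card l)"
  have xs: "set xs = orbit \<sigma> ` A" "distinct xs" using l by (auto simp: xs_def)
  have "sorted (map card (sort_key card l))" by (rule sorted_sort_key)
  then have dec: "card (xs ! j) \<le> card (xs ! i)" if "i \<le> j" "j < length xs" for i j
    using that sorted_rev_nth_mono[of "map card xs" i j] by (simp add: xs_def rev_map)
  have len: "length xs \<le> k"
    using card_image_le[OF assms(1), of "orbit \<sigma>"] distinct_card[OF xs(2)] xs(1) assms(2) by simp
  define p where "p = (\<lambda>x\<in>A. THE i. i < length xs \<and> xs ! i = orbit \<sigma> x)"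
  have p: "p x < length xs \<and> xs ! p x = orbit \<sigma> x" if "x \<in> A" for x
  proof -
    have "orbit \<sigma> x \<in> set xs" using xs that by simp
    then have "\<exists>!i. i < length xs \<and> xs ! i = orbit \<sigma> x"
      by (rule distinct_Ex1[OF xs(2)])
    then show ?thesis using theI'[of "\<lambda>i. i < length xs \<and> xs ! i = orbit \<sigma> x"] that by (simp add: p_def)
  qed
  have p_eq: "p x = i \<longleftrightarrow> orbit \<sigma> x = xs ! i" if "x \<in> A" "i < length xs" for x i
    using p[OF that(1)] that xs(2) by (metis nth_eq_iff_index_eq)
  define m where "m i = (if i < length xs then card (xs ! i) else 0)" for i
  have fib: "card {x\<in>A. p x = i} = m i" for i
  proof (cases "i < length xs")
    case True
    then have "xs ! i \<in> orbit \<sigma> ` A" using xs(1) nth_mem by blast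
    then obtain z where z: "z \<in> A" "xs ! i = orbit \<sigma> z" by blast
    have "x \<in> A \<and> orbit \<sigma> x = orbit \<sigma> z \<longleftrightarrow> x \<in> orbit \<sigma> z" for x
      using z permutes_orbit_subset[OF assms(3) z(1)] permutation_self_in_orbit[OF ps, of x]
         orbit_cyclic_eq3[OF cyclic_on_orbit'[OF ps], of x z] by auto
    then have "{x\<in>A. orbit \<sigma> x = orbit \<sigma> z} = xs ! i" unfolding z(2) by blast
    moreover have "{x\<in>A. p x = i} = {x\<in>A. orbit \<sigma> x = orbit \<sigma> z}"
      using p_eq[OF _ True] z(2) by (intro Collect_cong) metis
    ultimately have "{x\<in>A. p x = i} = xs ! i" by simp
    then show ?thesis using True by (simp add: m_def)
  next
    case False
    then have "{x\<in>A. p x = i} = {}" using p by blast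
    then have "card {x\<in>A. p x = i} = 0" by (simp only: card.empty)
    then show ?thesis using False by (simp add: m_def)
  qed
  have pk: "p x < k" if "x \<in> A" for x using p[OF that] len by simp
  have col: "p \<in> colorings A {..<k} m"
    using fib pk by (auto simp: colorings_def p_def)
  have "(\<Sum>i<k. m i) = k"
    using card_eq_sum_fibres[OF assms(1), of "{..<k}" p] pk fib assms(2) by simp
  moreover have "antimono m" using dec by (intro antimonoI) (auto simp: m_def)
  ultimately have "m \<in> parts k" using len by (auto simp: parts_def m_def)
  moreover have "p x = p y \<longleftrightarrow> orbit \<sigma> x = orbit \<sigma> y" if "x \<in> A" "y \<in> A" for x y
    using p_eq[OF that(1)] p[OF that(2)] by (metis that p)
  ultimately show thesis using that col by blast
qed

text \<open>Take \<open>\<rho>\<close> with nonzero value and as many cycles as possible, and the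
  Young subgroup of its cycles. A member of this subgroup with nonzero value has orbits inside those
  of \<open>\<rho>\<close> and no more of them, hence the same orbits, and is conjugate to
  \<open>\<rho>\<close>. So the sum of \<open>g\<close> over the subgroup is a positive multiple of
  \<open>g \<rho>\<close>, against the orthogonality.\<close>

lemma class_function_eq_0:
  fixes g :: "('a \<Rightarrow> 'a) \<Rightarrow> int"
  assumes "finite A" "card A = k"
    and cls: "\<And>\<sigma> \<tau> \<pi>. \<sigma> permutes A \<Longrightarrow> \<tau> permutes A \<Longrightarrow> \<pi> permutes A \<Longrightarrow> \<pi> \<circ> \<sigma> = \<tau> \<circ> \<pi> \<Longrightarrow> g \<sigma> = g \<tau>"
    and orth: "\<And>m. m \<in> parts k \<Longrightarrow> (\<Sum>\<sigma> | \<sigma> permutes A. g \<sigma> * int (fixcol A {..<k} m \<sigma>)) = 0"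
    and "\<sigma> permutes A"
  shows "g \<sigma> = 0"
proof (rule ccontr)
  assume "g \<sigma> \<noteq> 0"
  let ?G = "{\<sigma>. \<sigma> permutes A}"
  have finG: "finite ?G" using assms(1) by (simp add: finite_permutations)
  have "\<exists>\<rho>. (\<rho> permutes A \<and> g \<rho> \<noteq> 0) \<and>
      (\<forall>\<tau>. \<tau> permutes A \<and> g \<tau> \<noteq> 0 \<longrightarrow> card (orbit \<tau> ` A) \<le> card (orbit \<rho> ` A))"
    using \<open>g \<sigma> \<noteq> 0\<close> \<open>\<sigma> permutes A\<close>
    by (intro Lattices_Big.ex_has_greatest_nat[of _ \<sigma> _ "Suc (card A)"])
      (auto simp: le_imp_less_Suc card_image_le[OF assms(1)])
  then obtain \<rho> where \<rho>: "\<rho> permutes A" "g \<rho> \<noteq> 0"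
    and max: "\<And>\<tau>. \<tau> permutes A \<Longrightarrow> g \<tau> \<noteq> 0 \<Longrightarrow> card (orbit \<tau> ` A) \<le> card (orbit \<rho> ` A)" by blast
  have p\<rho>: "permutation \<rho>" using assms(1) \<rho>(1) by (rule permutes_imp_permutation)
  obtain m p where mp: "m \<in> parts k" "p \<in> colorings A {..<k} m"
    and pp: "\<And>x y. x \<in> A \<Longrightarrow> y \<in> A \<Longrightarrow> p x = p y \<longleftrightarrow> orbit \<rho> x = orbit \<rho> y"
    using orbit_coloring[OF assms(1,2) \<rho>(1)] by blast
  define H where "H q = {\<tau> \<in> ?G. \<forall>x\<in>A. q (\<tau> x) = q x}" for q :: "'a \<Rightarrow> nat"
  have gH: "g \<tau> = g \<rho>" if "\<tau> \<in> H p" "g \<tau> \<noteq> 0" for \<tau>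
  proof -
    have \<tau>: "\<tau> permutes A" "\<And>x. x \<in> A \<Longrightarrow> p (\<tau> x) = p x" using that by (auto simp: H_def)
    have "orbit \<tau> x \<subseteq> orbit \<rho> x" if "x \<in> A" for x
    proof
      fix y assume "y \<in> orbit \<tau> x"
      then have "y \<in> A \<and> p y = p x"
        by induction (use \<tau> that in \<open>auto simp: permutes_in_image\<close>)
      then have "orbit \<rho> y = orbit \<rho> x" using pp that by blast
      then show "y \<in> orbit \<rho> x" using permutation_self_in_orbit[OF p\<rho>, of y] by simp
    qed
    then have "orbit \<tau> x = orbit \<rho> x" if "x \<in> A" for x
      using orbits_subset_imp_eq[OF assms(1) \<rho>(1) \<tau>(1) _ max[OF \<tau>(1) \<open>g \<tau> \<noteq> 0\<close>] that] by blast
    then obtain \<pi> where "\<pi> permutes A" "\<pi> \<circ> \<tau> = \<rho> \<circ> \<pi>"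
      using conjugate_if_same_orbits[OF assms(1) \<tau>(1) \<rho>(1)] by blast
    then show ?thesis using cls \<tau>(1) \<rho>(1) by blast
  qed
  have "(\<Sum>\<tau>\<in>H p. g \<tau>) = (\<Sum>\<tau>\<in>H p. if g \<tau> \<noteq> 0 then g \<rho> else 0)"
    using gH by (intro sum.cong) auto
  also have "\<dots> = int (card {\<tau>\<in>H p. g \<tau> \<noteq> 0}) * g \<rho>"
    using finG by (simp add: sum.If_cases Int_def H_def)
  finally have Hp: "(\<Sum>\<tau>\<in>H p. g \<tau>) = int (card {\<tau>\<in>H p. g \<tau> \<noteq> 0}) * g \<rho>" .
  have "p (\<rho> x) = p x" if "x \<in> A" for x
    using pp[of "\<rho> x" x] that \<rho>(1) permutation_orbit_step[OF p\<rho>] by (simp add: permutes_in_image)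
  then have "\<rho> \<in> {\<tau>\<in>H p. g \<tau> \<noteq> 0}" using \<rho> by (simp add: H_def)
  then have "card {\<tau>\<in>H p. g \<tau> \<noteq> 0} > 0" using finG by (auto simp: card_gt_0_iff H_def)
  with Hp \<rho>(2) have Hp0: "(\<Sum>\<tau>\<in>H p. g \<tau>) \<noteq> 0" by simp
  \<comment> \<open>Stabilisers of colourings of the same type are conjugate, so the sum over all
    colourings is a positive multiple of the sum for \<open>p\<close>.\<close>
  have Hq: "(\<Sum>\<tau>\<in>H q. g \<tau>) = (\<Sum>\<tau>\<in>H p. g \<tau>)" if q: "q \<in> colorings A {..<k} m" for q
  proof -
    obtain \<pi> where \<pi>: "\<pi> permutes A" "\<And>x. x \<in> A \<Longrightarrow> p (\<pi> x) = q x"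
      using colorings_transitive[OF assms(1) mp(2) q] by blast
    have i\<pi>: "inv \<pi> permutes A" using \<pi> by (simp add: permutes_inv)
    have qp: "q (inv \<pi> x) = p x" if "x \<in> A" for x
      using \<pi>(2)[of "inv \<pi> x"] that permutes_inverses[OF \<pi>(1)] i\<pi> by (simp add: permutes_in_image)
    show ?thesis
    proof (rule sum.reindex_bij_witness[of _ "\<lambda>\<tau>. inv \<pi> \<circ> (\<tau> \<circ> \<pi>)" "\<lambda>\<tau>. \<pi> \<circ> (\<tau> \<circ> inv \<pi>)"])
      fix \<tau> assume \<tau>: "\<tau> \<in> H q"
      show "inv \<pi> \<circ> ((\<pi> \<circ> (\<tau> \<circ> inv \<pi>)) \<circ> \<pi>) = \<tau>"
        using permutes_inverses[OF \<pi>(1)] by (simp add: fun_eq_iff)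
      show t: "\<pi> \<circ> (\<tau> \<circ> inv \<pi>) \<in> H p"
        using \<tau> \<pi> i\<pi> qp by (auto simp: H_def permutes_compose permutes_in_image)
      show "g (\<pi> \<circ> (\<tau> \<circ> inv \<pi>)) = g \<tau>"
        using \<tau> t \<pi>(1) permutes_inverses[OF \<pi>(1)]
        by (intro cls[symmetric, of _ _ \<pi>]) (auto simp: H_def fun_eq_iff)
    next
      fix \<tau> assume \<tau>: "\<tau> \<in> H p"
      show "\<pi> \<circ> ((inv \<pi> \<circ> (\<tau> \<circ> \<pi>)) \<circ> inv \<pi>) = \<tau>"
        using permutes_inverses[OF \<pi>(1)] by (simp add: fun_eq_iff)
      show "inv \<pi> \<circ> (\<tau> \<circ> \<pi>) \<in> H q"
        using \<tau> \<pi> i\<pi> qp by (auto simp: H_def permutes_compose permutes_in_image)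
    qed
  qed
  have "0 = (\<Sum>\<sigma>\<in>?G. g \<sigma> * of_nat (card (fixed_colorings A {..<k} m \<sigma>)))"
    using orth[OF mp(1)] by (simp add: fixcol_def)
  also have "\<dots> = (\<Sum>q\<in>colorings A {..<k} m. \<Sum>\<tau>\<in>H q. g \<tau>)"
    unfolding H_def using assms(1) finG by (subst sum_card_swap) auto
  also have "\<dots> = (\<Sum>q\<in>colorings A {..<k} m. \<Sum>\<tau>\<in>H p. g \<tau>)" using Hq by (rule sum.cong[OF refl])
  also have "\<dots> = int (card (colorings A {..<k} m)) * (\<Sum>\<tau>\<in>H p. g \<tau>)" by simp
  finally have "card (colorings A {..<k} m) = 0" using Hp0 by simp
  then show False using mp(2) assms(1) by auto
qed

subsection \<open>Permutation characters as integer combinations of Young characters\<close>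

text \<open>The inverse makes this a left action, as \<open>perm_action\<close> demands.\<close>

definition color_act :: "'a set \<Rightarrow> ('a \<Rightarrow> 'a) \<Rightarrow> ('a \<Rightarrow> 'c) \<Rightarrow> 'a \<Rightarrow> 'c" where
  "color_act A \<sigma> p = restrict (p \<circ> inv \<sigma>) A"

lemma color_act_colorings:
  "\<sigma> permutes A \<Longrightarrow> p \<in> colorings A J m \<Longrightarrow> color_act A \<sigma> p \<in> colorings A J m"
  unfolding color_act_def by (rule colorings_comp[OF _ permutes_inv])

lemma color_act_id: "p \<in> colorings A J m \<Longrightarrow> color_act A id p = p"
  by (auto simp: color_act_def colorings_def PiE_def extensional_def)

lemma color_act_comp:
  assumes "\<sigma> permutes A" "\<tau> permutes A"
  shows "color_act A (\<sigma> \<circ> \<tau>) p = color_act A \<sigma> (color_act A \<tau> p)"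
  using assms permutes_in_image[OF permutes_inv[OF assms(1)]]
  by (auto simp: color_act_def fun_eq_iff o_inv_distrib permutes_bij)

lemma perm_action_color_act: "perm_action A (colorings A J m) (color_act A)"
  by (simp add: perm_action_def color_act_colorings color_act_id color_act_comp)

lemma color_act_fixed_iff:
  assumes "\<sigma> permutes A" "p \<in> colorings A J m"
  shows "color_act A \<sigma> p = p \<longleftrightarrow> (\<forall>x\<in>A. p (\<sigma> x) = p x)"
proof
  assume e: "color_act A \<sigma> p = p"
  show "\<forall>x\<in>A. p (\<sigma> x) = p x"
  proof
    fix x assume "x \<in> A"
    then have "color_act A \<sigma> p (\<sigma> x) = p x"
      using assms permutes_inverses[OF assms(1)] by (simp add: color_act_def permutes_in_image)
    then show "p (\<sigma> x) = p x" using e by simp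
  qed
next
  assume e: "\<forall>x\<in>A. p (\<sigma> x) = p x"
  have "p (inv \<sigma> x) = p x" if "x \<in> A" for x
    using e permutes_inverses[OF assms(1)] permutes_in_image[OF permutes_inv[OF assms(1)], of x] that by metis
  moreover have "p x = undefined" if "x \<notin> A" for x
    using that assms(2) by (auto simp: colorings_def PiE_def extensional_def)
  ultimately show "color_act A \<sigma> p = p" by (auto simp: color_act_def fun_eq_iff)
qed

text \<open>The product of two permutation characters is the permutation character on the product
  set, so the integrality of the sign multiplicity applies to it.\<close>

lemma fact_dvd_sum_sign_fixed_fixcol:
  fixes act :: "('a \<Rightarrow> 'a) \<Rightarrow> 'x \<Rightarrow> 'x"
  assumes "finite A" "finite X" "finite J"
    and action: "perm_action A X act"
  shows "fact (card A) dvd (\<Sum>\<sigma> | \<sigma> permutes A. sign \<sigma> * int (card {x\<in>X. act \<sigma> x = x}) * int (fixcol A J m \<sigma>))"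
proof -
  let ?Y = "X \<times> colorings A J m" and ?act = "\<lambda>\<sigma> (x, p). (act \<sigma> x, color_act A \<sigma> p)"
  have "card {y\<in>?Y. ?act \<sigma> y = y} = card {x\<in>X. act \<sigma> x = x} * fixcol A J m \<sigma>" if "\<sigma> permutes A" for \<sigma>
  proof -
    have "{y\<in>?Y. ?act \<sigma> y = y} = {x\<in>X. act \<sigma> x = x} \<times> fixed_colorings A J m \<sigma>"
      using color_act_fixed_iff[OF that] by auto
    then show ?thesis by (simp add: card_cartesian_product fixcol_def)
  qed
  then have "(\<Sum>\<sigma> | \<sigma> permutes A. sign \<sigma> * int (card {x\<in>X. act \<sigma> x = x}) * int (fixcol A J m \<sigma>))
     = (\<Sum>\<sigma> | \<sigma> permutes A. sign \<sigma> * int (card {y\<in>?Y. ?act \<sigma> y = y}))"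
    by (simp add: mult.assoc)
  moreover have "fact (card A) dvd \<dots>"
  proof (rule fact_dvd_sum_sign_fixed)
    show "perm_action A ?Y ?act"
      using action perm_action_color_act[of A J m] by (auto simp: perm_action_def)
  qed (use assms(1-3) in auto)
  ultimately show ?thesis by simp
qed

lemma card_fixed_conjugate:
  fixes act :: "('a \<Rightarrow> 'a) \<Rightarrow> 'x \<Rightarrow> 'x"
  assumes action: "perm_action A X act"
    and perm: "\<sigma> permutes A" "\<tau> permutes A" "\<pi> permutes A" "\<pi> \<circ> \<sigma> = \<tau> \<circ> \<pi>"
  shows "card {x\<in>X. act \<sigma> x = x} = card {x\<in>X. act \<tau> x = x}"
proof (rule bij_betw_same_card, rule bij_betw_byWitness[where f' = "act (inv \<pi>)"])
  note closed = perm_actionD(1)[OF action] and id = perm_actionD(2)[OF action] and comp = perm_actionD(3)[OF action]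
  have i: "inv \<pi> permutes A" using perm by (simp add: permutes_inv)
  have c: "act (inv \<pi>) (act \<pi> x) = x" "act \<pi> (act (inv \<pi>) x) = x" if "x \<in> X" for x
    using comp[OF perm(3) i that] comp[OF i perm(3) that] id[OF that] permutes_inv_o[OF perm(3)] by simp_all
  then show "\<forall>x\<in>{x\<in>X. act \<sigma> x = x}. act (inv \<pi>) (act \<pi> x) = x"
    "\<forall>x\<in>{x\<in>X. act \<tau> x = x}. act \<pi> (act (inv \<pi>) x) = x" by auto
  have e: "\<pi> (\<sigma> x) = \<tau> (\<pi> x)" for x using perm(4) by (metis comp_apply)
  have comm: "inv \<pi> \<circ> \<tau> = \<sigma> \<circ> inv \<pi>"
    using e permutes_inverses[OF perm(3)] by (simp add: fun_eq_iff) metis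
  have act: "act b (act a x) = act a x"
    if "a permutes A" "b permutes A" "c permutes A" "x \<in> X" "act c x = x" "b \<circ> a = a \<circ> c" for a b c x
    using comp[OF that(1,3,4)] comp[OF that(2,1,4)] that by simp
  show "act \<pi> ` {x \<in> X. act \<sigma> x = x} \<subseteq> {x \<in> X. act \<tau> x = x}"
    using act[OF perm(3,2,1)] closed[OF perm(3)] perm(4) by auto
  show "act (inv \<pi>) ` {x \<in> X. act \<tau> x = x} \<subseteq> {x \<in> X. act \<sigma> x = x}"
    using act[OF i perm(1,2)] closed[OF i] comm by auto
qed

lemma fixcol_eq_card_fixed:
  assumes "\<sigma> permutes A"
  shows "fixcol A J m \<sigma> = card {p \<in> colorings A J m. color_act A \<sigma> p = p}"
  unfolding fixcol_def
  by (intro arg_cong[of _ _ card] Collect_cong) (use color_act_fixed_iff[OF assms] in blast)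

lemma fixcol_conjugate:
  assumes "\<sigma> permutes A" "\<tau> permutes A" "\<pi> permutes A" "\<pi> \<circ> \<sigma> = \<tau> \<circ> \<pi>"
  shows "fixcol A J m \<sigma> = fixcol A J m \<tau>"
  unfolding fixcol_eq_card_fixed[OF assms(1)] fixcol_eq_card_fixed[OF assms(2)]
  by (rule card_fixed_conjugate[OF perm_action_color_act assms])

theorem permutation_character_young:
  fixes act :: "('a \<Rightarrow> 'a) \<Rightarrow> 'x \<Rightarrow> 'x"
  assumes A: "finite A" "card A = k" and X: "finite X"
    and action: "perm_action A X act"
  shows "\<exists>a. \<forall>\<sigma>. \<sigma> permutes A \<longrightarrow>
     int (card {x\<in>X. act \<sigma> x = x}) = (\<Sum>\<gamma>\<in>parts k. a \<gamma> * int (fixcol A {..<k} \<gamma> \<sigma>))"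
proof -
  let ?G = "{\<sigma>. \<sigma> permutes A}"
  define F where "F \<sigma> = int (card {x\<in>X. act \<sigma> x = x})" for \<sigma>
  \<comment> \<open>\<open>E f m\<close> is k! times the multiplicity of the sign character of the
    Young subgroup of type \<open>m\<close> in \<open>f\<close>, by Frobenius reciprocity.\<close>
  define E where "E f m = (\<Sum>\<sigma>\<in>?G. sign \<sigma> * f \<sigma> * int (fixcol A {..<k} m \<sigma>))" for f m
  let ?\<eta> = "\<lambda>\<gamma> \<sigma>. int (fixcol A {..<k} \<gamma> \<sigma>)"
  have "fact k dvd E F m" for m
    unfolding E_def F_def A(2)[symmetric]
    by (rule fact_dvd_sum_sign_fixed_fixcol[OF A(1) X _ action]) simp
  then have EF: "E F m = E F m div fact k * fact k" for m by simp
  have E\<eta>: "E (?\<eta> \<gamma>) m = int (card (inj_pairs A k \<gamma> m))" for \<gamma> m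
    unfolding E_def using A(1) by (rule sum_sign_fixcol_fixcol)
  have fixcol_card: "?\<eta> \<gamma> \<sigma> = int (card {p \<in> colorings A {..<k} \<gamma>. color_act A \<sigma> p = p})"
    if "\<sigma> permutes A" for \<gamma> \<sigma>
    using fixcol_eq_card_fixed[OF that] by simp
  have "fact k dvd E (?\<eta> \<gamma>) m" for \<gamma> m
  proof -
    have "E (?\<eta> \<gamma>) m = (\<Sum>\<sigma>\<in>?G. sign \<sigma> * int (card {p \<in> colorings A {..<k} \<gamma>. color_act A \<sigma> p = p})
        * int (fixcol A {..<k} m \<sigma>))"
      unfolding E_def using fixcol_card by (intro sum.cong) auto
    also have "fact k dvd \<dots>"
      unfolding A(2)[symmetric]
      by (rule fact_dvd_sum_sign_fixed_fixcol[OF A(1) _ _ perm_action_color_act]) (use A in simp_all)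
    finally show ?thesis .
  qed
  then have E\<eta>d: "E (?\<eta> \<gamma>) m = E (?\<eta> \<gamma>) m div fact k * fact k" for \<gamma> m by simp
  \<comment> \<open>The conjugate in the second index puts the margins with exactly k! injective
    pairs on the diagonal; the divisions by k! are exact on both sides.\<close>
  have "\<exists>a. \<forall>\<beta>\<in>parts k. (\<Sum>\<gamma>\<in>parts k. a \<gamma> * (E (?\<eta> \<gamma>) (conjugate k \<beta>) div fact k)) = E F (conjugate k \<beta>) div fact k"
  proof (rule unitriangular_solve[where r = "part_rank k"])
    fix \<beta> assume b: "\<beta> \<in> parts k"
    have "card (inj_pairs A k \<beta> (conjugate k \<beta>)) = fact k"
      using card_inj_pairs_conjugate[OF A conjugate_parts[OF b]] conjugate_conjugate[OF b] by simp
    then show "E (?\<eta> \<beta>) (conjugate k \<beta>) div fact k = 1" by (simp add: E\<eta>)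
  next
    fix \<gamma> \<beta> assume b: "\<gamma> \<in> parts k" "\<beta> \<in> parts k" "\<gamma> \<noteq> \<beta>" "E (?\<eta> \<gamma>) (conjugate k \<beta>) div fact k \<noteq> 0"
    then have "inj_pairs A k \<gamma> (conjugate k \<beta>) \<noteq> {}" by (auto simp: E\<eta>)
    then show "part_rank k \<gamma> < part_rank k \<beta>"
      using inj_pairs_part_rank[OF A(1) _ b(1) conjugate_parts[OF b(2)]] b conjugate_conjugate[OF b(2)] by simp
  qed (rule finite_parts)
  then obtain a where a: "\<And>\<beta>. \<beta> \<in> parts k \<Longrightarrow>
     (\<Sum>\<gamma>\<in>parts k. a \<gamma> * (E (?\<eta> \<gamma>) (conjugate k \<beta>) div fact k)) = E F (conjugate k \<beta>) div fact k" by blast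
  \<comment> \<open>The sign is a factor of \<open>h\<close> because
    \<open>class_function_eq_0\<close> pairs with the unsigned Young characters, while
    \<open>E\<close> pairs with the signed ones.\<close>
  define h where "h \<sigma> = sign \<sigma> * (F \<sigma> - (\<Sum>\<gamma>\<in>parts k. a \<gamma> * ?\<eta> \<gamma> \<sigma>))" for \<sigma>
  have "h \<sigma> = 0" if "\<sigma> permutes A" for \<sigma>
  proof (rule class_function_eq_0[OF A _ _ that])
    fix \<sigma> \<tau> \<pi> assume p: "\<sigma> permutes A" "\<tau> permutes A" "\<pi> permutes A" "\<pi> \<circ> \<sigma> = \<tau> \<circ> \<pi>"
    have P: "permutation \<sigma>" "permutation \<tau>" "permutation \<pi>" using p A(1) by (auto intro: permutes_imp_permutation)
    have "sign \<pi> * sign \<sigma> = sign \<tau> * sign \<pi>" using p(4) P sign_compose by metis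
    then have "sign \<sigma> = sign \<tau>" by simp
    moreover have "F \<sigma> = F \<tau>"
      unfolding F_def using card_fixed_conjugate[OF action p] by simp
    ultimately show "h \<sigma> = h \<tau>" unfolding h_def by (simp add: fixcol_conjugate[OF p])
  next
    fix m assume m: "m \<in> parts k"
    define \<beta> where "\<beta> = conjugate k m"
    have \<beta>: "\<beta> \<in> parts k" "conjugate k \<beta> = m"
      using conjugate_parts[OF m] conjugate_conjugate[OF m] by (auto simp: \<beta>_def)
    have "(\<Sum>\<sigma>\<in>?G. h \<sigma> * ?\<eta> m \<sigma>) = E F m - (\<Sum>\<gamma>\<in>parts k. a \<gamma> * E (?\<eta> \<gamma>) m)"
      unfolding E_def h_def
      by (simp add: algebra_simps sum_subtractf sum_distrib_left sum_distrib_right sum.swap[of _ "parts k"])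
    also have "(\<Sum>\<gamma>\<in>parts k. a \<gamma> * E (?\<eta> \<gamma>) m) = (\<Sum>\<gamma>\<in>parts k. a \<gamma> * (E (?\<eta> \<gamma>) m div fact k)) * fact k"
      unfolding sum_distrib_right using E\<eta>d by (intro sum.cong) (auto simp: mult.assoc)
    also have "\<dots> = E F m div fact k * fact k" using a[OF \<beta>(1)] \<beta>(2) by simp
    finally show "(\<Sum>\<sigma>\<in>?G. h \<sigma> * ?\<eta> m \<sigma>) = 0" using EF[of m] by simp
  qed
  then have "\<forall>\<sigma>. \<sigma> permutes A \<longrightarrow> F \<sigma> = (\<Sum>\<gamma>\<in>parts k. a \<gamma> * ?\<eta> \<gamma> \<sigma>)"
    by (simp add: h_def)
  then show ?thesis unfolding F_def by blast
qed

subsection \<open>The span of stabilising irreducible characters\<close>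

lemma young_char_eq_fixcol:
  assumes "\<forall>x\<in>set a. 0 \<le> x"
  shows "young_char n a \<sigma> = int (fixcol {1..n} {..<length a} (\<lambda>j. nat (a ! j)) \<sigma>)"
proof -
  have "int c = a ! j \<longleftrightarrow> c = nat (a ! j)" if "j < length a" for c j
    using assms that nth_mem[OF that] by (metis int_nat_eq nat_int)
  then have "{f. f \<in> {1..n} \<rightarrow>\<^sub>E {..<length a} \<and>
                 (\<forall>j<length a. int (card {x\<in>{1..n}. f x = j}) = a ! j) \<and>
                 (\<forall>x\<in>{1..n}. f (\<sigma> x) = f x)} =
       fixed_colorings {1..n} {..<length a} (\<lambda>j. nat (a ! j)) \<sigma>"
    by (auto simp: colorings_def)
  then show ?thesis using assms by (auto simp: young_char_def fixcol_def not_less)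
qed

lemma sum_young_char:
  assumes "\<forall>x\<in>set a. 0 \<le> x" "sum_list a = int n"
  shows "(\<Sum>\<sigma> | \<sigma> permutes {1..n}. young_char n a \<sigma>) = fact n"
proof -
  have "int (\<Sum>j<length a. nat (a ! j)) = int n"
    using assms by (simp add: sum_list_sum_nth atLeast0LessThan)
  then have "(\<Sum>j<length a. nat (a ! j)) = card {1..n}"
    by (simp only: of_nat_eq_iff card_atLeastAtMost diff_Suc_1)
  then have "(\<Sum>\<sigma> | \<sigma> permutes {1..n}. fixcol {1..n} {..<length a} (\<lambda>j. nat (a ! j)) \<sigma>) = fact n"
    using sum_fixcol[of "{1..n}" "{..<length a}"] by simp
  then show ?thesis
    unfolding young_char_eq_fixcol[OF assms(1)] of_nat_sum[symmetric] by simp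
qed

lemma young_char_neg: "x \<in> set a \<Longrightarrow> x < 0 \<Longrightarrow> young_char n a \<sigma> = 0"
  by (auto simp: young_char_def)

text \<open>Relabelling points and colours gives an injection between fixed colourings; the reverse
  inequality will come from the inverse bijections.\<close>

lemma fixcol_le_transfer:
  assumes "finite B" "finite J'" and h: "bij_betw h B A" and k: "bij_betw k J J'"
    and m: "\<And>j. j \<in> J \<Longrightarrow> m' (k j) = m j"
    and s: "\<And>x. x \<in> B \<Longrightarrow> \<sigma>' x \<in> B \<and> h (\<sigma>' x) = \<sigma> (h x)"
  shows "fixcol A J m \<sigma> \<le> fixcol B J' m' \<sigma>'"
proof -
  let ?g = "inv_into B h" and ?k' = "inv_into J k" and ?F = "\<lambda>f. restrict (\<lambda>x. k (f (h x))) B"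
  have hA: "h x \<in> A" if "x \<in> B" for x using bij_betw_apply[OF h that] .
  have g: "h (?g y) = y" "?g y \<in> B" if "y \<in> A" for y
    using bij_betw_inv_into_right[OF h that] bij_betw_apply[OF bij_betw_inv_into[OF h] that] by auto
  have gh: "?g (h x) = x" if "x \<in> B" for x using bij_betw_inv_into_left[OF h that] .
  have k': "k (?k' i) = i" "?k' i \<in> J" if "i \<in> J'" for i
    using bij_betw_inv_into_right[OF k that] bij_betw_apply[OF bij_betw_inv_into[OF k] that] by auto
  have kJ: "k j \<in> J'" "?k' (k j) = j" if "j \<in> J" for j
    using bij_betw_apply[OF k that] bij_betw_inv_into_left[OF k that] by auto
  show ?thesis
    unfolding fixcol_def
  proof (rule card_inj_on_le[where f = ?F])
    let ?C = "fixed_colorings A J m \<sigma>"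
    have fJ: "f y \<in> J" if "f \<in> ?C" "y \<in> A" for f y using that by (auto simp: colorings_def)
    show "inj_on ?F ?C"
    proof (rule inj_onI)
      fix f f' assume f: "f \<in> ?C" "f' \<in> ?C" "?F f = ?F f'"
      have e: "k (f y) = k (f' y)" if "y \<in> A" for y using fun_cong[OF f(3), of "?g y"] g[OF that] by simp
      have "f y = f' y" if "y \<in> A" for y
        using e[OF that] kJ(2)[OF fJ[OF f(1) that]] kJ(2)[OF fJ[OF f(2) that]] by metis
      then show "f = f'" using f by (auto simp: colorings_def intro: PiE_ext)
    qed
    show "?F ` ?C \<subseteq> fixed_colorings B J' m' \<sigma>'"
    proof (rule image_subsetI)
      fix f assume f: "f \<in> ?C"
      have "card {x\<in>B. ?F f x = i} = m' i" if i: "i \<in> J'" for i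
      proof -
        have "card {x\<in>B. ?F f x = i} = card {y\<in>A. f y = ?k' i}"
          by (rule bij_betw_same_card[of h], rule bij_betw_byWitness[where f' = ?g])
            (use fJ[OF f] kJ k'[OF i] g gh hA in auto)
        then show ?thesis using f k'[OF i] m[of "?k' i"] by (auto simp: colorings_def)
      qed
      then show "?F f \<in> fixed_colorings B J' m' \<sigma>'"
        using f fJ[OF f] kJ s hA by (auto simp: colorings_def)
    qed
  qed (use assms(1,2) in simp)
qed

lemma fixcol_transfer:
  assumes fin: "finite B" "finite J" and h: "bij_betw h B A" and k: "bij_betw k J J'"
    and m: "\<And>j. j \<in> J \<Longrightarrow> m' (k j) = m j"
    and s: "\<And>x. x \<in> B \<Longrightarrow> \<sigma>' x \<in> B \<and> h (\<sigma>' x) = \<sigma> (h x)"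
  shows "fixcol A J m \<sigma> = fixcol B J' m' \<sigma>'"
proof (rule order_antisym)
  have fin': "finite A" "finite J'" using fin bij_betw_finite[OF h] bij_betw_finite[OF k] by auto
  show "fixcol A J m \<sigma> \<le> fixcol B J' m' \<sigma>'"
    using m s by (intro fixcol_le_transfer[OF fin(1) fin'(2) h k]) auto
  show "fixcol B J' m' \<sigma>' \<le> fixcol A J m \<sigma>"
  proof (rule fixcol_le_transfer[OF fin'(1) fin(2) bij_betw_inv_into[OF h] bij_betw_inv_into[OF k]])
    show "m (inv_into J k i) = m' i" if "i \<in> J'" for i
      using m[of "inv_into J k i"] bij_betw_inv_into_right[OF k that]
        bij_betw_apply[OF bij_betw_inv_into[OF k] that] by simp
    show "\<sigma> y \<in> A \<and> inv_into B h (\<sigma> y) = \<sigma>' (inv_into B h y)" if "y \<in> A" for y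
      using s[OF bij_betw_apply[OF bij_betw_inv_into[OF h] that]] bij_betw_inv_into_right[OF h that]
        bij_betw_apply[OF h] bij_betw_inv_into_left[OF h] by metis
  qed
qed

text \<open>Reordering the parts only renames the colours.\<close>

lemma young_char_mset_eq:
  assumes "mset a = mset b" "\<sigma> permutes {1..n}"
  shows "young_char n a \<sigma> = young_char n b \<sigma>"
proof (cases "\<exists>x\<in>set a. x < 0")
  case True
  then show ?thesis using mset_eq_setD[OF assms(1)] by (auto simp: young_char_def)
next
  case False
  obtain p where p: "p permutes {..<length b}" "permute_list p b = a"
    using mset_eq_permutation[OF assms(1)] by blast
  have len: "length a = length b" using p(2) by auto
  have "fixcol {1..n} {..<length a} (\<lambda>j. nat (a ! j)) \<sigma> = fixcol {1..n} {..<length b} (\<lambda>j. nat (b ! j)) \<sigma>"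
  proof (rule fixcol_transfer[where h = id and k = p and \<sigma>' = \<sigma>])
    show "bij_betw p {..<length a} {..<length b}" using permutes_imp_bij[OF p(1)] len by simp
    show "nat (b ! p j) = nat (a ! j)" if "j \<in> {..<length a}" for j
      using permute_list_nth[OF p(1), of j] p(2) len that by simp
    show "\<sigma> x \<in> {1..n} \<and> id (\<sigma> x) = \<sigma> (id x)" if "x \<in> {1..n}" for x
      using permutes_in_image[OF assms(2)] that by simp
  qed simp_all
  then show ?thesis
    using False mset_eq_setD[OF assms(1)] by (simp add: young_char_eq_fixcol not_less)
qed

lemma young_char_append_0: "young_char n (a @ [0]) \<sigma> = young_char n a \<sigma>"
proof (cases "\<exists>x\<in>set a. x < 0")
  case True
  then show ?thesis by (auto simp: young_char_def)
next
  case False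
  have "colorings {1..n} {..<length (a @ [0])} (\<lambda>j. nat ((a @ [0]) ! j)) =
      colorings {1..n} {..<length a} (\<lambda>j. nat (a ! j))"
  proof (intro equalityI subsetI)
    fix f assume "f \<in> colorings {1..n} {..<length (a @ [0])} (\<lambda>j. nat ((a @ [0]) ! j))"
    then have f: "f \<in> {1..n} \<rightarrow>\<^sub>E {..<Suc (length a)}"
      "\<And>j. j < Suc (length a) \<Longrightarrow> card {x \<in> {1..n}. f x = j} = nat ((a @ [0]) ! j)"
      by (auto simp: colorings_def)
    have "f x \<noteq> length a" if "x \<in> {1..n}" for x
      using f(2)[of "length a"] that by auto
    then have "f \<in> {1..n} \<rightarrow>\<^sub>E {..<length a}" using f(1) by (auto simp: PiE_iff less_Suc_eq)
    moreover have "card {x \<in> {1..n}. f x = j} = nat (a ! j)" if "j < length a" for j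
      using f(2)[of j] that by (simp add: nth_append)
    ultimately show "f \<in> colorings {1..n} {..<length a} (\<lambda>j. nat (a ! j))"
      by (auto simp: colorings_def)
  next
    fix f assume f: "f \<in> colorings {1..n} {..<length a} (\<lambda>j. nat (a ! j))"
    then have "f \<in> {1..n} \<rightarrow>\<^sub>E {..<length a}" by (auto simp: colorings_def)
    then have "f x \<noteq> length a" if "x \<in> {1..n}" for x using that by (force simp: PiE_iff)
    then have "{x \<in> {1..n}. f x = length a} = {}" by blast
    then have "card {x \<in> {1..n}. f x = length a} = 0" by (simp only: card.empty)
    then show "f \<in> colorings {1..n} {..<length (a @ [0])} (\<lambda>j. nat ((a @ [0]) ! j))"
      using f by (auto simp: colorings_def less_Suc_eq nth_append PiE_iff)
  qed
  then have "fixcol {1..n} {..<length (a @ [0])} (\<lambda>j. nat ((a @ [0]) ! j)) \<sigma> = 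
    fixcol {1..n} {..<length a} (\<lambda>j. nat (a ! j)) \<sigma>"
    by (simp only: fixcol_def)
  then show ?thesis
    using False young_char_eq_fixcol[of "a @ [0]" n \<sigma>] young_char_eq_fixcol[of a n \<sigma>] by (auto simp: not_less)
qed

text \<open>Zero parts belong to colours that no point carries; they are moved to the end and
  dropped one at a time.\<close>

lemma young_char_filter_0:
  assumes "\<sigma> permutes {1..n}"
  shows "young_char n (filter (\<lambda>x. x \<noteq> 0) a) \<sigma> = young_char n a \<sigma>"
proof -
  have "young_char n (b @ replicate z 0) \<sigma> = young_char n b \<sigma>" for b z
  proof (induction z)
    case (Suc z)
    have "b @ replicate (Suc z) 0 = (b @ replicate z (0::int)) @ [0]" by (simp add: replicate_append_same)
    then show ?case using Suc young_char_append_0 by metis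
  qed simp
  moreover have "mset a = mset (filter (\<lambda>x. x \<noteq> 0) a @ replicate (length (filter (\<lambda>x. x = 0) a)) 0)"
  proof -
    have "filter (\<lambda>x. x = 0) a = replicate (length (filter (\<lambda>x. x = 0) a)) 0"
      by (rule replicate_length_same[symmetric]) auto
    then show ?thesis by (metis (mono_tags, lifting) add.commute mset_append mset_filter multiset_partition filter_cong)
  qed
  ultimately show ?thesis using young_char_mset_eq[OF _ assms] by metis
qed

section \<open>Integer combinations of irreducible characters of shape (n - |\<kappa>|,
  \<kappa>)\<close>

abbreviation irr_comb :: "nat \<Rightarrow> (nat list \<Rightarrow> int) \<Rightarrow> nat \<Rightarrow> (nat \<Rightarrow> nat) \<Rightarrow> int" where
  "irr_comb K c n \<sigma> \<equiv>
     \<Sum>\<kappa>\<in>(\<Union>k\<le>K. int_partitions k). c \<kappa> * irr_char n ((n - sum_list \<kappa>) # \<kappa>) \<sigma>"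

text \<open>The order of the quantifiers is the point: \<open>c\<close> is fixed before
  \<open>n\<close>. For n \<ge> 2K every (n - |\<kappa>|, \<kappa>) with |\<kappa>| \<le> K is a
  partition up to a zero first row, since the parts of \<kappa> are at most K and the first row is
  at least n - K.\<close>

definition in_irr_span :: "nat \<Rightarrow> (nat \<Rightarrow> (nat \<Rightarrow> nat) \<Rightarrow> int) \<Rightarrow> bool" where
  "in_irr_span K F \<longleftrightarrow> (\<exists>c. \<forall>n\<ge>2 * K. \<forall>\<sigma>. \<sigma> permutes {1..n} \<longrightarrow> F n \<sigma> = irr_comb K c n \<sigma>)"

lemma finite_int_partitions: "finite (int_partitions k)"
proof (rule finite_subset)
  show "int_partitions k \<subseteq> {xs. set xs \<subseteq> {..k} \<and> length xs \<le> k}"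
  proof
    fix xs assume xs: "xs \<in> int_partitions k"
    then have pos: "\<forall>x\<in>set xs. 0 < x" and s: "sum_list xs = k"
      by (auto simp: int_partitions_def is_int_partition_def)
    have "length xs \<le> sum_list xs" using pos by (induction xs) auto
    then show "xs \<in> {xs. set xs \<subseteq> {..k} \<and> length xs \<le> k}"
      using s member_le_sum_list by auto
  qed
qed (simp add: finite_lists_length_le)

lemma in_irr_span_cong:
  assumes "in_irr_span K F" "\<And>n \<sigma>. n \<ge> 2 * K \<Longrightarrow> \<sigma> permutes {1..n} \<Longrightarrow> G n \<sigma> = F n \<sigma>"
  shows "in_irr_span K G"
  using assms unfolding in_irr_span_def by auto

lemma in_irr_span_0: "in_irr_span K (\<lambda>n \<sigma>. 0)"
  unfolding in_irr_span_def by (intro exI[of _ "\<lambda>_. 0"]) auto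

lemma in_irr_span_add:
  assumes "in_irr_span K F" "in_irr_span K G"
  shows "in_irr_span K (\<lambda>n \<sigma>. F n \<sigma> + G n \<sigma>)"
proof -
  obtain c d where "\<forall>n\<ge>2 * K. \<forall>\<sigma>. \<sigma> permutes {1..n} \<longrightarrow> F n \<sigma> = irr_comb K c n \<sigma>"
    "\<forall>n\<ge>2 * K. \<forall>\<sigma>. \<sigma> permutes {1..n} \<longrightarrow> G n \<sigma> = irr_comb K d n \<sigma>"
    using assms unfolding in_irr_span_def by blast
  then show ?thesis unfolding in_irr_span_def
    by (intro exI[of _ "\<lambda>\<kappa>. c \<kappa> + d \<kappa>"]) (simp add: sum.distrib distrib_right)
qed

lemma in_irr_span_scale:
  assumes "in_irr_span K F"
  shows "in_irr_span K (\<lambda>n \<sigma>. z * F n \<sigma>)"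
proof -
  obtain c where "\<forall>n\<ge>2 * K. \<forall>\<sigma>. \<sigma> permutes {1..n} \<longrightarrow> F n \<sigma> = irr_comb K c n \<sigma>"
    using assms unfolding in_irr_span_def by blast
  then show ?thesis unfolding in_irr_span_def
    by (intro exI[of _ "\<lambda>\<kappa>. z * c \<kappa>"]) (simp add: sum_distrib_left mult.assoc)
qed

lemma in_irr_span_sum:
  assumes "\<And>i. i \<in> I \<Longrightarrow> in_irr_span K (F i)"
  shows "in_irr_span K (\<lambda>n \<sigma>. \<Sum>i\<in>I. F i n \<sigma>)"
  using assms
  by (induction I rule: infinite_finite_induct) (simp_all add: in_irr_span_0 in_irr_span_add)

lemma in_irr_span_irr_char:
  assumes "\<kappa> \<in> int_partitions k" "k \<le> K"
  shows "in_irr_span K (\<lambda>n \<sigma>. irr_char n ((n - k) # \<kappa>) \<sigma>)"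
proof -
  have k: "sum_list \<kappa> = k" using assms by (auto simp: int_partitions_def is_int_partition_def)
  show ?thesis unfolding in_irr_span_def
  proof (intro exI[of _ "\<lambda>\<mu>. if \<mu> = \<kappa> then 1 else 0"] allI impI)
    fix n \<sigma>
    have "(\<Sum>\<mu>\<in>(\<Union>k\<le>K. int_partitions k). (if \<mu> = \<kappa> then 1 else 0) * irr_char n ((n - sum_list \<mu>) # \<mu>) \<sigma>)
      = (\<Sum>\<mu>\<in>(\<Union>k\<le>K. int_partitions k). if \<mu> = \<kappa> then irr_char n ((n - sum_list \<mu>) # \<mu>) \<sigma> else 0)"
      by (intro sum.cong) auto
    also have "\<dots> = irr_char n ((n - k) # \<kappa>) \<sigma>"
      using assms k by (auto simp: sum.delta finite_int_partitions)
    finally show "irr_char n ((n - k) # \<kappa>) \<sigma> = 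
      (\<Sum>\<mu>\<in>(\<Union>k\<le>K. int_partitions k). (if \<mu> = \<kappa> then 1 else 0) * irr_char n ((n - sum_list \<mu>) # \<mu>) \<sigma>)" by simp
  qed
qed

text \<open>At n = 2K every \<kappa> is completed by a first row to a partition of 2K, and a larger
  n only lengthens that row. For K = 0 the completion of \<open>[]\<close> would be
  \<open>[0]\<close>, which is not a partition.\<close>

lemma in_irr_span_imp_stabilizes:
  assumes "in_irr_span K F" "K > 0"
  shows "stabilizes_beyond F (2 * K)"
proof -
  let ?P = "\<Union>k\<le>K. int_partitions k"
  obtain c where c: "\<And>n \<sigma>. n \<ge> 2 * K \<Longrightarrow> \<sigma> permutes {1..n} \<Longrightarrow> F n \<sigma> = irr_comb K c n \<sigma>"
    using assms unfolding in_irr_span_def by blast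
  define ext where "ext \<kappa> = (2 * K - sum_list \<kappa>) # \<kappa>" for \<kappa>
  \<comment> \<open>Partitions of 2K that are not such completions, those with more than K below the
    first row, get coefficient 0.\<close>
  define c' where "c' lam = (if lam \<in> ext ` ?P then c (tl lam) else 0)" for lam
  have inj: "inj_on ext ?P" by (auto simp: inj_on_def ext_def)
  have P: "sum_list \<kappa> \<le> K" if "\<kappa> \<in> ?P" for \<kappa>
    using that by (auto simp: int_partitions_def is_int_partition_def)
  have sub: "ext ` ?P \<subseteq> int_partitions (2 * K)"
  proof (rule image_subsetI)
    fix \<kappa> assume k: "\<kappa> \<in> ?P"
    have "x \<le> sum_list \<kappa>" if "x \<in> set \<kappa>" for x using that by (intro member_le_sum_list) auto
    then have "x \<le> 2 * K - sum_list \<kappa>" if "x \<in> set \<kappa>" for x using that P[OF k] by fastforce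
    then show "ext \<kappa> \<in> int_partitions (2 * K)"
      using k P[OF k] assms(2) by (auto simp: int_partitions_def is_int_partition_def ext_def)
  qed
  have main: "F n \<sigma> = (\<Sum>lam\<in>int_partitions (2 * K). c' lam * irr_char n (shift_part lam (n - 2 * K)) \<sigma>)"
    if n: "n \<ge> 2 * K" "\<sigma> permutes {1..n}" for n \<sigma>
  proof -
    have "(\<Sum>lam\<in>int_partitions (2 * K). c' lam * irr_char n (shift_part lam (n - 2 * K)) \<sigma>)
      = (\<Sum>lam\<in>ext ` ?P. c' lam * irr_char n (shift_part lam (n - 2 * K)) \<sigma>)"
      using sub by (intro sum.mono_neutral_right finite_int_partitions) (auto simp: c'_def)
    also have "\<dots> = (\<Sum>\<kappa>\<in>?P. c' (ext \<kappa>) * irr_char n (shift_part (ext \<kappa>) (n - 2 * K)) \<sigma>)"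
      using inj by (simp add: sum.reindex)
    also have "\<dots> = irr_comb K c n \<sigma>"
    proof (rule sum.cong)
      fix \<kappa> assume k: "\<kappa> \<in> ?P"
      have "shift_part (ext \<kappa>) (n - 2 * K) = (n - sum_list \<kappa>) # \<kappa>"
        using P[OF k] n(1) by (simp add: shift_part_def ext_def)
      moreover have "c' (ext \<kappa>) = c \<kappa>" using k by (auto simp: c'_def ext_def)
      ultimately show "c' (ext \<kappa>) * irr_char n (shift_part (ext \<kappa>) (n - 2 * K)) \<sigma> =
         c \<kappa> * irr_char n ((n - sum_list \<kappa>) # \<kappa>) \<sigma>" by simp
    qed simp
    finally show ?thesis using c[OF n] by simp
  qed
  have "shift_part lam 0 = lam" if "lam \<in> int_partitions (2 * K)" for lam
    using that assms(2) by (cases lam) (auto simp: shift_part_def int_partitions_def is_int_partition_def)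
  then have "F (2 * K) \<sigma> = (\<Sum>lam\<in>int_partitions (2 * K). c' lam * irr_char (2 * K) lam \<sigma>)"
    if "\<sigma> permutes {1..2 * K}" for \<sigma>
    using main[of "2 * K" \<sigma>] that by (simp cong: sum.cong)
  then show ?thesis unfolding stabilizes_beyond_def using main by (intro exI[of _ c']) auto
qed

section \<open>Termination of the Jacobi-Trudi recursion\<close>

lemma sum_lessThan_card_le:
  "finite S \<Longrightarrow> \<Sum>{..<card S} \<le> \<Sum>(S :: nat set)"
proof (induction "card S" arbitrary: S)
  case (Suc m)
  then have ne: "S \<noteq> {}" by auto
  let ?M = "Max S"
  have "S \<subseteq> {..?M}" using Suc.prems by auto
  from card_mono[OF _ this] have M: "m \<le> ?M" using Suc.hyps(2) by simp
  have c: "card (S - {?M}) = m" using Suc.hyps(2) Suc.prems ne by simp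
  have "\<Sum>{..<m} \<le> \<Sum>(S - {?M})"
    using Suc.hyps(1)[OF c[symmetric]] Suc.prems unfolding c by simp
  moreover have "\<Sum>S = ?M + \<Sum>(S - {?M})"
    using Suc.prems ne by (intro sum.remove) auto
  moreover have "\<Sum>{..<card S} = m + \<Sum>{..<m}" using Suc.hyps(2) by (simp flip: Suc.hyps(2))
  ultimately show ?case using M by simp
qed simp

text \<open>Abel summation: the smallest weight \<open>c\<close> is split off. What remains is a
  shorter sum with decreasing positive weights, plus \<open>c\<close> times the excess of distinct
  natural numbers over 0, ..., m, which is nonnegative.\<close>

lemma rearrangement_strict:
  fixes z :: "nat \<Rightarrow> int" and v :: "nat \<Rightarrow> nat"
  assumes "\<And>i j. i < j \<Longrightarrow> j < m \<Longrightarrow> z j < z i" "\<And>j. j < m \<Longrightarrow> 0 < z j" "inj_on v {..<m}"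
  shows "0 \<le> (\<Sum>j<m. z j * (int (v j) - int j)) \<and>
    ((\<Sum>j<m. z j * (int (v j) - int j)) = 0 \<longrightarrow> (\<forall>j<m. v j = j))"
  using assms
proof (induction m arbitrary: z)
  case (Suc m)
  define c where "c = z m"
  have c: "c > 0" using Suc.prems(2) by (simp add: c_def)
  let ?S = "\<Sum>j<m. (z j - c) * (int (v j) - int j)" and ?T = "\<Sum>j<Suc m. int (v j) - int j"
  have IH: "0 \<le> ?S \<and> (?S = 0 \<longrightarrow> (\<forall>j<m. v j = j))"
  proof (rule Suc.IH)
    show "z j - c < z i - c" if "i < j" "j < m" for i j using Suc.prems(1)[of i j] that by simp
    show "0 < z j - c" if "j < m" for j using Suc.prems(1)[of j m] that by (simp add: c_def)
    show "inj_on v {..<m}" using Suc.prems(3) by (rule inj_on_subset) auto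
  qed
  have "\<Sum>{..<Suc m} \<le> \<Sum>(v ` {..<Suc m})"
    using sum_lessThan_card_le[of "v ` {..<Suc m}"] card_image[OF Suc.prems(3)] by simp
  also have "\<dots> = (\<Sum>j<Suc m. v j)" using Suc.prems(3) by (simp add: sum.reindex)
  finally have "int (\<Sum>j<Suc m. j) \<le> int (\<Sum>j<Suc m. v j)" by (simp only: of_nat_le_iff)
  then have T: "0 \<le> ?T" by (simp add: sum_subtractf)
  have eq: "(\<Sum>j<Suc m. z j * (int (v j) - int j)) = ?S + c * ?T"
  proof -
    have "(\<Sum>j<Suc m. z j * (int (v j) - int j)) = (\<Sum>j<Suc m. (z j - c) * (int (v j) - int j)) + c * ?T"
      unfolding sum_distrib_left sum.distrib[symmetric] by (intro sum.cong) (auto simp: algebra_simps)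
    then show ?thesis by (simp add: c_def)
  qed
  have cT: "0 \<le> c * ?T" using c T by simp
  show ?case
  proof (intro conjI impI allI)
    show "0 \<le> (\<Sum>j<Suc m. z j * (int (v j) - int j))" using eq IH cT by linarith
    fix j assume z: "(\<Sum>j<Suc m. z j * (int (v j) - int j)) = 0" and "j < Suc m"
    have "?S = 0" "c * ?T = 0" using eq IH cT z by linarith+
    then have eqs: "\<forall>j<m. v j = j" "?T = 0" using IH c by auto
    then have "v m = m" by simp
    with eqs \<open>j < Suc m\<close> show "v j = j" by (auto simp: less_Suc_eq)
  qed
qed simp

text \<open>The entries on the right are those after the first in the Jacobi-Trudi term of
  \<open>w\<close>. Among the terms with \<open>w 0 = 0\<close> the identity has the strictly
  smallest sum of squares, by the rearrangement inequality.\<close>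

lemma sum_squares_permuted_less:
  fixes \<kappa> :: "nat \<Rightarrow> nat"
  assumes "\<And>i j. i \<le> j \<Longrightarrow> j < l \<Longrightarrow> \<kappa> j \<le> \<kappa> i" "w permutes {..<Suc l}" "w 0 = 0" "w \<noteq> id"
  shows "(\<Sum>j<l. (int (\<kappa> j))\<^sup>2) < (\<Sum>j<l. (int (\<kappa> j) - int (Suc j) + int (w (Suc j)))\<^sup>2)"
proof -
  define v where "v j = w (Suc j) - 1" for j
  \<comment> \<open>Adding \<open>l\<close> makes the weights positive; it does not affect the
    weighted sum because the displacements \<open>v j - j\<close> add up to 0.\<close>
  define z where "z j = int (\<kappa> j) - int j + int l" for j
  have inj: "inj w" using assms(2) by (rule permutes_inj)
  have w: "w (Suc j) \<noteq> 0" for j using inj assms(3) by (metis injD nat.distinct(1))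
  have wv: "int (w (Suc j)) = int (v j) + 1" for j using w[of j] by (simp add: v_def)
  have "inj_on v {..<l}"
  proof (rule inj_onI)
    fix i j assume "v i = v j"
    then have "w (Suc i) = w (Suc j)" using w[of i] w[of j] by (simp add: v_def)
    then show "i = j" using inj by (auto dest: injD)
  qed
  moreover have "z j < z i" if "i < j" "j < l" for i j using assms(1)[of i j] that by (simp add: z_def)
  moreover have "0 < z j" if "j < l" for j using that by (simp add: z_def)
  ultimately have R: "0 \<le> (\<Sum>j<l. z j * (int (v j) - int j)) \<and>
    ((\<Sum>j<l. z j * (int (v j) - int j)) = 0 \<longrightarrow> (\<forall>j<l. v j = j))"
    by (intro rearrangement_strict) auto
  have "\<not> (\<forall>j<l. v j = j)"
  proof
    assume *: "\<forall>j<l. v j = j"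
    have "w x = x" for x
    proof (cases x)
      case (Suc j)
      then show ?thesis using * wv[of j] permutes_not_in[OF assms(2), of x] by (cases "j < l") auto
    qed (use assms in simp)
    then show False using assms(4) by auto
  qed
  then have R: "0 < (\<Sum>j<l. z j * (int (v j) - int j))" using R by (metis less_le)
  have perm: "(\<Sum>j<l. f (w (Suc j))) = (\<Sum>j<l. f (Suc j))" for f :: "nat \<Rightarrow> int"
    using sum.permute[OF assms(2), of f] assms(3)
    by (simp add: sum.lessThan_Suc_shift del: sum.lessThan_Suc)
  have v1: "(\<Sum>j<l. int (v j) - int j) = 0" using perm[of int] wv by (simp add: sum_subtractf sum.distrib)
  \<comment> \<open>The squares are arranged so that everything after the weighted sum cancels: the
    displacements add up to 0, and \<open>w\<close> only permutes the squares of 1, ..., l.\<close>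
  have "(\<Sum>j<l. (int (\<kappa> j) - int (Suc j) + int (w (Suc j)))\<^sup>2) =
      (\<Sum>j<l. (int (\<kappa> j))\<^sup>2 + 2 * (z j * (int (v j) - int j)) - 2 * (int l + 1) * (int (v j) - int j)
         + ((int (w (Suc j)))\<^sup>2 - (int (Suc j))\<^sup>2))"
    unfolding wv z_def by (intro sum.cong) (auto simp: power2_eq_square algebra_simps)
  also have "\<dots> = (\<Sum>j<l. (int (\<kappa> j))\<^sup>2) + 2 * (\<Sum>j<l. z j * (int (v j) - int j))
      - 2 * (int l + 1) * (\<Sum>j<l. int (v j) - int j)
      + ((\<Sum>j<l. (int (w (Suc j)))\<^sup>2) - (\<Sum>j<l. (int (Suc j))\<^sup>2))"
    by (simp only: sum.distrib sum_subtractf sum_distrib_left[symmetric])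
  also have "\<dots> = (\<Sum>j<l. (int (\<kappa> j))\<^sup>2) + 2 * (\<Sum>j<l. z j * (int (v j) - int j))"
    using perm[of "\<lambda>x. (int x)\<^sup>2"] v1 by simp
  finally show ?thesis using R by simp
qed

text \<open>Keeps the second measure of the coming induction from being truncated at 0.\<close>

lemma sum_list_squares_le:
  fixes b :: "int list"
  assumes "\<forall>x\<in>set b. 0 \<le> x"
  shows "(\<Sum>x\<leftarrow>b. x\<^sup>2) \<le> (sum_list b)\<^sup>2"
  using assms
proof (induction b)
  case (Cons a b)
  then have "0 \<le> a" "0 \<le> sum_list b" by (auto intro: sum_list_nonneg)
  then have "0 \<le> a * sum_list b" by simp
  then show ?case using Cons by (simp add: power2_sum)
qed simp

lemma map_upt_Suc_shift: "map f [0..<Suc l] = f 0 # map (\<lambda>j. f (Suc j)) [0..<l]"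
  by (simp add: upt_conv_Cons map_Suc_upt[symmetric] del: upt_Suc)

abbreviation padded_young_char :: "int list \<Rightarrow> nat \<Rightarrow> (nat \<Rightarrow> nat) \<Rightarrow> int" where
  "padded_young_char b n \<sigma> \<equiv> young_char n ((int n - sum_list b) # b) \<sigma>"

text \<open>The induction is lexicographic. In the determinant for \<kappa>, a term with a negative
  entry vanishes; otherwise a term with w 0 > 0 has a total after the first entry that is smaller by
  \<open>w 0\<close>, while a term with w 0 = 0 keeps the total but has a larger sum of squares. So
  every term except the identity is in the span by induction or zero.\<close>

lemma young_char_in_irr_span:
  assumes "sum_list b \<le> int K"
  shows "in_irr_span K (\<lambda>n \<sigma>. padded_young_char b n \<sigma>)"
  using assms
proof (induction b rule: wf_induct_rule[OF wf_measures[of "[\<lambda>b. nat (sum_list b), \<lambda>b. nat ((sum_list b)\<^sup>2 - (\<Sum>x\<leftarrow>b. x\<^sup>2))]"]])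
  case (1 b)
  show ?case
  proof (cases "\<exists>x\<in>set b. x < 0")
    case True
    then have "padded_young_char b n \<sigma> = 0" for n \<sigma>
      by (auto intro: young_char_neg)
    then show ?thesis using in_irr_span_0 by simp
  next
    case False
    \<comment> \<open>A Young character depends only on the multiset of its nonzero parts, so
      \<open>b\<close> may be replaced by a partition.\<close>
    define \<kappa> where "\<kappa> = rev (sort (map nat (filter (\<lambda>x. x \<noteq> 0) b)))"
    define l where "l = length \<kappa>"
    define s where "s = sum_list \<kappa>"
    have mset: "mset (map int \<kappa>) = mset (filter (\<lambda>x. x \<noteq> 0) b)"
    proof -
      have "map (int \<circ> nat) (filter (\<lambda>x. x \<noteq> 0) b) = filter (\<lambda>x. x \<noteq> 0) b"
        using False by (intro map_idI) auto
      moreover have "mset (map int \<kappa>) = mset (map (int \<circ> nat) (filter (\<lambda>x. x \<noteq> 0) b))"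
        by (simp add: \<kappa>_def multiset.map_comp)
      ultimately show ?thesis by (simp only:)
    qed
    have sumf: "sum_list (map g (filter (\<lambda>x. x \<noteq> 0) b)) = sum_list (map g b)" if "g 0 = 0" for g :: "int \<Rightarrow> int"
      using that by (induction b) auto
    have sumk: "sum_list (map g (map int \<kappa>)) = sum_list (map g b)" if "g 0 = 0" for g :: "int \<Rightarrow> int"
      using mset sumf[of g, OF that] by (metis mset_map sum_mset_sum_list)
    have int_sum: "sum_list (map int xs) = int (sum_list xs)" for xs by (induction xs) auto
    have s: "int s = sum_list b" using sumk[of "\<lambda>x. x"] by (simp add: s_def int_sum)
    have sK: "s \<le> K" using 1(2) s by simp
    have sq: "(\<Sum>j<l. (int (\<kappa> ! j))\<^sup>2) = (\<Sum>x\<leftarrow>b. x\<^sup>2)"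
      using sumk[of "\<lambda>x. x\<^sup>2"] by (simp add: l_def sum_list_sum_nth atLeast0LessThan)
    have dec: "sorted_wrt (\<ge>) \<kappa>" by (simp add: \<kappa>_def sorted_wrt_rev)
    have \<kappa>_part: "\<kappa> \<in> int_partitions s"
      using False dec by (auto simp: int_partitions_def is_int_partition_def s_def) (auto simp: \<kappa>_def)
    have nth_dec: "\<kappa> ! j \<le> \<kappa> ! i" if "i \<le> j" "j < l" for i j
      using that dec sorted_wrt_nth_less[OF dec, of i j] by (cases "i = j") (auto simp: l_def)
    define bw where "bw w = map (\<lambda>j. int (\<kappa> ! j) - int (Suc j) + int (w (Suc j))) [0..<l]" for w :: "nat \<Rightarrow> nat"
    let ?W = "{w. w permutes {..<Suc l}}"
    have sum_bw: "sum_list (bw w) = int s - int (w 0)" if "w permutes {..<Suc l}" for w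
    proof -
      have "(\<Sum>j<Suc l. int (w j)) = (\<Sum>j<Suc l. int j)"
        using sum.permute[OF that, of int] by (simp add: o_def)
      then have "int (w 0) + (\<Sum>j<l. int (w (Suc j))) = (\<Sum>j<l. int (Suc j))"
        by (subst (asm) (1 2) sum.lessThan_Suc_shift) simp
      moreover have "sum_list (bw w) = int s - (\<Sum>j<l. int (Suc j)) + (\<Sum>j<l. int (w (Suc j)))"
        by (simp add: bw_def s_def l_def sum_list_sum_nth atLeast0LessThan sum.distrib sum_subtractf)
      ultimately show ?thesis by linarith
    qed
    have bw_id: "bw id = map int \<kappa>"
      by (rule nth_equalityI) (auto simp: bw_def l_def)
    have irr: "irr_char n ((n - s) # \<kappa>) \<sigma> =
        (\<Sum>w\<in>?W. sign w * padded_young_char (bw w) n \<sigma>)" if "n \<ge> 2 * K" for n \<sigma>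
    proof -
      have ns: "int (n - s) = int n - int s" using that sK by simp
      \<comment> \<open>The first entry absorbs the shift by \<open>w 0\<close>, so the tail
        \<open>bw w\<close> does not depend on \<open>n\<close>.\<close>
      have "map (\<lambda>j. int (((n - s) # \<kappa>) ! j) - int j + int (w j)) [0..<Suc l] =
          (int n - sum_list (bw w)) # bw w" if "w \<in> ?W" for w
        using that sum_bw[of w] ns unfolding map_upt_Suc_shift by (simp add: bw_def)
      then show ?thesis unfolding irr_char_def by (simp add: l_def)
    qed
    have finW: "finite ?W" by (simp add: finite_permutations)
    have "in_irr_span K (\<lambda>n \<sigma>. padded_young_char (bw w) n \<sigma>)"
      if w: "w \<in> ?W - {id}" for w
    proof (cases "\<exists>x\<in>set (bw w). x < 0")
      case True
      then have "padded_young_char (bw w) n \<sigma> = 0" for n \<sigma>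
        by (auto intro: young_char_neg)
      then show ?thesis using in_irr_span_0 by simp
    next
      case nonneg: False
      have sw: "sum_list (bw w) = int s - int (w 0)" using sum_bw w by simp
      have "0 \<le> sum_list (bw w)" using nonneg by (intro sum_list_nonneg) auto
      have "(bw w, b) \<in> measures [\<lambda>b. nat (sum_list b), \<lambda>b. nat ((sum_list b)\<^sup>2 - (\<Sum>x\<leftarrow>b. x\<^sup>2))]"
      proof (cases "w 0 = 0")
        case True
        have "(\<Sum>x\<leftarrow>b. x\<^sup>2) < (\<Sum>x\<leftarrow>bw w. x\<^sup>2)"
          using sum_squares_permuted_less[of l "\<lambda>j. \<kappa> ! j" w] nth_dec w True sq
          by (simp add: bw_def sum_list_sum_nth atLeast0LessThan)
        moreover have "(\<Sum>x\<leftarrow>bw w. x\<^sup>2) \<le> (sum_list (bw w))\<^sup>2"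
          using nonneg by (intro sum_list_squares_le) auto
        ultimately show ?thesis using sw s True by simp
      next
        case False
        then show ?thesis using sw s \<open>0 \<le> sum_list (bw w)\<close> by simp
      qed
      then show ?thesis using 1 sw s by (intro 1(1)) auto
    qed
    then have rest: "in_irr_span K (\<lambda>n \<sigma>. \<Sum>w\<in>?W - {id}. - sign w * padded_young_char (bw w) n \<sigma>)"
      by (intro in_irr_span_sum in_irr_span_scale)
    show ?thesis
    proof (rule in_irr_span_cong[OF in_irr_span_add[OF in_irr_span_irr_char[OF \<kappa>_part sK] rest]])
      fix n \<sigma> assume n: "n \<ge> 2 * K" "\<sigma> permutes {1..n}"
      have "padded_young_char b n \<sigma> = young_char n ((int n - sum_list b) # map int \<kappa>) \<sigma>"
      proof -
        have "filter (\<lambda>x. x \<noteq> 0) (map int \<kappa>) = map int \<kappa>"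
          using mset_eq_setD[OF mset] by (intro filter_True) auto
        then have "mset (filter (\<lambda>x. x \<noteq> 0) ((int n - sum_list b) # b)) = 
          mset (filter (\<lambda>x. x \<noteq> 0) ((int n - sum_list b) # map int \<kappa>))"
          using mset by simp
        then show ?thesis
          using young_char_mset_eq[OF _ n(2)] young_char_filter_0[OF n(2)] by metis
      qed
      also have "\<dots> = padded_young_char (bw id) n \<sigma>"
        using s by (simp add: bw_id s_def int_sum)
      also have "\<dots> = irr_char n ((n - s) # \<kappa>) \<sigma> +
          (\<Sum>w\<in>?W - {id}. - sign w * padded_young_char (bw w) n \<sigma>)"
        unfolding irr[OF n(1)] using finW by (simp add: sum.remove[of ?W id] sum_negf)
      finally show "padded_young_char b n \<sigma> = irr_char n ((n - s) # \<kappa>) \<sigma> +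
          (\<Sum>w\<in>?W - {id}. - sign w * padded_young_char (bw w) n \<sigma>)" .
    qed
  qed
qed

subsection \<open>Chains of set partitions\<close>

text \<open>On partitions of one set this agrees with \<open>refines\<close>. Once singleton blocks
  are dropped, a block need no longer be a union of the smaller blocks that are kept, while
  containment still makes sense.\<close>

definition finer :: "'a set set \<Rightarrow> 'a set set \<Rightarrow> bool" where
  "finer P Q \<longleftrightarrow> (\<forall>B\<in>P. \<exists>C\<in>Q. B \<subseteq> C)"

lemma finer_refl: "finer P P"
  by (auto simp: finer_def)

lemma finer_trans: "finer P Q \<Longrightarrow> finer Q R \<Longrightarrow> finer P R"
  unfolding finer_def by (meson order_trans)

lemma partition_on_unique:
  "partition_on A P \<Longrightarrow> B \<in> P \<Longrightarrow> C \<in> P \<Longrightarrow> x \<in> B \<Longrightarrow> x \<in> C \<Longrightarrow> B = C"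
  unfolding partition_on_def by (meson disjointD disjoint_iff)

lemma partition_on_nonempty: "partition_on A P \<Longrightarrow> B \<in> P \<Longrightarrow> \<exists>x. x \<in> B"
  unfolding partition_on_def by (metis ex_in_conv)

lemma partition_on_cover: "partition_on A P \<Longrightarrow> x \<in> A \<Longrightarrow> \<exists>B\<in>P. x \<in> B"
  unfolding partition_on_def by blast

lemma partition_on_subset: "partition_on A P \<Longrightarrow> B \<in> P \<Longrightarrow> B \<subseteq> A"
  unfolding partition_on_def by blast

lemma refines_iff_finer:
  assumes "setpart n P" "setpart n Q"
  shows "refines P Q \<longleftrightarrow> finer P Q"
proof
  have PQ: "partition_on {1..n} P" "partition_on {1..n} Q" using assms by (auto simp: setpart_def)
  assume r: "refines P Q"
  show "finer P Q" unfolding finer_def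
  proof
    fix B assume B: "B \<in> P"
    obtain x where x: "x \<in> B" using partition_on_nonempty[OF PQ(1) B] by blast
    obtain C where C: "C \<in> Q" "x \<in> C"
      using partition_on_cover[OF PQ(2)] partition_on_subset[OF PQ(1) B] x by blast
    obtain X where X: "X \<subseteq> P" "C = \<Union>X" using r C(1) by (auto simp: refines_def)
    then have "B \<in> X" using partition_on_unique[OF PQ(1) B _ x] C(2) by blast
    then show "\<exists>C\<in>Q. B \<subseteq> C" using X C(1) by blast
  qed
next
  have PQ: "partition_on {1..n} P" "partition_on {1..n} Q" using assms by (auto simp: setpart_def)
  assume f: "finer P Q"
  show "refines P Q" unfolding refines_def
  proof
    fix C assume C: "C \<in> Q"
    have "C \<subseteq> \<Union>{B\<in>P. B \<subseteq> C}"
    proof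
      fix x assume x: "x \<in> C"
      then obtain B where B: "B \<in> P" "x \<in> B"
        using partition_on_cover[OF PQ(1)] partition_on_subset[OF PQ(2) C] by blast
      obtain C' where C': "C' \<in> Q" "B \<subseteq> C'" using f B(1) by (auto simp: finer_def)
      then have "C' = C" using partition_on_unique[OF PQ(2) _ C _ x] B(2) by blast
      then show "x \<in> \<Union>{B\<in>P. B \<subseteq> C}" using B C' by blast
    qed
    then show "\<exists>X\<subseteq>P. C = \<Union>X" by (intro exI[of _ "{B\<in>P. B \<subseteq> C}"]) auto
  qed
qed

text \<open>Each block of \<open>P\<close> goes to the block of \<open>Q\<close> that contains it. A
  point of a block of \<open>Q\<close> lies in some block of \<open>P\<close>, so the map is onto;
  numbers of blocks are compared through it.\<close>

lemma finer_map:
  assumes "partition_on A P" "partition_on A Q" "finer P Q"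
  obtains f where "\<And>B. B \<in> P \<Longrightarrow> f B \<in> Q" "\<And>B. B \<in> P \<Longrightarrow> B \<subseteq> f B" "f ` P = Q"
proof -
  have "\<forall>B\<in>P. \<exists>C. C \<in> Q \<and> B \<subseteq> C" using assms(3) by (auto simp: finer_def)
  then obtain f where f: "\<And>B. B \<in> P \<Longrightarrow> f B \<in> Q" "\<And>B. B \<in> P \<Longrightarrow> B \<subseteq> f B" by metis
  have "C \<in> f ` P" if C: "C \<in> Q" for C
  proof -
    obtain x where x: "x \<in> C" using partition_on_nonempty[OF assms(2) C] by blast
    obtain B where B: "B \<in> P" "x \<in> B"
      using partition_on_cover[OF assms(1)] partition_on_subset[OF assms(2) C] x by blast
    have "f B = C" using partition_on_unique[OF assms(2) f(1)[OF B(1)] C _ x] f(2)[OF B(1)] B(2) by blast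
    then show ?thesis using B(1) by blast
  qed
  then have "f ` P = Q" using f(1) by blast
  then show thesis using that f by blast
qed

lemma finer_card_le:
  assumes "finite A" "partition_on A P" "partition_on A Q" "finer P Q"
  shows "card Q \<le> card P"
proof -
  obtain f where "f ` P = Q" using finer_map[OF assms(2-4)] by metis
  then show ?thesis using card_image_le[OF finite_elements[OF assms(1,2)], of f] by simp
qed

lemma finer_card_eq:
  assumes "finite A" "partition_on A P" "partition_on A Q" "finer P Q" "card P = card Q"
  shows "P = Q"
proof -
  obtain f where f: "\<And>B. B \<in> P \<Longrightarrow> f B \<in> Q" "\<And>B. B \<in> P \<Longrightarrow> B \<subseteq> f B" "f ` P = Q"
    using finer_map[OF assms(2-4)] by blast
  have inj: "inj_on f P"
    using f(3) assms(5) finite_elements[OF assms(1,2)] by (intro eq_card_imp_inj_on) auto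
  have "f B = B" if B: "B \<in> P" for B
  proof
    show "f B \<subseteq> B"
    proof
      fix y assume y: "y \<in> f B"
      then obtain B' where B': "B' \<in> P" "y \<in> B'"
        using partition_on_cover[OF assms(2)] partition_on_subset[OF assms(3) f(1)[OF B]] by blast
      then have "f B' = f B"
        using partition_on_unique[OF assms(3) f(1)[OF B'(1)] f(1)[OF B] _ y] f(2)[OF B'(1)] by blast
      then show "y \<in> B" using inj B B' by (auto dest: inj_onD)
    qed
  qed (use f(2) B in blast)
  then show ?thesis using f(3) by simp
qed

text \<open>Gradedness of the partition lattice: merging two blocks of \<open>P\<close> inside one
  block of \<open>Q\<close> lowers the number of blocks by one.\<close>

lemma finer_interpolate:
  assumes "finite A" "partition_on A P" "partition_on A Q" "finer P Q" "card Q \<le> c" "c \<le> card P"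
  shows "\<exists>R. partition_on A R \<and> finer P R \<and> finer R Q \<and> card R = c"
  using assms(2,4,6)
proof (induction "card P - c" arbitrary: P)
  case 0
  then show ?case using finer_refl[of P] by (intro exI[of _ P]) auto
next
  case (Suc d)
  have finP: "finite P" using finite_elements[OF assms(1) Suc.prems(1)] .
  obtain f where f: "\<And>B. B \<in> P \<Longrightarrow> f B \<in> Q" "\<And>B. B \<in> P \<Longrightarrow> B \<subseteq> f B" "f ` P = Q"
    using finer_map[OF Suc.prems(1) assms(3) Suc.prems(2)] by blast
  \<comment> \<open>\<open>P\<close> has more blocks than \<open>Q\<close>, so two of them lie in
    the same block of \<open>Q\<close>.\<close>
  have "card (f ` P) < card P" using f(3) assms(5) Suc.hyps(2) by simp
  then have "\<not> inj_on f P" by (rule pigeonhole)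
  then obtain X Y where XY: "X \<in> P" "Y \<in> P" "X \<noteq> Y" "f X = f Y" by (auto simp: inj_on_def)
  define P' where "P' = insert (X \<union> Y) (P - {X, Y})"
  have meet: "B = X" if "B \<in> P" "x \<in> B" "x \<in> X" for B x
    using partition_on_unique[OF Suc.prems(1) that(1) XY(1) that(2,3)] .
  have meetY: "B = Y" if "B \<in> P" "x \<in> B" "x \<in> Y" for B x
    using partition_on_unique[OF Suc.prems(1) that(1) XY(2) that(2,3)] .
  have nX: "X \<union> Y \<notin> P"
  proof
    assume u: "X \<union> Y \<in> P"
    obtain x y where xy: "x \<in> X" "y \<in> Y"
      using partition_on_nonempty[OF Suc.prems(1)] XY by metis
    have "X \<union> Y = X" using meet[OF u, of x] xy by blast
    moreover have "X \<union> Y = Y" using meetY[OF u, of y] xy by blast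
    ultimately show False using XY(3) by blast
  qed
  have part: "partition_on A P'"
  proof (rule partition_onI)
    show "\<Union>P' = A" using XY Suc.prems(1) unfolding P'_def partition_on_def by auto
    show "disjnt p q" if "p \<in> P'" "q \<in> P'" "p \<noteq> q" for p q
      using that meet meetY partition_on_unique[OF Suc.prems(1)] unfolding P'_def disjnt_def by blast
    show "{} \<notin> P'" using XY Suc.prems(1) unfolding P'_def partition_on_def by auto
  qed
  have card: "card P' = card P - 1"
  proof -
    have "card P' = Suc (card (P - {X, Y}))" using nX finP by (simp add: P'_def)
    also have "card (P - {X, Y}) = card P - 2" using XY finP by (simp add: card_Diff_subset)
    finally show ?thesis using Suc.hyps(2) card_mono[OF finP, of "{X, Y}"] XY by simp
  qed
  have "finer P P'" unfolding finer_def
  proof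
    fix B assume "B \<in> P"
    then show "\<exists>C\<in>P'. B \<subseteq> C" by (cases "B \<in> {X, Y}") (auto simp: P'_def)
  qed
  moreover have "finer P' Q"
  proof -
    have "X \<union> Y \<subseteq> f X" using f(2)[OF XY(1)] f(2)[OF XY(2)] XY(4) by simp
    then show ?thesis using Suc.prems(2) f(1)[OF XY(1)] unfolding finer_def P'_def by blast
  qed
  moreover have "d = card P' - c" "c \<le> card P'" using card Suc.hyps(2) by auto
  ultimately obtain R where "partition_on A R" "finer P' R" "finer R Q" "card R = c"
    using Suc.hyps(1)[of P'] part by blast
  then show ?case using finer_trans[OF \<open>finer P P'\<close>] by blast
qed

lemma card_setpart_le: "setpart n P \<Longrightarrow> card P \<le> n"
proof -
  assume P: "setpart n P"
  then have p: "partition_on {1..n} P" by (simp add: setpart_def)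
  have "card P \<le> card {1..n}"
    by (intro finer_card_le[of "{1..n}" "(\<lambda>x. {x}) ` {1..n}" P, THEN order_trans] partition_on_singletons p)
       (use partition_on_cover[OF p] in \<open>auto simp: finer_def card_image\<close>)
  then show ?thesis by simp
qed

lemma finer_prank_le:
  assumes "setpart n P" "setpart n Q" "finer P Q"
  shows "prank n P \<le> prank n Q"
  using finer_card_le[of "{1..n}" P Q] assms by (auto simp: setpart_def prank_def)

lemma finer_prank_eq:
  assumes "setpart n P" "setpart n Q" "finer P Q" "prank n P = prank n Q"
  shows "P = Q"
  using finer_card_eq[of "{1..n}" P Q] assms card_setpart_le[of n P] card_setpart_le[of n Q]
  by (auto simp: setpart_def prank_def)

lemma comparable_prank_le:
  assumes "setpart n P" "setpart n Q" "finer P Q \<or> finer Q P" "prank n P \<le> prank n Q"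
  shows "finer P Q"
  using finer_prank_eq[OF assms(2,1)] finer_prank_le[OF assms(2,1)] assms(3,4) finer_refl
  by (metis le_antisym)

lemma is_chain_iff:
  "is_chain n T C \<longleftrightarrow> (\<forall>P\<in>C. setpart n P \<and> prank n P \<in> T) \<and> (\<forall>P\<in>C. \<forall>Q\<in>C. finer P Q \<or> finer Q P)"
proof -
  have "\<forall>P\<in>C. \<forall>Q\<in>C. refines P Q = finer P Q" if "\<forall>P\<in>C. setpart n P"
    using that refines_iff_finer by blast
  then show ?thesis
    by (cases "\<forall>P\<in>C. setpart n P") (auto simp: is_chain_def rank_sel_def subset_iff)
qed

lemma finite_chain: "is_chain n T C \<Longrightarrow> finite C"
proof (rule finite_subset)
  assume "is_chain n T C"
  then show "C \<subseteq> {P. partition_on {1..n} P}" by (auto simp: is_chain_iff setpart_def)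
qed (simp add: finitely_many_partition_on)

text \<open>The missing rank \<open>t\<close> is filled by interpolating between the coarsest member
  of rank below \<open>t\<close> and the finest member of rank above \<open>t\<close>.\<close>

lemma chain_extend:
  assumes C: "is_chain n T C" and t: "t \<in> T" "t < n" "t \<notin> prank n ` C"
  shows "\<exists>R. R \<notin> C \<and> is_chain n T (insert R C)"
proof -
  have Cs: "setpart n P" if "P \<in> C" for P using C that by (auto simp: is_chain_iff)
  have Cc: "finer P Q \<or> finer Q P" if "P \<in> C" "Q \<in> C" for P Q using C that by (auto simp: is_chain_iff)
  have Cle: "finer P Q" if "P \<in> C" "Q \<in> C" "prank n P \<le> prank n Q" for P Q
    using comparable_prank_le Cs Cc that by blast
  have n: "1 \<le> n" using t by simp
  define L where "L = {P\<in>C. prank n P < t}"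
  define U where "U = {P\<in>C. t < prank n P}"
  have fin: "finite L" "finite U" using finite_chain[OF C] by (auto simp: L_def U_def)
  \<comment> \<open>The discrete and the one-block partition, of ranks 0 and n - 1, act as
    neighbours when no member lies below or above; their ranks may lie outside
    \<open>T\<close>.\<close>
  let ?bot = "(\<lambda>x. {x}) ` {1..n}" and ?top = "{{1..n}}"
  have bot: "setpart n ?bot" by (simp add: setpart_def partition_on_singletons)
  have top: "setpart n ?top" using n by (simp add: setpart_def partition_on_space)
  have botf: "finer ?bot Q" if "setpart n Q" for Q
    using that partition_on_cover[of "{1..n}" Q] by (auto simp: finer_def setpart_def)
  have topf: "finer P ?top" if "setpart n P" for P
    using that partition_on_subset[of "{1..n}" P] by (auto simp: finer_def setpart_def)
  have "\<exists>P. setpart n P \<and> prank n P \<le> t \<and> (\<forall>P'\<in>L. finer P' P) \<and> (\<forall>Q\<in>U. finer P Q)"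
  proof (cases "L = {}")
    case True
    have "prank n ?bot \<le> t" by (simp add: prank_def card_image)
    then show ?thesis using True bot botf Cs by (intro exI[of _ ?bot]) (auto simp: U_def)
  next
    case False
    then have "Max (prank n ` L) \<in> prank n ` L" using fin by simp
    then obtain P where P: "P \<in> L" "prank n P = Max (prank n ` L)" by auto
    have "finer P' P" if "P' \<in> L" for P'
      using that P fin by (intro Cle) (auto simp: L_def)
    moreover have "finer P Q" if "Q \<in> U" for Q
      using that P(1) by (intro Cle) (auto simp: L_def U_def)
    ultimately show ?thesis using P(1) Cs by (intro exI[of _ P]) (auto simp: L_def)
  qed
  then obtain P where P: "setpart n P" "prank n P \<le> t" "\<And>P'. P' \<in> L \<Longrightarrow> finer P' P" "\<And>Q. Q \<in> U \<Longrightarrow> finer P Q"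
    by blast
  have "\<exists>Q. setpart n Q \<and> t \<le> prank n Q \<and> (\<forall>Q'\<in>U. finer Q Q') \<and> finer P Q"
  proof (cases "U = {}")
    case True
    have "t \<le> prank n ?top" using t by (simp add: prank_def)
    then show ?thesis using True top topf P by (intro exI[of _ ?top]) auto
  next
    case False
    then have "Min (prank n ` U) \<in> prank n ` U" using fin by simp
    then obtain Q where Q: "Q \<in> U" "prank n Q = Min (prank n ` U)" by auto
    have "finer Q Q'" if "Q' \<in> U" for Q'
      using that Q fin by (intro Cle) (auto simp: U_def)
    then show ?thesis using Q(1) Cs P by (intro exI[of _ Q]) (auto simp: U_def)
  qed
  then obtain Q where Q: "setpart n Q" "t \<le> prank n Q" "\<And>Q'. Q' \<in> U \<Longrightarrow> finer Q Q'" "finer P Q" by blast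
  have "card Q \<le> n - t" "n - t \<le> card P" 
    using P(2) Q(2) t(2) card_setpart_le[OF Q(1)] by (auto simp: prank_def)
  then obtain R where R: "partition_on {1..n} R" "finer P R" "finer R Q" "card R = n - t"
    using finer_interpolate[of "{1..n}" P Q "n - t"] P(1) Q(1,4) by (auto simp: setpart_def)
  have Rt: "prank n R = t" using R(4) t(2) by (simp add: prank_def)
  then have "R \<notin> C" using t(3) by blast
  have cmp: "finer R X \<or> finer X R" if "X \<in> C" for X
  proof -
    have "X \<in> L \<or> X \<in> U" using that t(3) by (auto simp: L_def U_def)
    then show ?thesis using P(3) Q(3) R finer_trans by blast
  qed
  have "is_chain n T (insert R C)"
    unfolding is_chain_iff using C[unfolded is_chain_iff] cmp R(1) Rt t(1) finer_refl[of R]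
    by (auto simp: setpart_def)
  with \<open>R \<notin> C\<close> show ?thesis by blast
qed

text \<open>Any missing rank can be filled, and comparable partitions of equal rank coincide; so
  maximality means exactly one member in each rank of \<open>T\<close>.\<close>

lemma max_chains_eq:
  assumes "T \<subseteq> {..<n}"
  shows "max_chains n T = {C. is_chain n T C \<and> prank n ` C = T}"
proof (intro equalityI subsetI)
  fix C assume C: "C \<in> max_chains n T"
  then have ch: "is_chain n T C" and mx: "\<And>D. is_chain n T D \<Longrightarrow> \<not> C \<subset> D" by (auto simp: max_chains_def)
  have "t \<in> prank n ` C" if "t \<in> T" for t
  proof (rule ccontr)
    assume "t \<notin> prank n ` C"
    then obtain R where "R \<notin> C" "is_chain n T (insert R C)"
      using chain_extend[OF ch \<open>t \<in> T\<close>] assms \<open>t \<in> T\<close> by auto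
    then show False using mx[of "insert R C"] by auto
  qed
  then show "C \<in> {C. is_chain n T C \<and> prank n ` C = T}" using ch by (auto simp: is_chain_iff)
next
  fix C assume "C \<in> {C. is_chain n T C \<and> prank n ` C = T}"
  then have C: "is_chain n T C" "prank n ` C = T" by auto
  have False if D: "is_chain n T D" "C \<subset> D" for D
  proof -
    obtain P where P: "P \<in> D" "P \<notin> C" using D(2) by blast
    then have "prank n P \<in> prank n ` C" using D(1) C(2) by (auto simp: is_chain_iff)
    then obtain Q where Q: "Q \<in> C" "prank n Q = prank n P" by auto
    then have "setpart n P" "setpart n Q" "finer P Q \<or> finer Q P"
      using D P(1) C(1) by (auto simp: is_chain_iff)
    then have "P = Q" using finer_prank_eq Q(2) by metis
    then show False using P(2) Q(1) by simp
  qed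
  then show "C \<in> max_chains n T" using C(1) by (auto simp: max_chains_def)
qed

subsection \<open>Chains of non-singleton blocks\<close>

text \<open>A partition is encoded by its non-singleton blocks; rank, refinement and the
  group action are then independent of the ground set.\<close>

definition partial_part :: "nat set set \<Rightarrow> bool" where
  "partial_part R \<longleftrightarrow> finite R \<and> disjoint R \<and> (\<forall>B\<in>R. 2 \<le> card B)"

definition partial_rank :: "nat set set \<Rightarrow> nat" where
  "partial_rank R = (\<Sum>B\<in>R. card B - 1)"

text \<open>No ground set occurs here: all dependence on \<open>n\<close> is moved into the
  condition that the support lies in {1..n}.\<close>

definition partial_chains :: "nat set \<Rightarrow> nat set set set set" where
  "partial_chains T = {D. (\<forall>R\<in>D. partial_part R) \<and> (\<forall>R\<in>D. \<forall>R'\<in>D. finer R R' \<or> finer R' R) \<and>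
     partial_rank ` D = T}"

definition big_blocks :: "nat set set \<Rightarrow> nat set set" where
  "big_blocks P = {B\<in>P. 2 \<le> card B}"

definition add_singletons :: "nat \<Rightarrow> nat set set \<Rightarrow> nat set set" where
  "add_singletons n R = R \<union> (\<lambda>x. {x}) ` ({1..n} - \<Union>R)"

lemma partial_part_big_blocks:
  assumes "setpart n P"
  shows "partial_part (big_blocks P)" "\<Union>(big_blocks P) \<subseteq> {1..n}"
proof -
  have p: "partition_on {1..n} P" using assms by (simp add: setpart_def)
  have "finite P" using finite_elements[OF _ p] by simp
  moreover have "disjoint (big_blocks P)"
    using partition_onD2[OF p] by (auto simp: big_blocks_def pairwise_def)
  ultimately show "partial_part (big_blocks P)" by (auto simp: partial_part_def big_blocks_def)
  show "\<Union>(big_blocks P) \<subseteq> {1..n}" using partition_on_subset[OF p] by (auto simp: big_blocks_def)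
qed

lemma setpart_block:
  assumes "setpart n P" "B \<in> P"
  shows "finite B" "1 \<le> card B"
proof -
  have p: "partition_on {1..n} P" using assms by (simp add: setpart_def)
  show "finite B" using partition_on_subset[OF p assms(2)] finite_subset by blast
  then show "1 \<le> card B" using partition_on_nonempty[OF p assms(2)] by (auto simp: Suc_le_eq card_gt_0_iff)
qed

text \<open>n minus the number of blocks is the sum of |B| - 1 over all blocks, to which singletons
  contribute nothing.\<close>

lemma partial_rank_big_blocks:
  assumes "setpart n P"
  shows "partial_rank (big_blocks P) = prank n P"
proof -
  have p: "partition_on {1..n} P" using assms by (simp add: setpart_def)
  have fin: "finite P" using finite_elements[OF _ p] by simp
  have "n = (\<Sum>B\<in>P. card B)" using product_partition[OF p] setpart_block(1)[OF assms] by simp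
  then have "prank n P = (\<Sum>B\<in>P. card B - 1)"
    using sum_subtractf_nat[of P "\<lambda>_. 1" card] setpart_block(2)[OF assms] by (simp add: prank_def)
  also have "\<dots> = (\<Sum>B\<in>big_blocks P. card B - 1)"
    using fin by (intro sum.mono_neutral_right) (auto simp: big_blocks_def)
  finally show ?thesis by (simp add: partial_rank_def)
qed

lemma add_singletons_big_blocks:
  assumes "setpart n P"
  shows "add_singletons n (big_blocks P) = P"
proof -
  have p: "partition_on {1..n} P" using assms by (simp add: setpart_def)
  have single: "B \<in> big_blocks P \<or> (\<exists>x. B = {x})" if B: "B \<in> P" for B
  proof (cases "2 \<le> card B")
    case False
    then have "card B = 1" using setpart_block(2)[OF assms B] by linarith
    then show ?thesis by (auto simp: card_1_singleton_iff)
  qed (simp add: big_blocks_def B)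
  show ?thesis
  proof (intro equalityI subsetI)
    fix B assume "B \<in> add_singletons n (big_blocks P)"
    then consider "B \<in> big_blocks P" | x where "x \<in> {1..n}" "x \<notin> \<Union>(big_blocks P)" "B = {x}"
      by (auto simp: add_singletons_def)
    then show "B \<in> P"
    proof cases
      case 2
      then obtain C where C: "C \<in> P" "x \<in> C" using partition_on_cover[OF p] by blast
      then have "C \<notin> big_blocks P" using 2 by blast
      then have "C = {x}" using single[OF C(1)] C(2) by auto
      then show ?thesis using 2 C by simp
    qed (simp add: big_blocks_def)
  next
    fix B assume B: "B \<in> P"
    show "B \<in> add_singletons n (big_blocks P)"
    proof (cases "B \<in> big_blocks P")
      case False
      then obtain x where x: "B = {x}" using single[OF B] by blast
      have "x \<notin> \<Union>(big_blocks P)"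
      proof
        assume "x \<in> \<Union>(big_blocks P)"
        then obtain C where C: "C \<in> big_blocks P" "x \<in> C" by blast
        then have "C = B" using partition_on_unique[OF p _ B C(2)] x by (auto simp: big_blocks_def)
        then show False using False C by simp
      qed
      moreover have "x \<in> {1..n}" using partition_on_subset[OF p B] x by simp
      ultimately show ?thesis using x by (simp add: add_singletons_def)
    qed (simp add: add_singletons_def)
  qed
qed

lemma setpart_add_singletons:
  assumes "partial_part R" "\<Union>R \<subseteq> {1..n}"
  shows "setpart n (add_singletons n R)" "big_blocks (add_singletons n R) = R"
proof -
  have "{} \<notin> R" using assms(1) by (auto simp: partial_part_def)
  moreover have "disjnt p q" if "p \<in> add_singletons n R" "q \<in> add_singletons n R" "p \<noteq> q" for p q
    using that assms(1) unfolding add_singletons_def partial_part_def pairwise_def disjnt_def by blast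
  ultimately show "setpart n (add_singletons n R)"
    unfolding setpart_def using assms(2) by (intro partition_onI) (auto simp: add_singletons_def)
  show "big_blocks (add_singletons n R) = R"
    using assms(1) by (auto simp: big_blocks_def add_singletons_def partial_part_def)
qed

text \<open>A singleton lies in a block of any partition, and a block that contains a non-singleton
  block is itself non-singleton.\<close>

lemma finer_big_blocks_iff:
  assumes "setpart n P" "setpart n Q"
  shows "finer (big_blocks P) (big_blocks Q) \<longleftrightarrow> finer P Q"
proof
  assume f: "finer (big_blocks P) (big_blocks Q)"
  show "finer P Q" unfolding finer_def
  proof
    fix B assume B: "B \<in> P"
    show "\<exists>C\<in>Q. B \<subseteq> C"
    proof (cases "B \<in> big_blocks P")
      case True
      then show ?thesis using f by (auto simp: finer_def big_blocks_def)
    next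
      case False
      then have "card B = 1" using setpart_block(2)[OF assms(1) B] B by (simp add: big_blocks_def)
      then obtain x where "B = {x}" by (auto simp: card_1_singleton_iff)
      then show ?thesis
        using partition_on_cover[of "{1..n}" Q x] partition_on_subset[of "{1..n}" P B] assms B
        by (auto simp: setpart_def)
    qed
  qed
next
  assume f: "finer P Q"
  show "finer (big_blocks P) (big_blocks Q)" unfolding finer_def
  proof
    fix B assume B: "B \<in> big_blocks P"
    then obtain C where C: "C \<in> Q" "B \<subseteq> C" using f by (auto simp: finer_def big_blocks_def)
    then have "card B \<le> card C" using setpart_block(1)[OF assms(2)] by (intro card_mono) auto
    then have "C \<in> big_blocks Q" using B C by (simp add: big_blocks_def)
    then show "\<exists>C\<in>big_blocks Q. B \<subseteq> C" using C by blast
  qed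
qed

lemma big_blocks_inj: "inj_on big_blocks {P. setpart n P}"
  by (rule inj_on_inverseI[where g = "add_singletons n"]) (simp add: add_singletons_big_blocks)

lemma full_chains_image:
  "(\<lambda>C. big_blocks ` C) ` {C. is_chain n T C \<and> prank n ` C = T} = {D \<in> partial_chains T. \<Union>(\<Union>D) \<subseteq> {1..n}}"
proof (intro equalityI subsetI)
  fix D assume "D \<in> (\<lambda>C. big_blocks ` C) ` {C. is_chain n T C \<and> prank n ` C = T}"
  then obtain C where C: "is_chain n T C" "prank n ` C = T" "D = big_blocks ` C" by blast
  have s: "setpart n P" if "P \<in> C" for P using C(1) that by (auto simp: is_chain_iff)
  have "partial_rank ` D = prank n ` C"
    unfolding C(3) image_image using partial_rank_big_blocks[OF s] by (rule image_cong[OF refl])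
  moreover have "finer (big_blocks P) (big_blocks Q) = finer P Q" if "P \<in> C" "Q \<in> C" for P Q
    using finer_big_blocks_iff[OF s[OF that(1)] s[OF that(2)]] .
  then have "\<forall>R\<in>D. \<forall>R'\<in>D. finer R R' \<or> finer R' R"
    using C by (simp add: is_chain_iff)
  moreover have "\<Union>(\<Union>D) \<subseteq> {1..n}" using partial_part_big_blocks(2)[OF s] unfolding C(3) by blast
  ultimately show "D \<in> {D \<in> partial_chains T. \<Union>(\<Union>D) \<subseteq> {1..n}}"
    using partial_part_big_blocks(1)[OF s] C by (auto simp: partial_chains_def)
next
  fix D assume D: "D \<in> {D \<in> partial_chains T. \<Union>(\<Union>D) \<subseteq> {1..n}}"
  have R: "partial_part R" "\<Union>R \<subseteq> {1..n}" if "R \<in> D" for R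
  proof -
    show "partial_part R" using D that by (auto simp: partial_chains_def)
    show "\<Union>R \<subseteq> {1..n}" using D that by blast
  qed
  let ?C = "add_singletons n ` D"
  have s: "setpart n (add_singletons n R)" "big_blocks (add_singletons n R) = R" if "R \<in> D" for R
    using setpart_add_singletons R that by auto
  have DC: "D = big_blocks ` ?C" using s(2) by (auto simp: image_image)
  have pr: "prank n (add_singletons n R) = partial_rank R" if "R \<in> D" for R
    using partial_rank_big_blocks[OF s(1)[OF that]] s(2)[OF that] by simp
  have "prank n ` ?C = T"
    unfolding image_image using pr D by (auto simp: partial_chains_def)
  moreover have "finer (add_singletons n R) (add_singletons n R') \<or> finer (add_singletons n R') (add_singletons n R)"
    if "R \<in> D" "R' \<in> D" for R R'
  proof -
    have "finer R R' \<or> finer R' R" using D that by (simp add: partial_chains_def)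
    then show ?thesis
      using finer_big_blocks_iff[OF s(1)[OF that(1)] s(1)[OF that(2)]]
        finer_big_blocks_iff[OF s(1)[OF that(2)] s(1)[OF that(1)]] s(2)[OF that(1)] s(2)[OF that(2)] by simp
  qed
  moreover have "partial_rank R \<in> T" if "R \<in> D" for R using D that by (auto simp: partial_chains_def)
  ultimately have "is_chain n T ?C" "prank n ` ?C = T"
    using s(1) pr by (auto simp: is_chain_iff)
  then show "D \<in> (\<lambda>C. big_blocks ` C) ` {C. is_chain n T C \<and> prank n ` C = T}" using DC by blast
qed

section \<open>Transport of chains along injective maps\<close>

lemma act_chain_comp: "act_chain (f \<circ> g) D = act_chain f (act_chain g D)"
  by (simp add: act_chain_def act_part_def image_image)

lemma act_chain_cong:
  assumes "\<And>x. x \<in> \<Union>(\<Union>D) \<Longrightarrow> f x = g x"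
  shows "act_chain f D = act_chain g D"
proof -
  have "f ` B = g ` B" if "P \<in> D" "B \<in> P" for P B
    by (rule image_cong[OF refl], rule assms) (use that in blast)
  then have "act_part f P = act_part g P" if "P \<in> D" for P
    unfolding act_part_def by (rule image_cong[OF refl]) (use \<open>\<And>P B. P \<in> D \<Longrightarrow> B \<in> P \<Longrightarrow> f ` B = g ` B\<close> that in blast)
  then show ?thesis unfolding act_chain_def by (rule image_cong[OF refl])
qed

lemma act_chain_id: "act_chain id D = D"
  by (simp add: act_chain_def act_part_def)

lemma act_chain_eq_self: "(\<And>x. x \<in> \<Union>(\<Union>D) \<Longrightarrow> f x = x) \<Longrightarrow> act_chain f D = D"
  using act_chain_cong[of D f id] by (simp add: act_chain_id)

lemma Union_act_chain: "\<Union>(\<Union>(act_chain f D)) = f ` \<Union>(\<Union>D)"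
  by (auto simp: act_chain_def act_part_def)

text \<open>\<open>h\<close> is only required to be injective on the support, since it is used for
  bijections between different supports as well as for permutations.\<close>

lemma act_chain_partial_chains:
  assumes "D \<in> partial_chains T" "inj_on h (\<Union>(\<Union>D))"
  shows "act_chain h D \<in> partial_chains T"
proof -
  have inj: "inj_on h (\<Union>R)" if "R \<in> D" for R by (rule inj_on_subset[OF assms(2)]) (use that in blast)
  have injB: "inj_on h B" if "R \<in> D" "B \<in> R" for R B by (rule inj_on_subset[OF inj[OF that(1)]]) (use that(2) in blast)
  have P: "partial_part R" if "R \<in> D" for R using assms(1) that by (auto simp: partial_chains_def)
  have inji: "inj_on ((`) h) R" if "R \<in> D" for R
    using inj[OF that] by (rule inj_on_image)
  have "partial_part (act_part h R)" if "R \<in> D" for R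
  proof -
    have "disjnt (h ` B) (h ` C)" if "B \<in> R" "C \<in> R" "h ` B \<noteq> h ` C" for B C
    proof -
      have "B \<noteq> C" using that by auto
      then have "B \<inter> C = {}" using P[OF \<open>R \<in> D\<close>] that by (auto simp: partial_part_def disjoint_def)
      then show ?thesis using inj_on_image_Int[OF inj[OF \<open>R \<in> D\<close>], of B C] that by (auto simp: disjnt_def)
    qed
    moreover have "card (h ` B) = card B" if "B \<in> R" for B
      using injB[OF \<open>R \<in> D\<close> that] by (rule card_image)
    ultimately show ?thesis
      using P[OF that] unfolding partial_part_def act_part_def pairwise_def by auto
  qed
  moreover have "partial_rank (act_part h R) = partial_rank R" if "R \<in> D" for R
    unfolding partial_rank_def act_part_def using inji[OF that] injB[OF that]
    by (simp add: sum.reindex card_image)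
  moreover have "finer (act_part h R) (act_part h R')" if "finer R R'" for R R'
    using that unfolding finer_def act_part_def by (auto intro!: image_mono)
  ultimately show ?thesis
    using assms(1) unfolding partial_chains_def act_chain_def
    by (simp add: image_image cong: image_cong) blast
qed

lemma big_blocks_act_part:
  assumes "inj \<sigma>"
  shows "big_blocks (act_part \<sigma> P) = act_part \<sigma> (big_blocks P)"
  using card_image[OF inj_on_subset[OF assms]] by (auto simp: big_blocks_def act_part_def)

lemma setpart_act_part:
  assumes "setpart n P" "\<sigma> permutes {1..n}"
  shows "setpart n (act_part \<sigma> P)"
proof -
  have "partition_on (\<sigma> ` {1..n}) ((`) \<sigma> ` P - {{}})"
    using assms by (intro partition_on_inj_image) (auto simp: setpart_def permutes_inj_on)
  moreover have "(`) \<sigma> ` P - {{}} = act_part \<sigma> P"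
    using partition_onD3[of "{1..n}" P] assms(1) by (auto simp: act_part_def setpart_def)
  ultimately show ?thesis using assms(2) by (simp add: setpart_def permutes_image)
qed

text \<open>Passing to the non-singleton blocks is injective on chains and commutes with the action,
  so fixed chains correspond to fixed chains.\<close>

lemma alphaT_eq_partial_chains:
  assumes "T \<subseteq> {..<n}" "\<sigma> permutes {1..n}"
  shows "alphaT n T \<sigma> = int (card {D \<in> partial_chains T. \<Union>(\<Union>D) \<subseteq> {1..n} \<and> act_chain \<sigma> D = D})"
proof -
  let ?F = "{C. is_chain n T C \<and> prank n ` C = T}" and ?b = "\<lambda>C. big_blocks ` C"
  have sub: "C \<subseteq> {P. setpart n P}" if "C \<in> ?F" for C using that by (auto simp: is_chain_iff)
  have inj: "inj_on ?b ?F"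
    by (rule inj_on_subset[OF inj_on_image[of big_blocks ?F]], rule inj_on_subset[OF big_blocks_inj[of n]])
      (use sub in auto)
  have eqv: "?b (act_chain \<sigma> C) = act_chain \<sigma> (?b C)" for C
    using big_blocks_act_part[OF permutes_inj[OF assms(2)]] by (auto simp: act_chain_def image_image)
  have fixed: "act_chain \<sigma> (?b C) = ?b C \<longleftrightarrow> act_chain \<sigma> C = C" if "C \<in> ?F" for C
  proof -
    have "act_chain \<sigma> C \<subseteq> {P. setpart n P}"
      using sub[OF that] setpart_act_part[OF _ assms(2)] by (auto simp: act_chain_def)
    then show ?thesis
      using inj_on_image_eq_iff[OF big_blocks_inj[of n], of "act_chain \<sigma> C" C] sub[OF that] eqv by simp
  qed
  have "?b ` {C\<in>?F. act_chain \<sigma> C = C} = {D \<in> ?b ` ?F. act_chain \<sigma> D = D}"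
    using fixed by blast
  also have "\<dots> = {D \<in> partial_chains T. \<Union>(\<Union>D) \<subseteq> {1..n} \<and> act_chain \<sigma> D = D}"
    unfolding full_chains_image by auto
  finally have im: "?b ` {C\<in>?F. act_chain \<sigma> C = C} =
    {D \<in> partial_chains T. \<Union>(\<Union>D) \<subseteq> {1..n} \<and> act_chain \<sigma> D = D}" .
  have "inj_on ?b {C\<in>?F. act_chain \<sigma> C = C}" by (rule inj_on_subset[OF inj]) auto
  from card_image[OF this] im have "card {C\<in>?F. act_chain \<sigma> C = C} =
    card {D \<in> partial_chains T. \<Union>(\<Union>D) \<subseteq> {1..n} \<and> act_chain \<sigma> D = D}" by simp
  then show ?thesis unfolding alphaT_def max_chains_eq[OF assms(1)] by simp
qed

text \<open>Each block satisfies |B| \<le> 2(|B| - 1). Equality for pairs is what makes the bound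
  attained in the sharpness argument.\<close>

lemma card_Union_partial_part_le:
  assumes "partial_part R"
  shows "card (\<Union>R) \<le> 2 * partial_rank R"
proof -
  have "card (\<Union>R) \<le> (\<Sum>B\<in>R. card B)" using assms by (intro card_Union_le_sum_card)
  also have "\<dots> \<le> (\<Sum>B\<in>R. 2 * (card B - 1))"
    using assms by (intro sum_mono) (auto simp: partial_part_def)
  finally show ?thesis by (simp add: partial_rank_def sum_distrib_left)
qed

text \<open>The coarsest member contains the supports of all others, so the bound for a single
  partition applies to the union.\<close>

lemma card_Union_partial_chain_le:
  assumes "D \<in> partial_chains T" "T \<subseteq> {..i}" "\<Union>(\<Union>D) \<subseteq> {1..n}"
  shows "card (\<Union>(\<Union>D)) \<le> 2 * i"
proof (cases "D = {}")
  case False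
  have R: "partial_part R" "\<Union>R \<subseteq> {1..n}" "partial_rank R \<le> i" if "R \<in> D" for R
    using assms that by (auto simp: partial_chains_def)
  have "\<exists>R. R \<in> D \<and> (\<forall>R'. R' \<in> D \<longrightarrow> partial_rank R' \<le> partial_rank R)"
    using False R(3) by (intro Lattices_Big.ex_has_greatest_nat[of _ "SOME R. R \<in> D" _ "Suc i"])
      (auto simp: some_in_eq le_imp_less_Suc)
  then obtain M where M: "M \<in> D" "\<And>R. R \<in> D \<Longrightarrow> partial_rank R \<le> partial_rank M" by blast
  have "\<Union>R \<subseteq> \<Union>M" if "R \<in> D" for R
  proof -
    let ?a = "add_singletons n"
    note s = setpart_add_singletons[OF R(1,2)[OF that]] setpart_add_singletons[OF R(1,2)[OF M(1)]]
    have "finer R M \<or> finer M R" using assms(1) that M(1) by (auto simp: partial_chains_def)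
    then have "finer (?a R) (?a M) \<or> finer (?a M) (?a R)"
      using finer_big_blocks_iff[OF s(1,3)] finer_big_blocks_iff[OF s(3,1)] s by simp
    moreover have "prank n (?a R) \<le> prank n (?a M)"
      using partial_rank_big_blocks[OF s(1)] partial_rank_big_blocks[OF s(3)] s M(2)[OF that] by simp
    ultimately have "finer (?a R) (?a M)" using comparable_prank_le s by blast
    then have "finer R M" using finer_big_blocks_iff[OF s(1,3)] s by simp
    then show ?thesis by (auto simp: finer_def)
  qed
  then have "\<Union>(\<Union>D) = \<Union>M" using M(1) by blast
  then show ?thesis using card_Union_partial_part_le[OF R(1)[OF M(1)]] R(3)[OF M(1)] by simp
qed simp

section \<open>Chains with prescribed support and their Young coefficients\<close>

definition spanning_chains :: "nat set \<Rightarrow> nat set \<Rightarrow> nat set set set set" where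
  "spanning_chains T A = {D \<in> partial_chains T. \<Union>(\<Union>D) = A}"

abbreviation fixed_chains :: "nat set \<Rightarrow> nat set \<Rightarrow> (nat \<Rightarrow> nat) \<Rightarrow> nat set set set set" where
  "fixed_chains T A \<sigma> \<equiv> {D \<in> spanning_chains T A. act_chain \<sigma> D = D}"

lemma finite_partial_chains: "finite A \<Longrightarrow> finite {D \<in> partial_chains T. \<Union>(\<Union>D) \<subseteq> A}"
  by (rule finite_subset[of _ "Pow (Pow (Pow A))"]) auto

lemma spanning_chains_permutation_character:
  "\<exists>a. \<forall>\<sigma>. \<sigma> permutes {1..k} \<longrightarrow>
     int (card (fixed_chains T {1..k} \<sigma>)) =
     (\<Sum>\<gamma>\<in>parts k. a \<gamma> * int (fixcol {1..k} {..<k} \<gamma> \<sigma>))"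
proof (rule permutation_character_young)
  show "finite (spanning_chains T {1..k})"
    by (rule finite_subset[OF _ finite_partial_chains[of "{1..k}" T]]) (auto simp: spanning_chains_def)
  show "perm_action {1..k} (spanning_chains T {1..k}) act_chain"
    unfolding perm_action_def
    using act_chain_partial_chains[of _ T]
    by (simp add: spanning_chains_def Union_act_chain permutes_image permutes_inj_on act_chain_id act_chain_comp)
qed auto

text \<open>The coefficients are indexed by the size of the support and not by \<open>n\<close>;
  this is the source of stability.\<close>

definition young_coeffs :: "nat set \<Rightarrow> (nat \<Rightarrow> (nat \<Rightarrow> nat) \<Rightarrow> int) \<Rightarrow> bool" where
  "young_coeffs T a \<longleftrightarrow> (\<forall>k \<sigma>. \<sigma> permutes {1..k} \<longrightarrow> int (card (fixed_chains T {1..k} \<sigma>)) =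
     (\<Sum>\<gamma>\<in>parts k. a k \<gamma> * int (fixcol {1..k} {..<k} \<gamma> \<sigma>)))"

lemma ex_young_coeffs: "\<exists>a. young_coeffs T a"
  unfolding young_coeffs_def by (rule choice) (intro allI spanning_chains_permutation_character)

lemma spanning_chains_le_transfer:
  assumes "finite B" and h: "bij_betw h A B" and s: "\<And>x. x \<in> A \<Longrightarrow> h (\<sigma> x) = \<sigma>' (h x)"
  shows "card (fixed_chains T A \<sigma>) \<le> card (fixed_chains T B \<sigma>')"
proof (rule card_inj_on_le[where f = "act_chain h"])
  let ?X = "fixed_chains T A \<sigma>"
  have hA: "h ` A = B" "inj_on h A" using h by (auto simp: bij_betw_def)
  have X: "D \<in> partial_chains T" "\<Union>(\<Union>D) = A" "act_chain \<sigma> D = D" if "D \<in> ?X" for D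
    using that by (auto simp: spanning_chains_def)
  show "inj_on (act_chain h) ?X"
  proof (rule inj_on_inverseI[where g = "act_chain (inv_into A h)"])
    fix D assume "D \<in> ?X"
    then have "act_chain (inv_into A h \<circ> h) D = D"
      using X(2) hA(2) by (intro act_chain_eq_self) simp
    then show "act_chain (inv_into A h) (act_chain h D) = D" by (simp only: act_chain_comp)
  qed
  show "act_chain h ` ?X \<subseteq> fixed_chains T B \<sigma>'"
  proof (rule image_subsetI)
    fix D assume D: "D \<in> ?X"
    have "act_chain h (act_chain \<sigma> D) = act_chain \<sigma>' (act_chain h D)"
      unfolding act_chain_comp[symmetric] by (rule act_chain_cong) (use s X(2)[OF D] in simp)
    then show "act_chain h D \<in> fixed_chains T B \<sigma>'"
      using act_chain_partial_chains[OF X(1)[OF D], of h] hA X(2,3)[OF D]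
      by (simp add: spanning_chains_def Union_act_chain)
  qed
  show "finite (fixed_chains T B \<sigma>')"
    by (rule finite_subset[OF _ finite_partial_chains[OF assms(1), of T]]) (auto simp: spanning_chains_def)
qed

lemma spanning_chains_transfer:
  assumes "finite B" and h: "bij_betw h B A" and s: "\<And>x. x \<in> B \<Longrightarrow> \<sigma>' x \<in> B \<and> h (\<sigma>' x) = \<sigma> (h x)"
  shows "card (fixed_chains T A \<sigma>) = card (fixed_chains T B \<sigma>')"
proof (rule order_antisym)
  show "card (fixed_chains T B \<sigma>') \<le> card (fixed_chains T A \<sigma>)"
    using bij_betw_finite[OF h] assms(1) s by (intro spanning_chains_le_transfer[OF _ h]) auto
  show "card (fixed_chains T A \<sigma>) \<le> card (fixed_chains T B \<sigma>')"
  proof (rule spanning_chains_le_transfer[OF assms(1) bij_betw_inv_into[OF h]])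
    show "inv_into B h (\<sigma> y) = \<sigma>' (inv_into B h y)" if "y \<in> A" for y
      using s[OF bij_betw_apply[OF bij_betw_inv_into[OF h] that]] bij_betw_inv_into_right[OF h that]
        bij_betw_inv_into_left[OF h] by metis
  qed
qed

text \<open>The Young character of \<open>(n - k, \<gamma>)\<close> is induced: the first colour class is the
  complement of an invariant \<open>k\<close>-subset.\<close>

abbreviation induced_young_char :: "nat \<Rightarrow> nat \<Rightarrow> (nat \<Rightarrow> nat) \<Rightarrow> (nat \<Rightarrow> nat) \<Rightarrow> int" where
  "induced_young_char n k \<gamma> \<equiv> young_char n (int (n - k) # map (int \<circ> \<gamma>) [0..<k])"

lemma induced_young_char_eq_sum:
  assumes "\<sigma> permutes {1..n}" "k \<le> n" "(\<Sum>j<k. \<gamma> j) = k"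
  shows "induced_young_char n k \<gamma> \<sigma> =
    (\<Sum>A | A \<subseteq> {1..n} \<and> card A = k \<and> \<sigma> ` A = A. int (fixcol A {..<k} \<gamma> \<sigma>))"
proof -
  let ?N = "{1..n}" and ?I = "{A. A \<subseteq> {1..n} \<and> card A = k \<and> \<sigma> ` A = A}"
  define m where "m j = (case j of 0 \<Rightarrow> n - k | Suc i \<Rightarrow> \<gamma> i)" for j
  let ?X = "fixed_colorings ?N {..<Suc k} m \<sigma>"
  let ?supp = "\<lambda>f. {x\<in>?N. f x \<noteq> (0::nat)}"
  let ?a = "int (n - k) # map (int \<circ> \<gamma>) [0..<k]"
  have "(\<lambda>j. nat (?a ! j)) j = m j" if "j < Suc k" for j
    using that by (cases j) (auto simp: m_def)
  then have "colorings ?N {..<Suc k} (\<lambda>j. nat (?a ! j)) = colorings ?N {..<Suc k} m"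
    unfolding colorings_def by (intro Collect_cong conj_cong refl ball_cong) auto
  then have "young_char n ?a \<sigma> = int (card ?X)"
    by (subst young_char_eq_fixcol) (auto simp: fixcol_def)
  also have "card ?X = (\<Sum>A\<in>?I. card {f\<in>?X. ?supp f = A})"
  proof (rule card_eq_sum_fibres)
    show "finite ?I" by (rule finite_subset[of _ "Pow ?N"]) auto
    fix f assume f: "f \<in> ?X"
    have "card (?supp f) = n - card {x\<in>?N. f x = 0}"
    proof -
      have "?supp f = ?N - {x\<in>?N. f x = 0}" by auto
      moreover have "card (?N - {x\<in>?N. f x = 0}) = card ?N - card {x\<in>?N. f x = 0}"
        by (rule card_Diff_subset) auto
      ultimately show ?thesis by (simp only: card_atLeastAtMost diff_Suc_1)
    qed
    moreover have "card {x\<in>?N. f x = 0} = n - k" using f by (auto simp: colorings_def m_def)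
    moreover have "\<sigma> ` ?supp f = ?supp f"
    proof (rule card_subset_eq)
      show "\<sigma> ` ?supp f \<subseteq> ?supp f" using f assms(1) permutes_in_image[OF assms(1)] by auto
      show "card (\<sigma> ` ?supp f) = card (?supp f)" using assms(1) by (intro card_image) (simp add: permutes_inj_on)
    qed simp
    ultimately show "?supp f \<in> ?I" using assms(2) by auto
  qed simp
  also have "\<dots> = (\<Sum>A\<in>?I. fixcol A {..<k} \<gamma> \<sigma>)"
  proof (rule sum.cong)
    fix A assume "A \<in> ?I"
    then have A: "A \<subseteq> ?N" "card A = k" "\<sigma> ` A = A" by auto
    have \<sigma>A: "\<sigma> x \<in> A \<longleftrightarrow> x \<in> A" for x
      using A(3) permutes_inj[OF assms(1)] by (metis inj_image_mem_iff)
    have cA: "card (?N - A) = n - k" using A by (simp add: card_Diff_subset finite_subset[OF A(1)])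
    \<comment> \<open>Colour 0 marks the complement of \<open>A\<close>, so the colours on
      \<open>A\<close> are shifted down by one, and up by one in the inverse.\<close>
    let ?d = "\<lambda>f. restrict (\<lambda>x. f x - 1) A" and ?u = "\<lambda>f. restrict (\<lambda>x. if x \<in> A then Suc (f x) else 0) ?N"
    show "card {f\<in>?X. ?supp f = A} = fixcol A {..<k} \<gamma> \<sigma>"
      unfolding fixcol_def
    proof (rule bij_betw_same_card, rule bij_betw_byWitness[where f = ?d and f' = ?u])
      have supp: "x \<in> A \<longleftrightarrow> x \<in> ?N \<and> f x \<noteq> 0" if "?supp f = A" for f x using that by blast
      show "\<forall>f\<in>{f\<in>?X. ?supp f = A}. ?u (?d f) = f"
      proof
        fix f assume "f \<in> {f\<in>?X. ?supp f = A}"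
        then have f: "f \<in> ?N \<rightarrow>\<^sub>E {..<Suc k}" "?supp f = A" by (auto simp: colorings_def)
        show "?u (?d f) = f"
        proof
          fix x
          show "?u (?d f) x = f x"
            using supp[OF f(2), of x] PiE_arb[OF f(1), of x] by (cases "x \<in> ?N") auto
        qed
      qed
      show "\<forall>f\<in>fixed_colorings A {..<k} \<gamma> \<sigma>. ?d (?u f) = f"
      proof
        fix f assume "f \<in> fixed_colorings A {..<k} \<gamma> \<sigma>"
        then have f: "f \<in> A \<rightarrow>\<^sub>E {..<k}" unfolding colorings_def by blast
        show "?d (?u f) = f"
        proof
          fix x
          show "?d (?u f) x = f x"
            using A(1) PiE_arb[OF f, of x] by (cases "x \<in> A") auto
        qed
      qed
      show "?d ` {f\<in>?X. ?supp f = A} \<subseteq> fixed_colorings A {..<k} \<gamma> \<sigma>"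
      proof (rule image_subsetI)
        fix f assume "f \<in> {f\<in>?X. ?supp f = A}"
        then have f: "f \<in> colorings ?N {..<Suc k} m" "\<And>x. x \<in> ?N \<Longrightarrow> f (\<sigma> x) = f x" "?supp f = A" by blast+
        have fk: "f x < Suc k" if "x \<in> ?N" for x using f(1) that by (auto simp: colorings_def)
        have f0: "f x \<noteq> 0" if "x \<in> A" for x using f(3) that by blast
        have "x \<in> A \<and> ?d f x = j \<longleftrightarrow> x \<in> ?N \<and> f x = Suc j" for x j
          using supp[OF f(3), of x] by auto
        then have "{x\<in>A. ?d f x = j} = {x\<in>?N. f x = Suc j}" for j by blast
        moreover have "card {x\<in>?N. f x = Suc j} = \<gamma> j" if "j < k" for j
          using f(1) that by (auto simp: colorings_def m_def)
        moreover have "f x - 1 < k" if "x \<in> A" for x using fk[of x] f0[OF that] A(1) that by fastforce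
        moreover have "f (\<sigma> x) = f x" if "x \<in> A" for x using f(2) A(1) that by blast
        ultimately show "?d f \<in> fixed_colorings A {..<k} \<gamma> \<sigma>"
          using \<sigma>A by (simp add: colorings_def)
      qed
      show "?u ` (fixed_colorings A {..<k} \<gamma> \<sigma>) \<subseteq> {f\<in>?X. ?supp f = A}"
      proof (rule image_subsetI)
        fix f assume f: "f \<in> fixed_colorings A {..<k} \<gamma> \<sigma>"
        have fk: "f x < k" if "x \<in> A" for x using f that by (auto simp: colorings_def)
        have "card {x\<in>?N. ?u f x = j} = m j" if "j < Suc k" for j
        proof (cases j)
          case 0
          then have "{x\<in>?N. ?u f x = j} = ?N - A" by auto
          then show ?thesis using cA 0 by (simp add: m_def)
        next
          case (Suc i)
          then have "{x\<in>?N. ?u f x = j} = {x\<in>A. f x = i}" using A(1) by auto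
          then show ?thesis using f Suc that by (simp add: m_def colorings_def)
        qed
        moreover have "?supp (?u f) = A" using A(1) by auto
        moreover have "?u f \<in> ?N \<rightarrow>\<^sub>E {..<Suc k}" using fk by auto
        moreover have "\<forall>x\<in>?N. ?u f (\<sigma> x) = ?u f x"
          using f \<sigma>A permutes_in_image[OF assms(1)] by auto
        ultimately show "?u f \<in> {f\<in>?X. ?supp f = A}" by (simp add: colorings_def)
      qed
    qed
  qed simp
  finally show ?thesis by (simp only: of_nat_sum)
qed

text \<open>The fixed chains are sorted by their support \<open>A\<close>, which
  \<open>\<sigma>\<close> preserves and which has at most 2i points; for each \<open>A\<close> the
  count is the fixed-point count of the restriction of \<open>\<sigma>\<close>.\<close>

lemma alphaT_eq_sum_young_char:
  assumes "T \<subseteq> {..i}" "0 < i"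
    and a: "young_coeffs T a"
    and n: "4 * i \<le> n" and \<sigma>: "\<sigma> permutes {1..n}"
  shows "alphaT n T \<sigma> = (\<Sum>k\<le>2 * i. \<Sum>\<gamma>\<in>parts k. a k \<gamma> *
    induced_young_char n k \<gamma> \<sigma>)"
proof -
  let ?I = "\<lambda>k. {A. A \<subseteq> {1..n} \<and> card A = k \<and> \<sigma> ` A = A}"
  have finI: "finite (?I k)" for k by (rule finite_subset[of _ "Pow {1..n}"]) auto
  let ?X = "{D \<in> partial_chains T. \<Union>(\<Union>D) \<subseteq> {1..n} \<and> act_chain \<sigma> D = D}"
  have finX: "finite ?X" by (rule finite_subset[OF _ finite_partial_chains[of "{1..n}" T]]) auto
  have "T \<subseteq> {..<n}" using assms(1,2) n by auto
  then have "alphaT n T \<sigma> = int (card ?X)" using alphaT_eq_partial_chains \<sigma> by blast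
  also have "card ?X = (\<Sum>A\<in>(\<Union>k\<le>2*i. ?I k). card {D\<in>?X. \<Union>(\<Union>D) = A})"
  proof (rule card_eq_sum_fibres[OF finX])
    show "finite (\<Union>k\<le>2*i. ?I k)" using finI by blast
    fix D assume "D \<in> ?X"
    then show "\<Union>(\<Union>D) \<in> (\<Union>k\<le>2*i. ?I k)"
      using card_Union_partial_chain_le[OF _ assms(1), of D n] Union_act_chain[of \<sigma> D] by auto
  qed
  also have "\<dots> = (\<Sum>k\<le>2*i. \<Sum>A\<in>?I k. card {D\<in>?X. \<Union>(\<Union>D) = A})"
    using finI by (intro sum.UNION_disjoint) auto
  also have "int \<dots> = (\<Sum>k\<le>2*i. \<Sum>A\<in>?I k. int (card {D\<in>?X. \<Union>(\<Union>D) = A}))" by simp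
  also have "\<dots> = (\<Sum>k\<le>2*i. \<Sum>A\<in>?I k. \<Sum>\<gamma>\<in>parts k. a k \<gamma> * int (fixcol A {..<k} \<gamma> \<sigma>))"
  proof (intro sum.cong refl)
    fix k A assume "A \<in> ?I k"
    then have A: "A \<subseteq> {1..n}" "card A = k" "\<sigma> ` A = A" by auto
    have "finite A" using A(1) finite_subset by blast
    then obtain h where h: "bij_betw h {1..k} A"
      using A(2) by (metis card_atLeastAtMost diff_Suc_1 finite_atLeastAtMost finite_same_card_bij)
    let ?g = "inv_into {1..k} h"
    \<comment> \<open>The restriction of \<open>\<sigma>\<close> to \<open>A\<close>, carried over
      to {1..k}, where the coefficients \<open>a\<close> are known.\<close>
    define \<sigma>' where "\<sigma>' = map_permutation A ?g (restrict_id \<sigma> A)"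
    have g: "bij_betw ?g A {1..k}" using h by (rule bij_betw_inv_into)
    have "bij_betw \<sigma> A A" using A(3) permutes_inj_on[OF \<sigma>] by (simp add: bij_betw_def)
    then have \<sigma>': "\<sigma>' permutes {1..k}"
      unfolding \<sigma>'_def by (intro map_permutation_permutes[OF g] permutes_restrict_id)
    have s: "\<sigma>' x \<in> {1..k} \<and> h (\<sigma>' x) = \<sigma> (h x)" if "x \<in> {1..k}" for x
    proof -
      have hx: "h x \<in> A" "?g (h x) = x"
        using bij_betw_apply[OF h that] bij_betw_inv_into_left[OF h that] by auto
      then have "\<sigma>' x = ?g (\<sigma> (h x))"
        using map_permutation_apply[OF bij_betw_imp_inj_on[OF g] hx(1)] by (simp add: \<sigma>'_def)
      moreover have "\<sigma> (h x) \<in> A" using A(3) hx(1) by blast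
      ultimately show ?thesis
        using bij_betw_inv_into_right[OF h] permutes_in_image[OF \<sigma>', of x] that by metis
    qed
    have "{D\<in>?X. \<Union>(\<Union>D) = A} = fixed_chains T A \<sigma>"
      using A(1) by (auto simp: spanning_chains_def)
    then have "int (card {D\<in>?X. \<Union>(\<Union>D) = A}) = int (card (fixed_chains T {1..k} \<sigma>'))"
      using spanning_chains_transfer[of "{1..k}" h A \<sigma>' \<sigma> T, OF _ h s] by simp
    also have "\<dots> = (\<Sum>\<gamma>\<in>parts k. a k \<gamma> * int (fixcol {1..k} {..<k} \<gamma> \<sigma>'))"
      using a \<sigma>' by (simp add: young_coeffs_def)
    also have "\<dots> = (\<Sum>\<gamma>\<in>parts k. a k \<gamma> * int (fixcol A {..<k} \<gamma> \<sigma>))"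
    proof -
      have "fixcol A {..<k} \<gamma> \<sigma> = fixcol {1..k} {..<k} \<gamma> \<sigma>'" for \<gamma>
        using h s by (intro fixcol_transfer[where h = h and k = id]) auto
      then show ?thesis by simp
    qed
    finally show "int (card {D\<in>?X. \<Union>(\<Union>D) = A}) = (\<Sum>\<gamma>\<in>parts k. a k \<gamma> * int (fixcol A {..<k} \<gamma> \<sigma>))" .
  qed
  also have "\<dots> = (\<Sum>k\<le>2*i. \<Sum>\<gamma>\<in>parts k. \<Sum>A\<in>?I k. a k \<gamma> * int (fixcol A {..<k} \<gamma> \<sigma>))"
    by (intro sum.cong refl sum.swap)
  also have "\<dots> = (\<Sum>k\<le>2 * i. \<Sum>\<gamma>\<in>parts k. a k \<gamma> *
    induced_young_char n k \<gamma> \<sigma>)"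
  proof (intro sum.cong refl)
    fix k \<gamma> assume "k \<in> {..2*i}" "\<gamma> \<in> parts k"
    then have "k \<le> n" "(\<Sum>j<k. \<gamma> j) = k" using n by (auto simp: parts_def)
    from induced_young_char_eq_sum[OF \<sigma> this]
    show "(\<Sum>A\<in>?I k. a k \<gamma> * int (fixcol A {..<k} \<gamma> \<sigma>)) =
      a k \<gamma> * induced_young_char n k \<gamma> \<sigma>"
      by (simp add: sum_distrib_left)
  qed
  finally show ?thesis .
qed

lemma alphaT_in_irr_span:
  assumes "T \<subseteq> {..i}" "0 < i"
  shows "in_irr_span (2 * i) (\<lambda>n \<sigma>. alphaT n T \<sigma>)"
proof -
  obtain a where a: "young_coeffs T a" using ex_young_coeffs by blast
  let ?b = "\<lambda>k \<gamma>. map (int \<circ> \<gamma>) [0..<k]"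
  have sum_b: "sum_list (?b k \<gamma>) = int k" if "\<gamma> \<in> parts k" for k \<gamma>
  proof -
    have "sum_list (?b k \<gamma>) = (\<Sum>j<k. int (\<gamma> j))" by (simp add: sum_list_sum_nth atLeast0LessThan)
    also have "\<dots> = int k" using that by (simp add: parts_def flip: of_nat_sum)
    finally show ?thesis .
  qed
  have "in_irr_span (2 * i) (\<lambda>n \<sigma>. \<Sum>k\<le>2 * i. \<Sum>\<gamma>\<in>parts k. a k \<gamma> *
      young_char n ((int n - sum_list (?b k \<gamma>)) # ?b k \<gamma>) \<sigma>)"
    using sum_b by (intro in_irr_span_sum in_irr_span_scale young_char_in_irr_span) auto
  then show ?thesis
  proof (rule in_irr_span_cong)
    fix n \<sigma> assume n: "2 * (2 * i) \<le> n" "\<sigma> permutes {1..n}"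
    have "alphaT n T \<sigma> = (\<Sum>k\<le>2 * i. \<Sum>\<gamma>\<in>parts k. a k \<gamma> * young_char n (int (n - k) # ?b k \<gamma>) \<sigma>)"
      using alphaT_eq_sum_young_char[OF assms a] n by simp
    also have "\<dots> = (\<Sum>k\<le>2 * i. \<Sum>\<gamma>\<in>parts k. a k \<gamma> * young_char n ((int n - sum_list (?b k \<gamma>)) # ?b k \<gamma>) \<sigma>)"
      using n sum_b by (intro sum.cong refl) (auto simp: of_nat_diff)
    finally show "alphaT n T \<sigma> = (\<Sum>k\<le>2 * i. \<Sum>\<gamma>\<in>parts k. a k \<gamma> *
      young_char n ((int n - sum_list (?b k \<gamma>)) # ?b k \<gamma>) \<sigma>)" .
  qed
qed

lemma betaS_stabilizes:
  assumes "S \<subseteq> {..i}" "0 < i"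
  shows "stabilizes_beyond (\<lambda>n. betaS n S) (4 * i)"
proof -
  have "in_irr_span (2 * i) (\<lambda>n \<sigma>. betaS n S \<sigma>)"
    unfolding betaS_def using assms
    by (intro in_irr_span_sum in_irr_span_scale alphaT_in_irr_span) auto
  then show ?thesis
    using in_irr_span_imp_stabilizes[of "2 * i"] assms(2) by simp
qed

subsection \<open>Multiplicity of the two-row shape with equal rows\<close>

text \<open>The complete homogeneous symmetric polynomial of degree \<open>z\<close> in the two
  variables 1 and t, with value 0 for negative \<open>z\<close> as in Jacobi-Trudi
  determinants.\<close>

definition hpoly :: "int \<Rightarrow> int poly" where
  "hpoly z = (if z < 0 then 0 else \<Sum>r\<le>nat z. monom 1 r)"

lemma coeff_hpoly: "coeff (hpoly z) k = (if int k \<le> z then 1 else 0)"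
  by (auto simp: hpoly_def coeff_sum)

text \<open>Reads off the generating function 1/((1 - u)(1 - tu)). At z = -1 it would fail, the left
  side being 1 and the right side 0.\<close>

lemma hpoly_recurrence:
  assumes "0 \<le> z"
  shows "hpoly (z + 1) = (1 + monom 1 1) * hpoly z - monom 1 1 * hpoly (z - 1)"
proof (rule poly_eqI)
  fix k
  show "coeff (hpoly (z + 1)) k = coeff ((1 + monom 1 1) * hpoly z - monom 1 1 * hpoly (z - 1)) k"
    using assms by (cases k) (auto simp: coeff_hpoly distrib_right coeff_monom_mult)
qed

lemma degree_hpoly:
  assumes "0 \<le> z"
  shows "degree (hpoly z) = nat z" "lead_coeff (hpoly z) = 1"
proof -
  show *: "degree (hpoly z) = nat z"
    using assms by (intro order_antisym degree_le le_degree) (auto simp: coeff_hpoly)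
  show "lead_coeff (hpoly z) = 1" unfolding * using assms by (simp add: coeff_hpoly)
qed

lemma degree_prod_list_hpoly:
  assumes "\<forall>x\<in>set b. 0 \<le> x"
  shows "degree (prod_list (map hpoly b)) = nat (sum_list b)" "lead_coeff (prod_list (map hpoly b)) = 1"
proof -
  have "degree (prod_list (map hpoly b)) = nat (sum_list b) \<and> lead_coeff (prod_list (map hpoly b)) = 1"
    using assms
  proof (induction b)
    case (Cons a b)
    then have "hpoly a \<noteq> 0" "prod_list (map hpoly b) \<noteq> 0"
      using degree_hpoly(2)[of a] by auto
    moreover have "0 \<le> sum_list b" using Cons.prems by (intro sum_list_nonneg) auto
    ultimately have "degree (prod_list (map hpoly (a # b))) = nat (sum_list (a # b))"
      using Cons degree_hpoly(1)[of a] by (simp add: degree_mult_eq nat_add_distrib)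
    moreover have "lead_coeff (prod_list (map hpoly b)) = 1" "lead_coeff (hpoly a) = 1"
      using Cons.IH Cons.prems degree_hpoly(2)[of a] by (meson list.set_intros)+
    then have "lead_coeff (hpoly a * prod_list (map hpoly b)) = 1"
      unfolding lead_coeff_mult by (simp only: mult_1_left)
    ultimately show ?case by simp
  qed simp
  then show "degree (prod_list (map hpoly b)) = nat (sum_list b)" "lead_coeff (prod_list (map hpoly b)) = 1" by auto
qed

text \<open>Multiplicity functional for the Schur polynomial of shape (N, N): at (1, t) the one of
  shape (p, q) with p + q = 2N is t^q + ... + t^p, whose coefficients at N and N - 1 differ only if
  q = N.\<close>

definition mid_diff :: "nat \<Rightarrow> int poly \<Rightarrow> int" where
  "mid_diff N p = coeff p N - coeff p (N - 1)"

text \<open>Up to degree N, multiplication by \<open>hpoly z\<close> with z \<ge> N is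
  multiplication by 1/(1 - t), and taking the difference of neighbouring coefficients undoes
  it.\<close>

lemma mid_diff_hpoly_mult:
  assumes "0 < N" "int N \<le> z"
  shows "mid_diff N (hpoly z * q) = coeff q N"
proof -
  have c: "coeff (hpoly z * q) M = (\<Sum>i\<le>M. coeff q (M - i))" if "M \<le> N" for M
    unfolding coeff_mult using assms that by (intro sum.cong) (auto simp: coeff_hpoly)
  obtain M where M: "N = Suc M" using assms(1) by (cases N) auto
  have "coeff (hpoly z * q) N = (\<Sum>i\<le>Suc M. coeff q (Suc M - i))"
    using c[of N] by (simp add: M)
  also have "\<dots> = coeff q N + (\<Sum>i\<le>M. coeff q (M - i))"
    by (simp add: M sum.atMost_Suc_shift del: sum.atMost_Suc)
  finally have "coeff (hpoly z * q) N = coeff q N + (\<Sum>i\<le>M. coeff q (M - i))" .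
  then show ?thesis using c[of M] by (simp add: mid_diff_def M)
qed

section \<open>Scalar products with two-row Young characters\<close>

lemma card_eq_coeff_prod_hpoly:
  fixes l b :: nat
  shows
  "int (card {x \<in> {..<l} \<rightarrow>\<^sub>E UNIV. (\<forall>j<l. x j \<le> m j) \<and> (\<Sum>j<l. x j) = b}) =
    coeff (\<Prod>j<l. hpoly (int (m j))) b"
proof -
  let ?P = "PiE {..<l} (\<lambda>j. {..m j})"
  have "(\<Prod>j<l. hpoly (int (m j))) = (\<Prod>j<l. \<Sum>r\<in>{..m j}. monom 1 r)" by (simp add: hpoly_def)
  also have "\<dots> = (\<Sum>x\<in>?P. \<Prod>j<l. monom 1 (x j))" by (rule prod_sum_PiE) auto
  also have "\<dots> = (\<Sum>x\<in>?P. monom 1 (\<Sum>j<l. x j))"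
  proof (rule sum.cong)
    fix x :: "nat \<Rightarrow> nat"
    show "(\<Prod>j<l. monom (1::int) (x j)) = monom 1 (\<Sum>j<l. x j)"
      by (induction l) (simp_all add: mult_monom one_poly_eq_simps(2)[symmetric] monom_0)
  qed simp
  finally have "coeff (\<Prod>j<l. hpoly (int (m j))) b = (\<Sum>x\<in>?P. if (\<Sum>j<l. x j) = b then 1 else 0)"
    by (simp add: coeff_sum)
  also have "\<dots> = int (card {x\<in>?P. (\<Sum>j<l. x j) = b})"
    by (simp add: sum.If_cases Int_def finite_PiE)
  also have "{x\<in>?P. (\<Sum>j<l. x j) = b} =
     {x \<in> {..<l} \<rightarrow>\<^sub>E UNIV. (\<forall>j<l. x j \<le> m j) \<and> (\<Sum>j<l. x j) = b}"
    by (auto simp: PiE_iff)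
  finally show ?thesis by simp
qed

text \<open>Mackey's formula for two Young characters. A pair of colourings is a colouring by pairs,
  sorted by the matrix of its fibre sizes; having only two columns and given row sums, the matrix is
  determined by its second column \<open>x\<close>.\<close>

lemma fixcol_mult:
  fixes l b :: nat
  assumes A: "finite A" and m: "(\<Sum>j<l. m j) = card A" and b: "b \<le> card A" and \<sigma>: "\<sigma> permutes A"
  shows "fixcol A {..<l} m \<sigma> * fixcol A {..<2::nat} (\<lambda>c. if c = 0 then card A - b else b) \<sigma> =
    (\<Sum>x | x \<in> {..<l} \<rightarrow>\<^sub>E UNIV \<and> (\<forall>j<l. x j \<le> m j) \<and> (\<Sum>j<l. x j) = b.
      fixcol A ({..<l} \<times> {..<2::nat}) (\<lambda>(j, c). if c = 0 then m j - x j else x j) \<sigma>)"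
proof -
  let ?m2 = "\<lambda>c::nat. if c = 0 then card A - b else b"
  let ?M = "\<lambda>x (j, c::nat). if c = 0 then m j - x j else x j"
  let ?X = "{x. x \<in> {..<l} \<rightarrow>\<^sub>E UNIV \<and> (\<forall>j<l. x j \<le> m j) \<and> (\<Sum>j<l. x j) = b}"
  define Q where "Q = {q \<in> A \<rightarrow>\<^sub>E ({..<l} \<times> {..<2::nat}). (\<forall>j<l. card {y\<in>A. fst (q y) = j} = m j) \<and>
     (\<forall>c<2. card {y\<in>A. snd (q y) = c} = ?m2 c) \<and> (\<forall>y\<in>A. q (\<sigma> y) = q y)}"
  have finQ: "finite Q" unfolding Q_def
    by (rule finite_subset[of _ "A \<rightarrow>\<^sub>E ({..<l} \<times> {..<2})"]) (auto intro!: finite_PiE simp: A)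
  have finX: "finite ?X"
  proof (rule finite_subset)
    show "?X \<subseteq> PiE {..<l} (\<lambda>j. {..m j})" by (auto simp: PiE_def)
  qed (simp add: finite_PiE)
  have "fixcol A {..<l} m \<sigma> * fixcol A {..<2} ?m2 \<sigma> =
    card (fixed_colorings A {..<l} m \<sigma> \<times> fixed_colorings A {..<2} ?m2 \<sigma>)"
    by (simp add: fixcol_def card_cartesian_product)
  also have "\<dots> = card Q"
  proof (rule bij_betw_same_card)
    let ?e = "\<lambda>(f, p). restrict (\<lambda>y. (f y, p y)) A"
    let ?d = "\<lambda>q. (restrict (\<lambda>y. fst (q y)) A, restrict (\<lambda>y. snd (q y)) A)"
    let ?FP = "fixed_colorings A {..<l} m \<sigma> \<times> fixed_colorings A {..<2} ?m2 \<sigma>"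
    show "bij_betw ?e ?FP Q"
    proof (rule bij_betw_byWitness[where f' = ?d])
      show "\<forall>fp\<in>?FP. ?d (?e fp) = fp"
        by (auto simp: colorings_def PiE_def extensional_def fun_eq_iff)
      show "\<forall>q\<in>Q. ?e (?d q) = q"
        by (auto simp: Q_def PiE_def extensional_def fun_eq_iff)
      have c: "{y. (y \<in> A \<longrightarrow> P y) \<and> y \<in> A} = {y\<in>A. P y}" for P by auto
      show "?e ` ?FP \<subseteq> Q"
        using permutes_in_image[OF \<sigma>] by (auto simp: Q_def c colorings_def)
      show "?d ` Q \<subseteq> ?FP"
      proof (rule image_subsetI)
        fix q assume q: "q \<in> Q"
        then have "q y \<in> {..<l} \<times> {..<2}" if "y \<in> A" for y using that by (auto simp: Q_def)
        then have "fst (q y) < l" "snd (q y) < 2" if "y \<in> A" for y using that by (auto simp: mem_Times_iff)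
        then show "?d q \<in> ?FP"
          using q permutes_in_image[OF \<sigma>] by (simp add: Q_def c colorings_def)
      qed
    qed
  qed
  also have "\<dots> = (\<Sum>x\<in>?X. card {q\<in>Q. (\<lambda>j\<in>{..<l}. card {y\<in>A. q y = (j, 1)}) = x})"
  proof (rule card_eq_sum_fibres[OF finQ finX])
    fix q assume q: "q \<in> Q"
    have qA: "q y \<in> {..<l} \<times> {..<2}" if "y \<in> A" for y using q that by (auto simp: Q_def)
    have "card {y\<in>A. q y = (j, 1)} \<le> m j" if "j < l" for j
    proof -
      have "card {y\<in>A. q y = (j, 1)} \<le> card {y\<in>A. fst (q y) = j}" using A by (intro card_mono) auto
      then show ?thesis using q that by (auto simp: Q_def)
    qed
    moreover have "(\<Sum>j<l. card {y\<in>A. q y = (j, 1)}) = b"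
    proof -
      have "b = card {y\<in>A. snd (q y) = 1}" using q by (auto simp: Q_def)
      also have "\<dots> = (\<Sum>j<l. card {y\<in>{y\<in>A. snd (q y) = 1}. fst (q y) = j})"
        using qA A by (intro card_eq_sum_fibres) (auto simp: mem_Times_iff)
      also have "\<dots> = (\<Sum>j<l. card {y\<in>A. q y = (j, 1)})"
        by (intro sum.cong arg_cong[of _ _ card]) (auto simp: prod_eq_iff)
      finally show ?thesis by simp
    qed
    ultimately show "(\<lambda>j\<in>{..<l}. card {y\<in>A. q y = (j, 1)}) \<in> ?X" by simp
  qed
  also have "\<dots> = (\<Sum>x\<in>?X. fixcol A ({..<l} \<times> {..<2::nat}) (?M x) \<sigma>)"
  proof (intro sum.cong refl)
    fix x assume "x \<in> ?X"
    then have x: "x \<in> {..<l} \<rightarrow>\<^sub>E UNIV" "\<And>j. j < l \<Longrightarrow> x j \<le> m j" "(\<Sum>j<l. x j) = b" by auto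
    have split: "card {y\<in>A. fst (q y) = j} = card {y\<in>A. q y = (j, 0)} + card {y\<in>A. q y = (j, 1)}"
      if "q \<in> A \<rightarrow>\<^sub>E ({..<l} \<times> {..<2::nat})" for q :: "'a \<Rightarrow> nat \<times> nat" and j
    proof -
      have "snd (q y) < 2" if "y \<in> A" for y using PiE_mem[OF \<open>q \<in> _\<close> that] by (auto simp: mem_Times_iff)
      then have "snd (q y) = 0 \<or> snd (q y) = 1" if "y \<in> A" for y using that by fastforce
      then have "{y\<in>A. fst (q y) = j} = {y\<in>A. q y = (j, 0)} \<union> {y\<in>A. q y = (j, 1)}"
        by (auto simp: prod_eq_iff)
      moreover have "card ({y\<in>A. q y = (j, 0)} \<union> {y\<in>A. q y = (j, 1)}) = 
        card {y\<in>A. q y = (j, 0)} + card {y\<in>A. q y = (j, 1)}"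
        using A by (intro card_Un_disjoint) auto
      ultimately show ?thesis by simp
    qed
    have "{q\<in>Q. (\<lambda>j\<in>{..<l}. card {y\<in>A. q y = (j, 1)}) = x} =
      fixed_colorings A ({..<l} \<times> {..<2::nat}) (?M x) \<sigma>"
    proof (intro equalityI subsetI)
      fix q assume "q \<in> {q\<in>Q. (\<lambda>j\<in>{..<l}. card {y\<in>A. q y = (j, 1)}) = x}"
      then have q: "q \<in> Q" "(\<lambda>j\<in>{..<l}. card {y\<in>A. q y = (j, 1)}) = x" by auto
      have "card {y\<in>A. q y = (j, 1)} = x j" if "j < l" for j using fun_cong[OF q(2), of j] that by simp
      moreover from this have "card {y\<in>A. q y = (j, 0)} = m j - x j" if "j < l" for j
        using split[of q j] q(1) that by (auto simp: Q_def)
      ultimately have "card {y\<in>A. q y = jc} = ?M x jc" if "jc \<in> {..<l} \<times> {..<2::nat}" for jc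
        using that by (auto simp: less_2_cases_iff)
      then show "q \<in> fixed_colorings A ({..<l} \<times> {..<2::nat}) (?M x) \<sigma>"
        using q(1) by (simp add: colorings_def Q_def)
    next
      fix q assume "q \<in> fixed_colorings A ({..<l} \<times> {..<2::nat}) (?M x) \<sigma>"
      then have q: "q \<in> A \<rightarrow>\<^sub>E ({..<l} \<times> {..<2::nat})"
        "\<And>jc. jc \<in> {..<l} \<times> {..<2::nat} \<Longrightarrow> card {y\<in>A. q y = jc} = ?M x jc" "\<forall>y\<in>A. q (\<sigma> y) = q y"
        by (auto simp: colorings_def)
      have q1: "card {y\<in>A. q y = (j, 1)} = x j" if "j < l" for j using q(2)[of "(j, 1)"] that by simp
      have q0: "card {y\<in>A. q y = (j, 0)} = m j - x j" if "j < l" for j using q(2)[of "(j, 0)"] that by simp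
      have f: "card {y\<in>A. fst (q y) = j} = m j" if "j < l" for j
        using split[OF q(1)] q0[OF that] q1[OF that] x(2)[OF that] by simp
      have s: "card {y\<in>A. snd (q y) = c} = (\<Sum>j<l. card {y\<in>A. q y = (j, c)})" for c
      proof -
        have "card {y\<in>A. snd (q y) = c} = (\<Sum>j<l. card {y\<in>{y\<in>A. snd (q y) = c}. fst (q y) = j})"
          using PiE_mem[OF q(1)] A by (intro card_eq_sum_fibres) (auto simp: mem_Times_iff)
        also have "\<dots> = (\<Sum>j<l. card {y\<in>A. q y = (j, c)})"
          by (intro sum.cong arg_cong[of _ _ card]) (auto simp: prod_eq_iff)
        finally show ?thesis .
      qed
      have "card {y\<in>A. snd (q y) = 1} = b" using s[of 1] q1 x(3) by simp
      moreover have "card {y\<in>A. snd (q y) = 0} = card A - b"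
        using s[of 0] q0 m x(2,3) sum_subtractf_nat[of "{..<l}" x m] by simp
      ultimately have "card {y\<in>A. snd (q y) = c} = ?m2 c" if "c < 2" for c
        using that by (auto simp: less_2_cases_iff)
      moreover have "(\<lambda>j\<in>{..<l}. card {y\<in>A. q y = (j, 1)}) = x"
        using q1 x(1) by (auto simp: fun_eq_iff PiE_def extensional_def)
      ultimately show "q \<in> {q\<in>Q. (\<lambda>j\<in>{..<l}. card {y\<in>A. q y = (j, 1)}) = x}"
        using q f by (simp add: Q_def)
    qed
    then show "card {q\<in>Q. (\<lambda>j\<in>{..<l}. card {y\<in>A. q y = (j, 1)}) = x} = fixcol A ({..<l} \<times> {..<2::nat}) (?M x) \<sigma>"
      by (simp add: fixcol_def)
  qed
  finally show ?thesis .
qed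

text \<open>Each matrix contributes n! by transitivity, so the scalar product is the number of
  possible second columns, a coefficient of a product of polynomials h(1, t).\<close>

lemma sum_young_char_mult:
  assumes "sum_list a = int n" "b \<le> n"
  shows "(\<Sum>\<sigma> | \<sigma> permutes {1..n}. young_char n a \<sigma> * young_char n [int (n - b), int b] \<sigma>) =
    fact n * coeff (prod_list (map hpoly a)) b"
proof (cases "\<exists>x\<in>set a. x < 0")
  case True
  then have "prod_list (map hpoly a) = 0" by (auto simp: prod_list_zero_iff hpoly_def)
  moreover have "young_char n a \<sigma> = 0" for \<sigma> using True young_char_neg by blast
  ultimately show ?thesis by simp
next
  case False
  let ?A = "{1..n}" and ?l = "length a"
  define m where "m j = nat (a ! j)" for j
  have im: "int (m j) = a ! j" if "j < ?l" for j using False that by (auto simp: m_def not_less)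
  let ?m2 = "\<lambda>c::nat. if c = 0 then card ?A - b else b"
  let ?X = "{x. x \<in> {..<?l} \<rightarrow>\<^sub>E UNIV \<and> (\<forall>j<?l. x j \<le> m j) \<and> (\<Sum>j<?l. x j) = b}"
  let ?M = "\<lambda>x (j, c::nat). if c = 0 then m j - x j else x j"
  have "int (\<Sum>j<?l. m j) = int n"
    using assms(1) im by (simp add: sum_list_sum_nth atLeast0LessThan)
  then have sm: "(\<Sum>j<?l. m j) = card ?A" by (simp only: of_nat_eq_iff card_atLeastAtMost diff_Suc_1)
  have y1: "young_char n a \<sigma> = int (fixcol ?A {..<?l} m \<sigma>)" for \<sigma>
  proof -
    have "m = (\<lambda>j. nat (a ! j))" by (simp add: m_def fun_eq_iff)
    then show ?thesis using False young_char_eq_fixcol[of a n \<sigma>] by (auto simp: not_less)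
  qed
  have y2: "young_char n [int (n - b), int b] \<sigma> = int (fixcol ?A {..<2} ?m2 \<sigma>)" for \<sigma>
  proof -
    have "colorings ?A {..<2} (\<lambda>j. nat ([int (n - b), int b] ! j)) = colorings ?A {..<2} ?m2"
      unfolding colorings_def by (intro Collect_cong conj_cong refl ball_cong) (auto simp: less_2_cases_iff)
    then show ?thesis by (subst young_char_eq_fixcol) (auto simp: fixcol_def numeral_2_eq_2)
  qed
  have "(\<Sum>\<sigma> | \<sigma> permutes ?A. young_char n a \<sigma> * young_char n [int (n - b), int b] \<sigma>) =
     (\<Sum>\<sigma> | \<sigma> permutes ?A. int (\<Sum>x\<in>?X. fixcol ?A ({..<?l} \<times> {..<2}) (?M x) \<sigma>))"
    unfolding y1 y2 of_nat_mult[symmetric]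
    by (intro sum.cong refl arg_cong[of _ _ int] fixcol_mult) (use sm assms(2) in auto)
  also have "\<dots> = (\<Sum>x\<in>?X. int (\<Sum>\<sigma> | \<sigma> permutes ?A. fixcol ?A ({..<?l} \<times> {..<2}) (?M x) \<sigma>))"
    unfolding of_nat_sum by (rule sum.swap)
  also have "\<dots> = (\<Sum>x\<in>?X. fact n)"
  proof (intro sum.cong refl)
    fix x assume x: "x \<in> ?X"
    have "sum (?M x) ({..<?l} \<times> {..<2}) = (\<Sum>j<?l. \<Sum>c<2. ?M x (j, c))"
      by (simp add: sum.cartesian_product)
    also have "\<dots> = (\<Sum>j<?l. m j)" using x by (intro sum.cong) (auto simp: numeral_2_eq_2)
    finally have "(\<Sum>\<sigma> | \<sigma> permutes ?A. fixcol ?A ({..<?l} \<times> {..<2}) (?M x) \<sigma>) = fact (card ?A)"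
      using sm by (intro sum_fixcol) auto
    then show "int (\<Sum>\<sigma> | \<sigma> permutes ?A. fixcol ?A ({..<?l} \<times> {..<2}) (?M x) \<sigma>) = fact n" by simp
  qed
  also have "\<dots> = fact n * int (card ?X)" by simp
  also have "int (card ?X) = coeff (\<Prod>j<?l. hpoly (int (m j))) b"
    using card_eq_coeff_prod_hpoly[of ?l m b] by simp
  also have "(\<Prod>j<?l. hpoly (int (m j))) = prod_list (map hpoly a)"
    using im by (simp add: prod.list_conv_set_nth atLeast0LessThan)
  finally show ?thesis .
qed

section \<open>Jacobi-Trudi determinants in two variables\<close>

lemma signed_sum_equal_columns:
  fixes H :: "nat \<Rightarrow> nat \<Rightarrow> 'r::comm_ring_1"
  assumes "c < l" "d < l" "c \<noteq> d" "\<phi> c = \<phi> d"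
  shows "(\<Sum>w | w permutes {..<l}. of_int (sign w) * (\<Prod>j<l. H j (\<phi> (w j)))) = 0"
proof -
  have "\<phi> (Transposition.transpose c d x) = \<phi> x" for x using assms(4) by (auto simp: transpose_def)
  then have "(\<Sum>w | w permutes {..<l} \<and> True. of_int (sign w) * (\<Prod>j<l. H j (\<phi> (w j)))) = 0"
    using assms(1-3) by (intro sum_permutes_transpose_eq_0) auto
  then show ?thesis by simp
qed

text \<open>In two variables the complete symmetric polynomials satisfy a two-term recurrence,
  so the last three columns of the Jacobi-Trudi matrix are linearly dependent.\<close>

lemma jacobi_trudi_two_variables_vanishes:
  assumes "3 \<le> l" "\<And>j. j < l \<Longrightarrow> 1 \<le> \<mu> j"
  shows "(\<Sum>w | w permutes {..<l}. of_int (sign w) * (\<Prod>j<l. hpoly (\<mu> j - int j + int (w j)))) = 0"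
proof -
  obtain r where r: "l = Suc (Suc (Suc r))" using assms(1) by (metis Suc_le_D numeral_3_eq_3 Suc_le_mono)
  define H where "H j c = hpoly (\<mu> j - int j + int c)" for j c
  \<comment> \<open>Both functions redirect the last column, \<open>\<phi>1\<close> to the one
    before it and \<open>\<phi>2\<close> to the one before that.\<close>
  define \<phi>1 where "\<phi>1 c = (if c = Suc (Suc r) then Suc r else c)" for c
  define \<phi>2 where "\<phi>2 c = (if c = Suc (Suc r) then r else c)" for c
  let ?t = "monom (1::int) 1"
  \<comment> \<open>The recurrence needs \<mu> j - j + r + 1 \<ge> 0; this holds because j \<le> r +
    2 and the parts are positive.\<close>
  have rec: "H j (Suc (Suc r)) = (1 + ?t) * H j (Suc r) - ?t * H j r" if "j < l" for j
    using hpoly_recurrence[of "\<mu> j - int j + int (Suc r)"] assms(2)[OF that] that r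
    by (simp add: H_def algebra_simps)
  have "(\<Prod>j<l. H j (w j)) = (1 + ?t) * (\<Prod>j<l. H j (\<phi>1 (w j))) - ?t * (\<Prod>j<l. H j (\<phi>2 (w j)))"
    if w: "w permutes {..<l}" for w
  proof -
    define u where "u = inv w (Suc (Suc r))"
    have wu: "w u = Suc (Suc r)" using permutes_inverses[OF w] by (simp add: u_def)
    then have u: "u \<in> {..<l}" using permutes_in_image[OF w, of u] r by simp
    have ne: "w j \<noteq> Suc (Suc r)" if "j \<noteq> u" for j using that wu permutes_inj[OF w] by (metis injD)
    let ?R = "\<Prod>j\<in>{..<l} - {u}. H j (w j)"
    have p: "(\<Prod>j<l. H j (\<phi> (w j))) = H u (\<phi> (Suc (Suc r))) * ?R"
      if "\<And>c. c \<noteq> Suc (Suc r) \<Longrightarrow> \<phi> c = c" for \<phi>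
      using u wu ne that by (simp add: prod.remove[of "{..<l}" u])
    have "(\<Prod>j<l. H j (w j)) = H u (Suc (Suc r)) * ?R" using p[of "\<lambda>c. c"] by simp
    also have "\<dots> = ((1 + ?t) * H u (Suc r) - ?t * H u r) * ?R" using rec[of u] u by simp
    also have "\<dots> = (1 + ?t) * (H u (Suc r) * ?R) - ?t * (H u r * ?R)"
      by (simp only: left_diff_distrib mult.assoc)
    also have "H u (Suc r) * ?R = (\<Prod>j<l. H j (\<phi>1 (w j)))" using p[of \<phi>1] by (simp add: \<phi>1_def)
    also have "H u r * ?R = (\<Prod>j<l. H j (\<phi>2 (w j)))" using p[of \<phi>2] by (simp add: \<phi>2_def)
    finally show ?thesis .
  qed
  then have "(\<Sum>w | w permutes {..<l}. of_int (sign w) * (\<Prod>j<l. H j (w j))) =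
    (1 + ?t) * (\<Sum>w | w permutes {..<l}. of_int (sign w) * (\<Prod>j<l. H j (\<phi>1 (w j)))) -
    ?t * (\<Sum>w | w permutes {..<l}. of_int (sign w) * (\<Prod>j<l. H j (\<phi>2 (w j))))"
    unfolding sum_distrib_left sum_subtractf[symmetric]
    by (intro sum.cong refl) (simp only: mem_Collect_eq right_diff_distrib mult.left_commute)
  moreover have "(\<Sum>w | w permutes {..<l}. of_int (sign w) * (\<Prod>j<l. H j (\<phi>1 (w j)))) = 0"
    by (rule signed_sum_equal_columns[of "Suc (Suc r)" _ "Suc r"]) (auto simp: r \<phi>1_def)
  moreover have "(\<Sum>w | w permutes {..<l}. of_int (sign w) * (\<Prod>j<l. H j (\<phi>2 (w j)))) = 0"
    by (rule signed_sum_equal_columns[of "Suc (Suc r)" _ r]) (auto simp: r \<phi>2_def)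
  ultimately show ?thesis by (simp add: H_def)
qed

text \<open>Up to the factor \<open>(2N)!\<close>, the multiplicity of the irreducible character
  of shape \<open>(N, N)\<close>.\<close>

definition mid_pairing :: "nat \<Rightarrow> ((nat \<Rightarrow> nat) \<Rightarrow> int) \<Rightarrow> int" where
  "mid_pairing N f = (\<Sum>\<sigma> | \<sigma> permutes {1..2 * N}. f \<sigma> *
     (young_char (2 * N) [int N, int N] \<sigma> - young_char (2 * N) [int (N + 1), int (N - 1)] \<sigma>))"

lemma mid_pairing_cong:
  assumes "\<And>\<sigma>. \<sigma> permutes {1..2 * N} \<Longrightarrow> f \<sigma> = g \<sigma>"
  shows "mid_pairing N f = mid_pairing N g"
  unfolding mid_pairing_def by (intro sum.cong refl arg_cong2[of _ _ _ _ "(*)"] assms) simp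

lemma mid_pairing_sum: "mid_pairing N (\<lambda>\<sigma>. \<Sum>i\<in>I. z i * f i \<sigma>) = (\<Sum>i\<in>I. z i * mid_pairing N (f i))"
proof -
  let ?Y = "\<lambda>\<sigma>. young_char (2 * N) [int N, int N] \<sigma> - young_char (2 * N) [int (N + 1), int (N - 1)] \<sigma>"
  have "mid_pairing N (\<lambda>\<sigma>. \<Sum>i\<in>I. z i * f i \<sigma>) =
    (\<Sum>\<sigma> | \<sigma> permutes {1..2 * N}. \<Sum>i\<in>I. z i * (f i \<sigma> * ?Y \<sigma>))"
    unfolding mid_pairing_def sum_distrib_right by (intro sum.cong refl) (rule mult.assoc)
  also have "\<dots> = (\<Sum>i\<in>I. \<Sum>\<sigma> | \<sigma> permutes {1..2 * N}. z i * (f i \<sigma> * ?Y \<sigma>))" by (rule sum.swap)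
  finally show ?thesis unfolding mid_pairing_def sum_distrib_left .
qed

lemma mid_pairing_diff: "mid_pairing N (\<lambda>\<sigma>. f \<sigma> - g \<sigma>) = mid_pairing N f - mid_pairing N g"
  unfolding mid_pairing_def sum_subtractf[symmetric] by (intro sum.cong refl left_diff_distrib)

lemma mid_pairing_young_char:
  assumes "sum_list a = int (2 * N)" "0 < N"
  shows "mid_pairing N (young_char (2 * N) a) = fact (2 * N) * mid_diff N (prod_list (map hpoly a))"
proof -
  have e: "2 * N - N = N" "2 * N - (N - 1) = N + 1" using assms(2) by auto
  show ?thesis
    using sum_young_char_mult[OF assms(1), of N] sum_young_char_mult[OF assms(1), of "N - 1"]
    unfolding mid_pairing_def mid_diff_def e
    by (simp add: right_diff_distrib sum_subtractf)
qed

lemma mid_diff_sum: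
  "mid_diff N (\<Sum>i\<in>I. of_int (z i) * p i) = (\<Sum>i\<in>I. z i * mid_diff N (p i))"
proof -
  have "coeff (of_int c * q) k = c * coeff q k" for c :: int and q k
    by (simp add: of_int_poly)
  then show ?thesis by (simp add: mid_diff_def coeff_sum sum_subtractf right_diff_distrib)
qed

text \<open>By linearity the determinant of Young characters becomes the same determinant with
  entries \<open>hpoly\<close>, which is a Schur polynomial in two variables when \<open>lam\<close>
  is a partition.\<close>

lemma mid_pairing_irr_char:
  assumes "sum_list lam = 2 * N" "0 < N"
  shows "mid_pairing N (irr_char (2 * N) lam) = fact (2 * N) *
    mid_diff N (\<Sum>w | w permutes {..<length lam}. of_int (sign w) *
      (\<Prod>j<length lam. hpoly (int (lam ! j) - int j + int (w j))))"
proof -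
  let ?l = "length lam"
  let ?a = "\<lambda>w. map (\<lambda>j. int (lam ! j) - int j + int (w j)) [0..<?l]"
  have sum_a: "sum_list (?a w) = int (2 * N)" if "w permutes {..<?l}" for w
  proof -
    have "sum_list (?a w) = (\<Sum>j<?l. int (lam ! j)) - (\<Sum>j<?l. int j) + (\<Sum>j<?l. int (w j))"
      by (simp add: sum_list_sum_nth atLeast0LessThan sum.distrib sum_subtractf)
    also have "(\<Sum>j<?l. int (w j)) = (\<Sum>j<?l. int j)" using sum.permute[OF that, of int] by (simp add: o_def)
    also have "(\<Sum>j<?l. int (lam ! j)) = int (sum_list lam)" by (simp add: sum_list_sum_nth atLeast0LessThan)
    finally show ?thesis using assms(1) by simp
  qed
  have prod_a: "prod_list (map hpoly (?a w)) = (\<Prod>j<?l. hpoly (int (lam ! j) - int j + int (w j)))" for w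
    by (simp add: prod.list_conv_set_nth atLeast0LessThan)
  have "mid_pairing N (irr_char (2 * N) lam) =
    mid_pairing N (\<lambda>\<sigma>. \<Sum>w | w permutes {..<?l}. sign w * young_char (2 * N) (?a w) \<sigma>)"
    by (rule mid_pairing_cong) (simp add: irr_char_def)
  also have "\<dots> = (\<Sum>w | w permutes {..<?l}. sign w * mid_pairing N (young_char (2 * N) (?a w)))"
    by (rule mid_pairing_sum)
  also have "\<dots> = (\<Sum>w | w permutes {..<?l}. sign w * (fact (2 * N) *
      mid_diff N (\<Prod>j<?l. hpoly (int (lam ! j) - int j + int (w j)))))"
    using mid_pairing_young_char[OF sum_a assms(2)] prod_a by (intro sum.cong refl) simp
  finally show ?thesis unfolding mid_diff_sum sum_distrib_left by (simp add: mult.left_commute)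
qed

text \<open>Three or more rows vanish in two variables. With at most two rows the strict inequality
  gives x > N, so the first factor cancels against the difference and what is left has degree below
  N; each term of the determinant vanishes by itself.\<close>

lemma mid_pairing_irr_char_eq_0:
  assumes "sum_list (x # xs) = 2 * N" "0 < N" "\<And>y. y \<in> set xs \<Longrightarrow> 0 < y \<and> y < x"
  shows "mid_pairing N (irr_char (2 * N) (x # xs)) = 0"
proof -
  let ?lam = "x # xs" and ?l = "length (x # xs)"
  let ?p = "\<lambda>w. \<Prod>j<?l. hpoly (int (?lam ! j) - int j + int (w j))"
  have "mid_diff N (\<Sum>w | w permutes {..<?l}. of_int (sign w) * ?p w) = 0"
  proof (cases "3 \<le> ?l")
    case True
    have pos: "0 < y" if "y \<in> set ?lam" for y
      using that assms(1,2) assms(3)[of "hd xs"] assms(3)[of y] by (cases xs) auto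
    then have "1 \<le> int (?lam ! j)" if "j < ?l" for j using nth_mem[OF that] by fastforce
    then show ?thesis
      using jacobi_trudi_two_variables_vanishes[OF True, of "\<lambda>j. int (?lam ! j)"] by (simp add: mid_diff_def)
  next
    case False
    then consider "xs = []" | y where "xs = [y]"
      by (cases xs; cases "tl xs") auto
    then have "mid_diff N (?p w) = 0" if "w permutes {..<?l}" for w
    proof cases
      case 1
      then show ?thesis
        using mid_diff_hpoly_mult[OF assms(2), of "int x + int (w 0)" 1] assms(1,2) by simp
    next
      case (2 y)
      then have xy: "x + y = 2 * N" "y < x" using assms by auto
      \<comment> \<open>As \<open>w 1\<close> is at most 1, the second factor has degree at most y,
        and y < N.\<close>
      have "w 1 < 2" using permutes_in_image[OF that, of 1] 2 by simp
      then have "coeff (hpoly (int y - 1 + int (w 1))) N = 0" using xy by (simp add: coeff_hpoly)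
      moreover have "?p w = hpoly (int x + int (w 0)) * hpoly (int y - 1 + int (w 1))"
        using 2 by (simp add: numeral_2_eq_2)
      ultimately show ?thesis
        using mid_diff_hpoly_mult[OF assms(2), of "int x + int (w 0)"] xy by simp
    qed
    then show ?thesis unfolding mid_diff_sum by simp
  qed
  then show ?thesis using mid_pairing_irr_char[OF assms(1,2)] by simp
qed

text \<open>The first factor has index 2N - k \<ge> N and cancels; what is left is the coefficient
  at N of a monic polynomial of degree k \<le> N.\<close>

lemma mid_pairing_induced_young_char:
  assumes "\<gamma> \<in> parts k" "k \<le> N" "0 < N"
  shows "mid_pairing N (induced_young_char (2 * N) k \<gamma>) =
    (if k = N then fact (2 * N) else 0)"
proof -
  let ?b = "map (int \<circ> \<gamma>) [0..<k]"
  have "sum_list ?b = (\<Sum>j<k. int (\<gamma> j))" by (simp add: sum_list_sum_nth atLeast0LessThan)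
  also have "\<dots> = int k" using assms(1) by (simp add: parts_def flip: of_nat_sum)
  finally have sb: "sum_list ?b = int k" .
  have nn: "\<forall>x\<in>set ?b. 0 \<le> x" by auto
  have d: "degree (prod_list (map hpoly ?b)) = k" "lead_coeff (prod_list (map hpoly ?b)) = 1"
    using degree_prod_list_hpoly[OF nn] unfolding sb by auto
  have "mid_diff N (prod_list (map hpoly (int (2 * N - k) # ?b))) = coeff (prod_list (map hpoly ?b)) N"
    using mid_diff_hpoly_mult[OF assms(3), of "int (2 * N - k)" "prod_list (map hpoly ?b)"] assms(2) by simp
  also have "\<dots> = (if k = N then 1 else 0)"
    using d assms(2) by (metis coeff_eq_0 le_neq_implies_less)
  finally have md: "mid_diff N (prod_list (map hpoly (int (2 * N - k) # ?b))) = (if k = N then 1 else 0)" .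
  have "sum_list (int (2 * N - k) # ?b) = int (2 * N)" using sb assms(2) by (simp add: of_nat_diff)
  from mid_pairing_young_char[OF this assms(3)] show ?thesis unfolding md by simp
qed

section \<open>Sharpness for a single rank\<close>

lemma spanning_chains_nonempty: "spanning_chains {i} {1..2 * i} \<noteq> {}"
proof -
  \<comment> \<open>The matching {1,2}, {3,4}, ... by i pairs, of rank i and covering all 2i
    points.\<close>
  define R where "R = (\<lambda>j. {2 * j + 1, 2 * j + 2}) ` {..<i}"
  have inj: "inj_on (\<lambda>j::nat. {2 * j + 1, 2 * j + 2}) {..<i}"
    by (auto simp: inj_on_def doubleton_eq_iff)
  have "disjoint R"
    unfolding R_def by (rule disjointI) (auto; presburger)
  then have "partial_part R" by (auto simp: partial_part_def R_def)
  moreover have "partial_rank R = i"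
    unfolding partial_rank_def R_def using inj by (simp add: sum.reindex)
  moreover have "\<Union>R = {1..2 * i}"
  proof (intro equalityI subsetI)
    fix x assume "x \<in> {1..2 * i}"
    then have "(x - 1) div 2 < i" "x = 2 * ((x - 1) div 2) + 1 \<or> x = 2 * ((x - 1) div 2) + 2" by auto
    then show "x \<in> \<Union>R" unfolding R_def by blast
  qed (auto simp: R_def)
  ultimately have "{R} \<in> spanning_chains {i} {1..2 * i}"
    by (auto simp: spanning_chains_def partial_chains_def finer_refl)
  then show ?thesis by blast
qed

text \<open>Only supports of the maximal size 2i survive the pairing, leaving (4i)! times the sum of
  their coefficients. By \<open>sum_fixcol\<close> that sum is also the average number of fixed
  chains spanning 2i points, which is positive because the identity fixes some.\<close>

lemma mid_pairing_alphaT: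
  assumes "0 < i"
  shows "mid_pairing (2 * i) (alphaT (4 * i) {i}) \<noteq> 0"
proof -
  let ?N = "2 * i"
  let ?fixed = "\<lambda>\<sigma>. card (fixed_chains {i} {1..?N} \<sigma>)"
  obtain a where a: "young_coeffs {i} a" using ex_young_coeffs by blast
  have "mid_pairing ?N (alphaT (4 * i) {i}) = mid_pairing ?N (\<lambda>\<sigma>. \<Sum>k\<le>?N. 1 * (\<Sum>\<gamma>\<in>parts k. a k \<gamma> *
    induced_young_char (2 * ?N) k \<gamma> \<sigma>))"
    by (rule mid_pairing_cong) (use alphaT_eq_sum_young_char[of "{i}" i a "4 * i"] a assms in simp)
  also have "\<dots> = (\<Sum>k\<le>?N. \<Sum>\<gamma>\<in>parts k. a k \<gamma> *
    mid_pairing ?N (induced_young_char (2 * ?N) k \<gamma>))"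
    unfolding mid_pairing_sum by simp
  also have "\<dots> = (\<Sum>k\<le>?N. \<Sum>\<gamma>\<in>parts k. a k \<gamma> * (if k = ?N then fact (2 * ?N) else 0))"
  proof (intro sum.cong refl)
    fix k \<gamma> assume "k \<in> {..?N}" "\<gamma> \<in> parts k"
    then have "mid_pairing ?N (induced_young_char (2 * ?N) k \<gamma>) =
        (if k = ?N then fact (2 * ?N) else 0)"
      using assms by (intro mid_pairing_induced_young_char) auto
    then show "a k \<gamma> * mid_pairing ?N (induced_young_char (2 * ?N) k \<gamma>) =
        a k \<gamma> * (if k = ?N then fact (2 * ?N) else 0)"
      by (simp only:)
  qed
  also have "\<dots> = (\<Sum>k\<le>?N. if k = ?N then (\<Sum>\<gamma>\<in>parts ?N. a ?N \<gamma>) * fact (2 * ?N) else 0)"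
    by (intro sum.cong refl) (auto simp: sum_distrib_right)
  finally have L: "mid_pairing ?N (alphaT (4 * i) {i}) = (\<Sum>\<gamma>\<in>parts ?N. a ?N \<gamma>) * fact (2 * ?N)"
    by (simp add: sum.delta)
  have "(\<Sum>\<sigma> | \<sigma> permutes {1..?N}. int (?fixed \<sigma>)) =
    (\<Sum>\<sigma> | \<sigma> permutes {1..?N}. \<Sum>\<gamma>\<in>parts ?N. a ?N \<gamma> * int (fixcol {1..?N} {..<?N} \<gamma> \<sigma>))"
    using a by (intro sum.cong) (auto simp: young_coeffs_def)
  also have "\<dots> = (\<Sum>\<gamma>\<in>parts ?N. a ?N \<gamma> * int (\<Sum>\<sigma> | \<sigma> permutes {1..?N}. fixcol {1..?N} {..<?N} \<gamma> \<sigma>))"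
    by (subst sum.swap) (simp add: sum_distrib_left)
  also have "\<dots> = (\<Sum>\<gamma>\<in>parts ?N. a ?N \<gamma> * fact ?N)"
    by (intro sum.cong refl) (simp add: sum_fixcol parts_def)
  finally have S: "(\<Sum>\<sigma> | \<sigma> permutes {1..?N}. int (?fixed \<sigma>)) = (\<Sum>\<gamma>\<in>parts ?N. a ?N \<gamma>) * fact ?N"
    by (simp add: sum_distrib_right)
  have "finite (spanning_chains {i} {1..?N})"
    by (rule finite_subset[OF _ finite_partial_chains[of "{1..?N}" "{i}"]]) (auto simp: spanning_chains_def)
  then have "0 < ?fixed id"
    using spanning_chains_nonempty[of i] by (simp add: act_chain_id card_gt_0_iff)
  moreover have "int (?fixed id) \<le> (\<Sum>\<sigma> | \<sigma> permutes {1..?N}. int (?fixed \<sigma>))"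
    by (rule member_le_sum) (auto simp: finite_permutations permutes_id[unfolded id_def])
  ultimately have "(\<Sum>\<gamma>\<in>parts ?N. a ?N \<gamma>) \<noteq> 0" using S by auto
  then show ?thesis unfolding L by simp
qed

lemma alphaT_empty: "alphaT n {} \<sigma> = 1"
proof -
  have "{C \<in> max_chains n {}. act_chain \<sigma> C = C} = {{}}"
    by (auto simp: max_chains_def is_chain_def rank_sel_def act_chain_def)
  then show ?thesis by (simp add: alphaT_def)
qed

text \<open>Both Young characters contain the trivial character once, so their contributions
  cancel.\<close>

lemma mid_pairing_1:
  assumes "0 < N"
  shows "mid_pairing N (\<lambda>_. 1) = 0"
proof -
  have "(\<Sum>\<sigma> | \<sigma> permutes {1..2 * N}. young_char (2 * N) [int N, int N] \<sigma>) = fact (2 * N)"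
    "(\<Sum>\<sigma> | \<sigma> permutes {1..2 * N}. young_char (2 * N) [int (N + 1), int (N - 1)] \<sigma>) = fact (2 * N)"
    by (rule sum_young_char; use assms in auto)+
  then show ?thesis unfolding mid_pairing_def mult_1 sum_subtractf by simp
qed

lemma mid_pairing_betaS:
  assumes "0 < i"
  shows "mid_pairing (2 * i) (betaS (4 * i) {i}) \<noteq> 0"
proof -
  have "betaS (4 * i) {i} = (\<lambda>\<sigma>. alphaT (4 * i) {i} \<sigma> - 1)"
    by (simp add: betaS_def Pow_insert alphaT_empty fun_eq_iff)
  moreover have "mid_pairing (2 * i) (\<lambda>_. 1) = 0" using assms by (simp add: mid_pairing_1)
  ultimately show ?thesis
    using mid_pairing_alphaT[OF assms] by (simp add: mid_pairing_diff)
qed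

lemma not_stabilizes_earlier:
  assumes "0 < n'" "n' < 4 * i"
  shows "\<not> stabilizes_beyond (\<lambda>n. betaS n {i}) n'"
proof
  assume "stabilizes_beyond (\<lambda>n. betaS n {i}) n'"
  then obtain c where c: "\<And>\<sigma>. \<sigma> permutes {1..4 * i} \<Longrightarrow> betaS (4 * i) {i} \<sigma> =
     (\<Sum>lam\<in>int_partitions n'. c lam * irr_char (4 * i) (shift_part lam (4 * i - n')) \<sigma>)"
    unfolding stabilizes_beyond_def using assms(2) by (meson less_imp_le)
  have "mid_pairing (2 * i) (irr_char (2 * (2 * i)) (shift_part lam (4 * i - n'))) = 0"
    if lam: "lam \<in> int_partitions n'" for lam
  proof -
    \<comment> \<open>n' > 0 guarantees a first row to which the shift is added.\<close>
    obtain x xs where x: "lam = x # xs"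
      using lam assms(1) by (cases lam) (auto simp: int_partitions_def is_int_partition_def)
    have p: "x + sum_list xs = n'" "\<And>y. y \<in> set xs \<Longrightarrow> 0 < y \<and> y \<le> x"
      using lam by (auto simp: x int_partitions_def is_int_partition_def)
    have "mid_pairing (2 * i) (irr_char (2 * (2 * i)) ((x + (4 * i - n')) # xs)) = 0"
    proof (rule mid_pairing_irr_char_eq_0)
      show "sum_list ((x + (4 * i - n')) # xs) = 2 * (2 * i)" using p(1) assms(2) by simp
      show "0 < 2 * i" using assms by simp
      show "0 < y \<and> y < x + (4 * i - n')" if "y \<in> set xs" for y
      proof -
        \<comment> \<open>A positive shift turns the weak inequality between the first row and the
          others into the strict one that forces the pairing to vanish.\<close>
        have "0 < 4 * i - n'" using assms(2) by simp
        then show ?thesis using p(2)[OF that] by linarith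
      qed
    qed
    then show ?thesis by (simp add: x shift_part_def)
  qed
  then have "mid_pairing (2 * i) (\<lambda>\<sigma>. \<Sum>lam\<in>int_partitions n'. c lam *
      irr_char (2 * (2 * i)) (shift_part lam (4 * i - n')) \<sigma>) = 0"
    unfolding mid_pairing_sum by simp
  moreover have "mid_pairing (2 * i) (betaS (4 * i) {i}) = mid_pairing (2 * i) (\<lambda>\<sigma>. \<Sum>lam\<in>int_partitions n'. c lam *
      irr_char (2 * (2 * i)) (shift_part lam (4 * i - n')) \<sigma>)"
    by (rule mid_pairing_cong) (use c in simp)
  ultimately show False using mid_pairing_betaS[of i] assms by simp
qed

theorem theorem1p7:
  fixes S :: "nat set" and i :: nat
  assumes "finite S" and "S \<noteq> {}" and "0 \<notin> S" and "Max S = i"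
  shows "stabilizes_beyond (\<lambda>n. betaS n S) (4 * i) \<and>
         (S = {i} \<longrightarrow> stabilizes_sharply_at (\<lambda>n. betaS n S) (i + 2) (4 * i))"
proof -
  have "i \<in> S" using assms Max_in by blast
  then have i: "0 < i" using assms(3) by (cases i) auto
  have "S \<subseteq> {..i}" using assms by auto
  then have stab: "stabilizes_beyond (\<lambda>n. betaS n S) (4 * i)" using i by (rule betaS_stabilizes)
  moreover have "stabilizes_sharply_at (\<lambda>n. betaS n S) (i + 2) (4 * i)" if "S = {i}"
    unfolding stabilizes_sharply_at_def using i stab not_stabilizes_earlier[of _ i] that by auto
  ultimately show ?thesis by blast
qed

end
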